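(* Let $S$ be an orthogonally complete inverse semigroup. Then $$K(S)\cong K(M_{\omega}(S)),$$ where $K(S)$ is the Grothendieck group of the commutative monoid of isomorphism classes of objects of $\mathbf{Proj}_S$ under $\bigoplus$, and $K(M_\omega(S))$ is the Grothendieck group of the commutative monoid $A(M_\omega(S))$ of $\mathcal{D}$-classes of idempotents of $M_\omega(S)$.
   Context: Inverse semigroups here have a zero $0$. $E(S)$ is the set of idempotents; $s\leq t$ iff $s=ts^{-1}s$; $s\perp t$ (orthogonal) iff $s^{-1}t=0=st^{-1}$. $S$ is orthogonally complete if every pair of orthogonal elements has a join and multiplication distributes over finite orthogonal joins. Idempotents satisfy $e\,\mathcal{D}\,f$ iff there is $s$ with $s^{-1}s=e$, $ss^{-1}=f$. MODULES. A pointed étale set $(X,p)$ is a set $X$ with a right action of $S$ satisfying $X\cdot S=X$, a function $p:X\to E(S)$ with $x\cdot p(x)=x$ and $p(x\cdot s)=s^{-1}p(x)s$, and an element $0_X$ with $p(0_X)=0$, $p(x)=0\Rightarrow x=0_X$, $0_X\cdot s=0_X$, $x\cdot0=0_X$. It is ordered by $x\leq y$ iff $x=y\cdot p(x)$; $x\perp y$ means $p(x)p(y)=0$; $x,y$ are strongly orthogonal if $x\perp y$, $x\vee y$ exists and $p(x\vee y)=p(x)\vee p(y)$. It is a premodule if (PRM1) whenever $x,y$ are strongly orthogonal and $s\in S$, $x\cdot s,y\cdot s$ are strongly orthogonal and $(x\vee y)\cdot s=(x\cdot s)\vee(y\cdot s)$, and (PRM2) whenever $s\perp t$ in $S$, $x\cdot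 s$ and $x\cdot t$ are strongly orthogonal for all $x$. It is a module if (M1) $x\perp y$ implies $x\vee y$ exists with $p(x\vee y)=p(x)\vee p(y)$, and (M2) $x\perp y$ implies $(x\vee y)\cdot s=x\cdot s\vee y\cdot s$. A module morphism $\alpha:(X,p)\to(Y,q)$ satisfies $\alpha(x\cdot s)=\alpha(x)\cdot s$, $q(\alpha(x))=p(x)$, $\alpha(0)=0$, and $\alpha(x\vee y)=\alpha(x)\vee\alpha(y)$ for $x\perp y$. For $e\in E(S)$ the right ideal $eS$, with action by multiplication and $p(s)=s^{-1}s$, is a premodule. For a premodule $X$, let $\overline{X}$ be the set of order ideals of the form $\{x_1,\dots,x_m\}^{\downarrow}=\{x:x\leq x_i\text{ for some }i\}$ with the $x_i$ pairwise orthogonal, let $\equiv$ be the smallest equivalence relation on $\overline{X}$ with $\{x_1,x_2,x_3,\dots,x_n\}^{\downarrow}\equiv\{x_1\vee x_2,x_3,\dots,x_n\}^{\downarrow}$ whenever $x_1,x_2$ are strongly orthogonal, and let $X^{\sharp}=\overline{X}/\!\equiv$, a module under $p^\sharp(\{x_1,\dots,x_m\}^{\downarrow})=\bigvee_i p(x_i)$ and $\{x_1,\dots,x_m\}^{\downarrow}\cdot s=\{x_1\cdot s,\dots,x_m\cdot s\}^{\downarrow}$. For modules $(X,p),(Y,q)$, $X\bigoplus Y=\{(x,y)\in X\times Y:p(x)q(y)=0\}$ with $(x,y)\cdot s=(x\cdot s,y\cdot s)$ and structure map $(x,y)\mapsto p(x)\vee q(y)$; it is a coproduct in the category of modules. $\mathbf{Proj}_S$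 is the full subcategory of modules isomorphic to $\bigoplus_{i=1}^n(e_iS)^{\sharp}$ for some $e_1,\dots,e_n\in E(S)$. MATRICES. $M_\omega(S)$ is the set of $\mathbb{N}\times\mathbb{N}$ matrices over $S$ with only finitely many non-zero entries such that $a^{-1}b=0$ for entries $a,b$ in distinct positions of the same row and $ab^{-1}=0$ for entries in distinct positions of the same column, with product $(AB)_{ij}=\bigvee_k a_{ik}b_{kj}$. It is an orthogonally complete inverse semigroup in which for any idempotents $E,F$ there are idempotents $E'\,\mathcal{D}\,E$, $F'\,\mathcal{D}\,F$ with $E'\perp F'$. $A(M_\omega(S))=E(M_\omega(S))/\mathcal{D}$ is a commutative monoid under $[E]+[F]=[E'\vee F']$ for such $E',F'$. *)

theory Defs
  imports "HOL-Algebra.Group" "HOL-Algebra.Lattice"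
begin

section \<open>Inverse semigroups with zero\<close>

record 'a zsemigroup = "'a partial_object" +
  smult :: "'a \<Rightarrow> 'a \<Rightarrow> 'a"  (infixl \<open>\<cdot>\<index>\<close> 70)
  szero :: 'a  (\<open>\<^bold>0\<index>\<close>)

locale inverse_semigroup_zero =
  fixes S (structure)
  assumes mult_closed: "\<lbrakk>s \<in> carrier S; t \<in> carrier S\<rbrakk> \<Longrightarrow> s \<cdot> t \<in> carrier S"
    and mult_assoc: "\<lbrakk>s \<in> carrier S; t \<in> carrier S; u \<in> carrier S\<rbrakk> \<Longrightarrow> (s \<cdot> t) \<cdot> u = s \<cdot> (t \<cdot> u)"
    and ex1_inverse: "s \<in> carrier S \<Longrightarrow> \<exists>!t. t \<in> carrier S \<and> s \<cdot> t \<cdot> s = s \<and> t \<cdot> s \<cdot> t = t"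
    and zero_closed: "\<^bold>0 \<in> carrier S"
    and zero_left: "s \<in> carrier S \<Longrightarrow> \<^bold>0 \<cdot> s = \<^bold>0"
    and zero_right: "s \<in> carrier S \<Longrightarrow> s \<cdot> \<^bold>0 = \<^bold>0"

definition sinv :: "('a, 'm) zsemigroup_scheme \<Rightarrow> 'a \<Rightarrow> 'a"
  where "sinv S s = (THE t. t \<in> carrier S \<and> s \<cdot>\<^bsub>S\<^esub> t \<cdot>\<^bsub>S\<^esub> s = s \<and> t \<cdot>\<^bsub>S\<^esub> s \<cdot>\<^bsub>S\<^esub> t = t)"

definition idems :: "('a, 'm) zsemigroup_scheme \<Rightarrow> 'a set"
  where "idems S = {e \<in> carrier S. e \<cdot>\<^bsub>S\<^esub> e = e}"

text \<open>The natural partial order, as an order structure, so that upper bounds and joins are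
  those of the library.\<close>

definition sord :: "('a, 'm) zsemigroup_scheme \<Rightarrow> 'a gorder"
  where "sord S = \<lparr>carrier = carrier S, eq = (=), le = (\<lambda>s t. s = t \<cdot>\<^bsub>S\<^esub> sinv S s \<cdot>\<^bsub>S\<^esub> s)\<rparr>"

definition sorth :: "('a, 'm) zsemigroup_scheme \<Rightarrow> 'a \<Rightarrow> 'a \<Rightarrow> bool"
  where "sorth S s t \<longleftrightarrow> sinv S s \<cdot>\<^bsub>S\<^esub> t = \<^bold>0\<^bsub>S\<^esub> \<and> s \<cdot>\<^bsub>S\<^esub> sinv S t = \<^bold>0\<^bsub>S\<^esub>"

definition has_join :: "('a, 'm) gorder_scheme \<Rightarrow> 'a set \<Rightarrow> bool"
  where "has_join L A \<longleftrightarrow> (\<exists>z. least L z (Upper L A))"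

locale orthogonally_complete = inverse_semigroup_zero +
  assumes orth_join: "\<lbrakk>s \<in> carrier S; t \<in> carrier S; sorth S s t\<rbrakk> \<Longrightarrow> has_join (sord S) {s, t}"
    and distrib_left:
      "\<lbrakk>finite A; A \<subseteq> carrier S; pairwise (sorth S) A; least (sord S) z (Upper (sord S) A);
        s \<in> carrier S\<rbrakk> \<Longrightarrow> least (sord S) (s \<cdot> z) (Upper (sord S) ((\<lambda>a. s \<cdot> a) ` A))"
    and distrib_right:
      "\<lbrakk>finite A; A \<subseteq> carrier S; pairwise (sorth S) A; least (sord S) z (Upper (sord S) A);
        s \<in> carrier S\<rbrakk> \<Longrightarrow> least (sord S) (z \<cdot> s) (Upper (sord S) ((\<lambda>a. a \<cdot> s) ` A))"


section \<open>Pointed etale sets, premodules and modules\<close>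

record ('x, 'a) etale = "'x partial_object" +
  act :: "'x \<Rightarrow> 'a \<Rightarrow> 'x"
  pmap :: "'x \<Rightarrow> 'a"
  pt :: 'x

definition eord :: "('x, 'a) etale \<Rightarrow> 'x gorder"
  where "eord X = \<lparr>carrier = carrier X, eq = (=), le = (\<lambda>x y. x = act X y (pmap X x))\<rparr>"

definition eorth :: "('a, 'm) zsemigroup_scheme \<Rightarrow> ('x, 'a) etale \<Rightarrow> 'x \<Rightarrow> 'x \<Rightarrow> bool"
  where "eorth S X x y \<longleftrightarrow> pmap X x \<cdot>\<^bsub>S\<^esub> pmap X y = \<^bold>0\<^bsub>S\<^esub>"

definition strongly_orth :: "('a, 'm) zsemigroup_scheme \<Rightarrow> ('x, 'a) etale \<Rightarrow> 'x \<Rightarrow> 'x \<Rightarrow> bool"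
  where "strongly_orth S X x y \<longleftrightarrow>
    eorth S X x y \<and> has_join (eord X) {x, y} \<and>
    pmap X (x \<squnion>\<^bsub>eord X\<^esub> y) = pmap X x \<squnion>\<^bsub>sord S\<^esub> pmap X y"

locale pointed_etale = inverse_semigroup_zero S
  for S :: "('a, 'm) zsemigroup_scheme" (structure) +
  fixes X :: "('x, 'a) etale"
  assumes act_closed: "\<lbrakk>x \<in> carrier X; s \<in> carrier S\<rbrakk> \<Longrightarrow> act X x s \<in> carrier X"
    and act_assoc: "\<lbrakk>x \<in> carrier X; s \<in> carrier S; t \<in> carrier S\<rbrakk>
      \<Longrightarrow> act X (act X x s) t = act X x (s \<cdot> t)"
    and act_unitary: "{act X x s | x s. x \<in> carrier X \<and> s \<in> carrier S} = carrier X"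
    and pmap_idem: "x \<in> carrier X \<Longrightarrow> pmap X x \<in> idems S"
    and act_pmap: "x \<in> carrier X \<Longrightarrow> act X x (pmap X x) = x"
    and pmap_act: "\<lbrakk>x \<in> carrier X; s \<in> carrier S\<rbrakk>
      \<Longrightarrow> pmap X (act X x s) = sinv S s \<cdot> pmap X x \<cdot> s"
    and pt_closed: "pt X \<in> carrier X"
    and pmap_pt: "pmap X (pt X) = \<^bold>0"
    and pmap_eq_zero: "\<lbrakk>x \<in> carrier X; pmap X x = \<^bold>0\<rbrakk> \<Longrightarrow> x = pt X"
    and act_pt: "s \<in> carrier S \<Longrightarrow> act X (pt X) s = pt X"
    and act_zero: "x \<in> carrier X \<Longrightarrow> act X x \<^bold>0 = pt X"

locale etale_premodule = pointed_etale +
  assumes PRM1: "\<lbrakk>x \<in> carrier X; y \<in> carrier X; strongly_orth S X x y; s \<in> carrier S\<rbrakk>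
      \<Longrightarrow> strongly_orth S X (act X x s) (act X y s) \<and>
          act X (x \<squnion>\<^bsub>eord X\<^esub> y) s = act X x s \<squnion>\<^bsub>eord X\<^esub> act X y s"
    and PRM2: "\<lbrakk>s \<in> carrier S; t \<in> carrier S; sorth S s t; x \<in> carrier X\<rbrakk>
      \<Longrightarrow> strongly_orth S X (act X x s) (act X x t)"

locale etale_module = pointed_etale +
  assumes M1: "\<lbrakk>x \<in> carrier X; y \<in> carrier X; eorth S X x y\<rbrakk>
      \<Longrightarrow> has_join (eord X) {x, y} \<and>
          pmap X (x \<squnion>\<^bsub>eord X\<^esub> y) = pmap X x \<squnion>\<^bsub>sord S\<^esub> pmap X y"
    and M2: "\<lbrakk>x \<in> carrier X; y \<in> carrier X; eorth S X x y; s \<in> carrier S\<rbrakk>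
      \<Longrightarrow> act X (x \<squnion>\<^bsub>eord X\<^esub> y) s = act X x s \<squnion>\<^bsub>eord X\<^esub> act X y s"

definition module_hom ::
    "('a, 'm) zsemigroup_scheme \<Rightarrow> ('x, 'a) etale \<Rightarrow> ('y, 'a) etale \<Rightarrow> ('x \<Rightarrow> 'y) set"
  where "module_hom S X Y = {\<alpha> \<in> carrier X \<rightarrow> carrier Y.
    (\<forall>x\<in>carrier X. \<forall>s\<in>carrier S. \<alpha> (act X x s) = act Y (\<alpha> x) s) \<and>
    (\<forall>x\<in>carrier X. pmap Y (\<alpha> x) = pmap X x) \<and>
    \<alpha> (pt X) = pt Y \<and>
    (\<forall>x\<in>carrier X. \<forall>y\<in>carrier X. eorth S X x y \<longrightarrow>
      \<alpha> (x \<squnion>\<^bsub>eord X\<^esub> y) = \<alpha> x \<squnion>\<^bsub>eord Y\<^esub> \<alpha> y)}"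

definition module_iso ::
    "('a, 'm) zsemigroup_scheme \<Rightarrow> ('x, 'a) etale \<Rightarrow> ('y, 'a) etale \<Rightarrow> bool"
  where "module_iso S X Y \<longleftrightarrow> (\<exists>\<alpha>\<in>module_hom S X Y. \<exists>\<beta>\<in>module_hom S Y X.
    (\<forall>x\<in>carrier X. \<beta> (\<alpha> x) = x) \<and> (\<forall>y\<in>carrier Y. \<alpha> (\<beta> y) = y))"

definition right_ideal :: "('a, 'm) zsemigroup_scheme \<Rightarrow> 'a \<Rightarrow> ('a, 'a) etale"
  where "right_ideal S e = \<lparr>carrier = {e \<cdot>\<^bsub>S\<^esub> s | s. s \<in> carrier S},
    act = (\<lambda>x s. x \<cdot>\<^bsub>S\<^esub> s), pmap = (\<lambda>s. sinv S s \<cdot>\<^bsub>S\<^esub> s), pt = \<^bold>0\<^bsub>S\<^esub>\<rparr>"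


section \<open>The module generated by a premodule\<close>

definition down :: "('x, 'a) etale \<Rightarrow> 'x set \<Rightarrow> 'x set"
  where "down X A = {x \<in> carrier X. \<exists>a\<in>A. x \<sqsubseteq>\<^bsub>eord X\<^esub> a}"

text \<open>Non-empty lists of pairwise orthogonal elements; the zero element may be repeated. Empty
  lists are excluded because the empty set would be a second element of structure value zero
  besides the ideal generated by the zero element.\<close>

definition orth_list :: "('a, 'm) zsemigroup_scheme \<Rightarrow> ('x, 'a) etale \<Rightarrow> 'x list \<Rightarrow> bool"
  where "orth_list S X xs \<longleftrightarrow> xs \<noteq> [] \<and> set xs \<subseteq> carrier X \<and>
    (\<forall>i<length xs. \<forall>j<length xs. i \<noteq> j \<longrightarrow> eorth S X (xs ! i) (xs ! j))"

definition orth_ideals :: "('a, 'm) zsemigroup_scheme \<Rightarrow> ('x, 'a) etale \<Rightarrow> 'x set set"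
  where "orth_ideals S X = {down X (set xs) | xs. orth_list S X xs}"

inductive_set sharp_rel ::
    "('a, 'm) zsemigroup_scheme \<Rightarrow> ('x, 'a) etale \<Rightarrow> ('x set \<times> 'x set) set"
  for S :: "('a, 'm) zsemigroup_scheme" and X :: "('x, 'a) etale" where
  refl: "I \<in> orth_ideals S X \<Longrightarrow> (I, I) \<in> sharp_rel S X"
| sym: "(I, J) \<in> sharp_rel S X \<Longrightarrow> (J, I) \<in> sharp_rel S X"
| trans: "\<lbrakk>(I, J) \<in> sharp_rel S X; (J, K) \<in> sharp_rel S X\<rbrakk> \<Longrightarrow> (I, K) \<in> sharp_rel S X"
| join: "\<lbrakk>orth_list S X (x # y # zs); strongly_orth S X x y\<rbrakk>
    \<Longrightarrow> (down X (set (x # y # zs)), down X (set ((x \<squnion>\<^bsub>eord X\<^esub> y) # zs))) \<in> sharp_rel S X"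

definition sharp_class ::
    "('a, 'm) zsemigroup_scheme \<Rightarrow> ('x, 'a) etale \<Rightarrow> 'x list \<Rightarrow> 'x set set"
  where "sharp_class S X xs = sharp_rel S X `` {down X (set xs)}"

text \<open>The structure map and the action do not depend on the representative, so each definite
  description below determines its value.\<close>

definition sharp :: "('a, 'm) zsemigroup_scheme \<Rightarrow> ('x, 'a) etale \<Rightarrow> ('x set set, 'a) etale"
  where "sharp S X = \<lparr>carrier = orth_ideals S X // sharp_rel S X,
    act = (\<lambda>C s. THE D. \<exists>xs. orth_list S X xs \<and> C = sharp_class S X xs \<and>
                          D = sharp_class S X (map (\<lambda>x. act X x s) xs)),
    pmap = (\<lambda>C. THE e. \<exists>xs. orth_list S X xs \<and> C = sharp_class S X xs \<and>
                          e = \<Squnion>\<^bsub>sord S\<^esub> (pmap X ` set xs)),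
    pt = sharp_class S X [pt X]\<rparr>"


section \<open>Direct sums and projective modules\<close>

definition direct_sum ::
    "('a, 'm) zsemigroup_scheme \<Rightarrow> ('x, 'a) etale \<Rightarrow> ('y, 'a) etale \<Rightarrow> ('x \<times> 'y, 'a) etale"
  where "direct_sum S X Y = \<lparr>
    carrier = {(x, y). x \<in> carrier X \<and> y \<in> carrier Y \<and> pmap X x \<cdot>\<^bsub>S\<^esub> pmap Y y = \<^bold>0\<^bsub>S\<^esub>},
    act = (\<lambda>(x, y) s. (act X x s, act Y y s)),
    pmap = (\<lambda>(x, y). pmap X x \<squnion>\<^bsub>sord S\<^esub> pmap Y y),
    pt = (pt X, pt Y)\<rparr>"

text \<open>The iterated direct sum, with tuples represented by lists, since iterating the binary
  version would change the type at every step.\<close>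

definition direct_sum_list ::
    "('a, 'm) zsemigroup_scheme \<Rightarrow> ('x, 'a) etale list \<Rightarrow> ('x list, 'a) etale"
  where "direct_sum_list S Xs = \<lparr>
    carrier = {xs. length xs = length Xs \<and> (\<forall>i<length Xs. xs ! i \<in> carrier (Xs ! i)) \<and>
      (\<forall>i<length Xs. \<forall>j<length Xs. i \<noteq> j \<longrightarrow>
        pmap (Xs ! i) (xs ! i) \<cdot>\<^bsub>S\<^esub> pmap (Xs ! j) (xs ! j) = \<^bold>0\<^bsub>S\<^esub>)},
    act = (\<lambda>xs s. map2 (\<lambda>X x. act X x s) Xs xs),
    pmap = (\<lambda>xs. \<Squnion>\<^bsub>sord S\<^esub> {pmap (Xs ! i) (xs ! i) | i. i < length Xs}),
    pt = map pt Xs\<rparr>"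

text \<open>Isomorphism classes are taken among modules over one fixed type. It contains every
  iterated direct sum of the modules \<open>(eS)\<^sup>\<sharp>\<close>, hence a copy of every
  projective module over any type, and the sum of two isomorphism classes is never empty.\<close>

type_synonym 'a proj_module = "('a set set list, 'a) etale"

definition Proj :: "('a, 'm) zsemigroup_scheme \<Rightarrow> 'a proj_module set"
  where "Proj S = {P. etale_module S P \<and> (\<exists>es. es \<noteq> [] \<and> set es \<subseteq> idems S \<and>
    module_iso S P (direct_sum_list S (map (\<lambda>e. sharp S (right_ideal S e)) es)))}"

definition iso_rel :: "('a, 'm) zsemigroup_scheme \<Rightarrow> ('a proj_module \<times> 'a proj_module) set"
  where "iso_rel S = {(P, Q). P \<in> Proj S \<and> Q \<in> Proj S \<and> module_iso S P Q}"

definition proj_monoid :: "('a, 'm) zsemigroup_scheme \<Rightarrow> 'a proj_module set monoid"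
  where "proj_monoid S = \<lparr>carrier = Proj S // iso_rel S,
    mult = (\<lambda>C D. {R \<in> Proj S. \<exists>P\<in>C. \<exists>Q\<in>D. module_iso S R (direct_sum S P Q)}),
    one = {R \<in> Proj S. carrier R = {pt R}}\<rparr>"


section \<open>Matrices and classes of idempotents\<close>

definition Momega :: "('a, 'm) zsemigroup_scheme \<Rightarrow> (nat \<Rightarrow> nat \<Rightarrow> 'a) zsemigroup"
  where "Momega S = \<lparr>
    carrier = {A. (\<forall>i j. A i j \<in> carrier S) \<and> finite {(i, j). A i j \<noteq> \<^bold>0\<^bsub>S\<^esub>} \<and>
      (\<forall>i j k. j \<noteq> k \<longrightarrow> sinv S (A i j) \<cdot>\<^bsub>S\<^esub> A i k = \<^bold>0\<^bsub>S\<^esub>) \<and>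
      (\<forall>i j k. i \<noteq> j \<longrightarrow> A i k \<cdot>\<^bsub>S\<^esub> sinv S (A j k) = \<^bold>0\<^bsub>S\<^esub>)},
    smult = (\<lambda>A B i j. \<Squnion>\<^bsub>sord S\<^esub> {A i k \<cdot>\<^bsub>S\<^esub> B k j | k. True}),
    szero = (\<lambda>i j. \<^bold>0\<^bsub>S\<^esub>)\<rparr>"

definition D_rel :: "('a, 'm) zsemigroup_scheme \<Rightarrow> ('a \<times> 'a) set"
  where "D_rel T = {(e, f). e \<in> idems T \<and> f \<in> idems T \<and>
    (\<exists>s\<in>carrier T. sinv T s \<cdot>\<^bsub>T\<^esub> s = e \<and> s \<cdot>\<^bsub>T\<^esub> sinv T s = f)}"

definition idem_monoid :: "('a, 'm) zsemigroup_scheme \<Rightarrow> 'a set monoid"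
  where "idem_monoid T = \<lparr>carrier = idems T // D_rel T,
    mult = (\<lambda>C D. \<Union>{D_rel T `` {e \<squnion>\<^bsub>sord T\<^esub> f} | e f. e \<in> C \<and> f \<in> D \<and> sorth T e f}),
    one = D_rel T `` {\<^bold>0\<^bsub>T\<^esub>}\<rparr>"


section \<open>Grothendieck groups\<close>

definition groth_rel :: "('a, 'm) monoid_scheme \<Rightarrow> (('a \<times> 'a) \<times> ('a \<times> 'a)) set"
  where "groth_rel M = {((a, b), (c, d)). a \<in> carrier M \<and> b \<in> carrier M \<and>
    c \<in> carrier M \<and> d \<in> carrier M \<and>
    (\<exists>k\<in>carrier M. a \<otimes>\<^bsub>M\<^esub> d \<otimes>\<^bsub>M\<^esub> k = c \<otimes>\<^bsub>M\<^esub> b \<otimes>\<^bsub>M\<^esub> k)}"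

definition grothendieck_group :: "('a, 'm) monoid_scheme \<Rightarrow> ('a \<times> 'a) set monoid"
  where "grothendieck_group M = \<lparr>carrier = (carrier M \<times> carrier M) // groth_rel M,
    mult = (\<lambda>U V. \<Union>(a, b)\<in>U. \<Union>(c, d)\<in>V. groth_rel M `` {(a \<otimes>\<^bsub>M\<^esub> c, b \<otimes>\<^bsub>M\<^esub> d)}),
    one = groth_rel M `` {(\<one>\<^bsub>M\<^esub>, \<one>\<^bsub>M\<^esub>)}\<rparr>"

definition K_proj :: "('a, 'm) zsemigroup_scheme \<Rightarrow> ('a proj_module set \<times> 'a proj_module set) set monoid"
  where "K_proj S = grothendieck_group (proj_monoid S)"

definition K_idem :: "('a, 'm) zsemigroup_scheme \<Rightarrow> ('a set \<times> 'a set) set monoid"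
  where "K_idem T = grothendieck_group (idem_monoid T)"

end

theory Submission
  imports Defs
begin

text \<open>Both groups are Grothendieck groups of monoids, and already the monoids are isomorphic. The
  link between them is the notion of a basis of a module \<open>P\<close>: a sequence \<open>m\<close> of elements, almost
  all of them zero, such that every element of \<open>P\<close> is a finite orthogonal join of multiples
  \<open>m i \<cdot> s\<close> and such that an equation \<open>m i \<cdot> s = m j \<cdot> t\<close> holds only for the obvious reasons. The
  class of \<open>e\<close> is a one-element basis of \<open>(eS)\<^sup>\<sharp>\<close>, and bases of the summands combine to a basis of
  an orthogonal sum, so every projective module has a basis.

  An idempotent of \<open>M\<^sub>\<omega>(S)\<close> is a diagonal matrix with idempotent entries
  (\<open>idempotent_diag\<close>). To a basis \<open>m\<close> belongs the diagonal matrix with the entries \<open>p(m i)\<close>; let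
  \<open>basis_idems P\<close> be the set of the matrices obtained from all bases of \<open>P\<close>. Three facts carry the
  proof.

  First, \<open>basis_idems P\<close> is exactly one \<open>\<D>\<close>-class. If \<open>m\<close> and \<open>n\<close> are two bases, each \<open>n j\<close> has
  coordinates \<open>a i j\<close> with \<open>n j = \<Or>\<^sub>i m i \<cdot> a i j\<close>, and freeness of the \<open>n j\<close> makes \<open>a\<close> an element
  of \<open>M\<^sub>\<omega>(S)\<close> that witnesses the \<open>\<D>\<close>-relation of the two diagonal matrices
  (\<open>bases_intertwine\<close>). Conversely any matrix witnessing this relation turns the basis \<open>m\<close>
  into a basis \<open>n\<close> by the same formula (\<open>basis_from_intertwining\<close>).

  Secondly, two modules having bases with the same sequence of idempotents are isomorphic, because
  elements can be matched through the multiples of basis elements below them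
  (\<open>iso_if_same_basis_idempotents\<close>). Since isomorphisms carry bases to bases, \<open>basis_idems\<close> is a
  complete invariant, and every \<open>\<D>\<close>-class is attained by a finite sum of modules \<open>(eS)\<^sup>\<sharp>\<close>.

  Thirdly, if \<open>m\<close> and \<open>n\<close> are bases of \<open>P\<close> and \<open>Q\<close> with \<open>p(m i)\<close> orthogonal to \<open>q(n i)\<close> for each
  \<open>i\<close>, the pairs \<open>(m i, n i)\<close> lie in \<open>P \<Oplus> Q\<close> and form a basis; its matrix is the join of the two
  matrices. Spreading the two bases over the even and the odd numbers produces such orthogonal
  bases, so addition of modules corresponds to addition of \<open>\<D>\<close>-classes.

  The part about \<open>(eS)\<^sup>\<sharp>\<close> rests on a direct description of the equivalence that defines \<open>X\<^sup>\<sharp>\<close>: two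
  orthogonal families are equivalent exactly if they agree locally, \<open>x \<cdot> p(y) = y \<cdot> p(x)\<close>, and
  their structure values have the same join.\<close>

section \<open>Inverse semigroups\<close>

context inverse_semigroup_zero
begin

abbreviation inverse_of (\<open>_\<^sup>\<star>\<close> [999] 999)
  where "s\<^sup>\<star> \<equiv> sinv S s"

abbreviation nat_le (infix \<open>\<preceq>\<close> 50)
  where "s \<preceq> t \<equiv> s \<sqsubseteq>\<^bsub>sord S\<^esub> t"

abbreviation src where "src s \<equiv> s\<^sup>\<star> \<cdot> s"

lemmas closed [simp, intro] = mult_closed zero_closed
lemmas zero_mult [simp] = zero_left zero_right

lemma sinv_props:
  assumes "s \<in> carrier S"
  shows sinv_closed [simp, intro]: "s\<^sup>\<star> \<in> carrier S"
    and mult_sinv_mult: "s \<cdot> s\<^sup>\<star> \<cdot> s = s"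
    and sinv_mult_sinv: "s\<^sup>\<star> \<cdot> s \<cdot> s\<^sup>\<star> = s\<^sup>\<star>"
  using theI'[OF ex1_inverse[OF assms]] unfolding sinv_def by auto

lemma sinv_unique:
  "\<lbrakk>s \<in> carrier S; t \<in> carrier S; s \<cdot> t \<cdot> s = s; t \<cdot> s \<cdot> t = t\<rbrakk> \<Longrightarrow> s\<^sup>\<star> = t"
  using ex1_inverse[of s] sinv_props[of s] by blast

lemma sinv_sinv [simp]: "s \<in> carrier S \<Longrightarrow> s\<^sup>\<star>\<^sup>\<star> = s"
  by (rule sinv_unique) (auto simp: sinv_props)

lemma idem_closed [simp, intro]: "e \<in> idems S \<Longrightarrow> e \<in> carrier S"
  unfolding idems_def by blast

lemma idem_mult [simp]: "e \<in> idems S \<Longrightarrow> e \<cdot> e = e"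
  unfolding idems_def by blast

lemma idemI: "e \<in> carrier S \<Longrightarrow> e \<cdot> e = e \<Longrightarrow> e \<in> idems S"
  unfolding idems_def by blast

lemma sinv_idem [simp]: "e \<in> idems S \<Longrightarrow> e\<^sup>\<star> = e"
  by (rule sinv_unique) auto

text \<open>The inverse \<open>x\<close> of a product \<open>e \<cdot> f\<close> of idempotents is idempotent, because \<open>f \<cdot> x \<cdot> e\<close>
  is another inverse; being its own inverse, it equals \<open>e \<cdot> f\<close>.\<close>

lemma idem_mult_closed [simp, intro]:
  assumes e: "e \<in> idems S" and f: "f \<in> idems S"
  shows "e \<cdot> f \<in> idems S"
proof -
  define x where "x = (e \<cdot> f)\<^sup>\<star>"
  have c: "e \<in> carrier S" "f \<in> carrier S" "x \<in> carrier S"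
    using e f by (auto simp: x_def)
  have ee: "e \<cdot> (e \<cdot> u) = e \<cdot> u" "f \<cdot> (f \<cdot> u) = f \<cdot> u" if "u \<in> carrier S" for u
    using that c e f mult_assoc[of e e u] mult_assoc[of f f u] by auto
  have x1: "e \<cdot> (f \<cdot> (x \<cdot> (e \<cdot> f))) = e \<cdot> f" and x2: "x \<cdot> (e \<cdot> (f \<cdot> x)) = x"
    using mult_sinv_mult[of "e \<cdot> f"] sinv_mult_sinv[of "e \<cdot> f"] c
    by (simp_all add: x_def[symmetric] mult_assoc)
  have "x = f \<cdot> x \<cdot> e"
    unfolding x_def
  proof (rule sinv_unique; (unfold x_def[symmetric])?)
    have "f \<cdot> x \<cdot> e \<cdot> (e \<cdot> f) \<cdot> (f \<cdot> x \<cdot> e) = f \<cdot> ((x \<cdot> (e \<cdot> (f \<cdot> x))) \<cdot> e)"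
      using c by (simp add: mult_assoc ee)
    then show "f \<cdot> x \<cdot> e \<cdot> (e \<cdot> f) \<cdot> (f \<cdot> x \<cdot> e) = f \<cdot> x \<cdot> e"
      using c by (simp add: x2 mult_assoc)
  qed (use c in \<open>simp_all add: mult_assoc ee x1\<close>)
  then have "x \<cdot> x = f \<cdot> x \<cdot> e \<cdot> (f \<cdot> x \<cdot> e)" by simp
  also have "\<dots> = f \<cdot> (x \<cdot> (e \<cdot> (f \<cdot> x))) \<cdot> e"
    using c by (simp add: mult_assoc)
  also have "\<dots> = x" using \<open>x = f \<cdot> x \<cdot> e\<close> by (simp add: x2)
  finally have "x \<in> idems S" using c by (intro idemI) auto
  then have "x\<^sup>\<star> = x" by simp
  then show ?thesis using c \<open>x \<in> idems S\<close> by (simp add: x_def)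
qed

lemma idem_commute:
  assumes e: "e \<in> idems S" and f: "f \<in> idems S"
  shows "e \<cdot> f = f \<cdot> e"
proof -
  have c: "e \<in> carrier S" "f \<in> carrier S" using e f by auto
  have ee: "e \<cdot> (e \<cdot> u) = e \<cdot> u" "f \<cdot> (f \<cdot> u) = f \<cdot> u" if "u \<in> carrier S" for u
    using that c e f mult_assoc[of e e u] mult_assoc[of f f u] by auto
  have "e \<cdot> (f \<cdot> (e \<cdot> f)) = e \<cdot> f" "f \<cdot> (e \<cdot> (f \<cdot> e)) = f \<cdot> e"
    using idem_mult[OF idem_mult_closed[OF e f]] idem_mult[OF idem_mult_closed[OF f e]] c
    by (simp_all add: mult_assoc)
  then have "(e \<cdot> f)\<^sup>\<star> = f \<cdot> e"
    using c by (intro sinv_unique) (simp_all add: mult_assoc ee)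
  then show ?thesis using e f by simp
qed

lemma idem_zero [simp, intro]: "\<^bold>0 \<in> idems S"
  by (intro idemI) auto

lemma sinv_zero [simp]: "\<^bold>0\<^sup>\<star> = \<^bold>0"
  by simp

lemma src_idem [simp, intro]: "s \<in> carrier S \<Longrightarrow> src s \<in> idems S"
  using mult_assoc[of "src s" "s\<^sup>\<star>" s] by (intro idemI) (auto simp: sinv_mult_sinv)

lemma tgt_idem [simp, intro]: "s \<in> carrier S \<Longrightarrow> s \<cdot> s\<^sup>\<star> \<in> idems S"
  using src_idem[of "s\<^sup>\<star>"] by simp

text \<open>The simplifier works with products associated to the right; these are the defining
  equations of the inverse, of idempotents, and their commutation in that form.\<close>

lemma cancel [simp]:
  assumes "s \<in> carrier S"
  shows "s \<cdot> (s\<^sup>\<star> \<cdot> s) = s" "s\<^sup>\<star> \<cdot> (s \<cdot> s\<^sup>\<star>) = s\<^sup>\<star>"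
    and "u \<in> carrier S \<Longrightarrow> s \<cdot> (s\<^sup>\<star> \<cdot> (s \<cdot> u)) = s \<cdot> u"
    and "u \<in> carrier S \<Longrightarrow> s\<^sup>\<star> \<cdot> (s \<cdot> (s\<^sup>\<star> \<cdot> u)) = s\<^sup>\<star> \<cdot> u"
proof -
  show 1: "s \<cdot> (s\<^sup>\<star> \<cdot> s) = s" "s\<^sup>\<star> \<cdot> (s \<cdot> s\<^sup>\<star>) = s\<^sup>\<star>"
    using assms mult_sinv_mult[of s] sinv_mult_sinv[of s] by (simp_all add: mult_assoc)
  show "s \<cdot> (s\<^sup>\<star> \<cdot> (s \<cdot> u)) = s \<cdot> u" if "u \<in> carrier S"
    using assms that mult_assoc[of s "s\<^sup>\<star> \<cdot> s" u] by (simp add: 1 mult_assoc)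
  show "s\<^sup>\<star> \<cdot> (s \<cdot> (s\<^sup>\<star> \<cdot> u)) = s\<^sup>\<star> \<cdot> u" if "u \<in> carrier S"
    using assms that mult_assoc[of "s\<^sup>\<star>" "s \<cdot> s\<^sup>\<star>" u] by (simp add: 1 mult_assoc)
qed

lemma idem_left [simp]: "e \<in> idems S \<Longrightarrow> u \<in> carrier S \<Longrightarrow> e \<cdot> (e \<cdot> u) = e \<cdot> u"
  using mult_assoc[of e e u] by simp

lemma idem_left_commute:
  "e \<in> idems S \<Longrightarrow> f \<in> idems S \<Longrightarrow> u \<in> carrier S \<Longrightarrow> e \<cdot> (f \<cdot> u) = f \<cdot> (e \<cdot> u)"
  using mult_assoc[of e f u] mult_assoc[of f e u] idem_commute[of e f] by simp

lemma sinv_mult [simp]: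
  assumes "s \<in> carrier S" "t \<in> carrier S"
  shows "(s \<cdot> t)\<^sup>\<star> = t\<^sup>\<star> \<cdot> s\<^sup>\<star>"
proof (rule sinv_unique)
  have c: "t \<cdot> t\<^sup>\<star> \<cdot> src s = src s \<cdot> (t \<cdot> t\<^sup>\<star>)"
    using assms by (intro idem_commute) auto
  have "s \<cdot> t \<cdot> (t\<^sup>\<star> \<cdot> s\<^sup>\<star>) \<cdot> (s \<cdot> t) = s \<cdot> (t \<cdot> t\<^sup>\<star> \<cdot> src s) \<cdot> t"
    using assms by (simp add: mult_assoc)
  then show "s \<cdot> t \<cdot> (t\<^sup>\<star> \<cdot> s\<^sup>\<star>) \<cdot> (s \<cdot> t) = s \<cdot> t"
    unfolding c using assms by (simp add: mult_assoc)
  have "t\<^sup>\<star> \<cdot> s\<^sup>\<star> \<cdot> (s \<cdot> t) \<cdot> (t\<^sup>\<star> \<cdot> s\<^sup>\<star>) = t\<^sup>\<star> \<cdot> (src s \<cdot> (t \<cdot> t\<^sup>\<star>)) \<cdot> s\<^sup>\<star>"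
    using assms by (simp add: mult_assoc)
  then show "t\<^sup>\<star> \<cdot> s\<^sup>\<star> \<cdot> (s \<cdot> t) \<cdot> (t\<^sup>\<star> \<cdot> s\<^sup>\<star>) = t\<^sup>\<star> \<cdot> s\<^sup>\<star>"
    unfolding c[symmetric] using assms by (simp add: mult_assoc)
qed (use assms in auto)

lemma conj_idem [simp, intro]:
  assumes "s \<in> carrier S" "e \<in> idems S"
  shows "s\<^sup>\<star> \<cdot> (e \<cdot> s) \<in> idems S"
  using src_idem[of "e \<cdot> s"] assms by (simp add: mult_assoc)

lemma idem_move:
  assumes "s \<in> carrier S" "e \<in> idems S"
  shows "e \<cdot> s = s \<cdot> (s\<^sup>\<star> \<cdot> (e \<cdot> s))"
proof -
  have "s \<cdot> (s\<^sup>\<star> \<cdot> (e \<cdot> s)) = (s \<cdot> s\<^sup>\<star>) \<cdot> (e \<cdot> s)"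
    using assms by (simp add: mult_assoc)
  also have "\<dots> = e \<cdot> ((s \<cdot> s\<^sup>\<star>) \<cdot> s)"
    using assms by (intro idem_left_commute) auto
  finally show ?thesis using assms by (simp add: mult_assoc)
qed

lemma src_eq_zero: "s \<in> carrier S \<Longrightarrow> src s = \<^bold>0 \<Longrightarrow> s = \<^bold>0"
  using cancel(1)[of s] by simp

lemma carrier_sord [simp]: "carrier (sord S) = carrier S"
  by (simp add: sord_def)

lemma le_iff_src: "s \<in> carrier S \<Longrightarrow> t \<in> carrier S \<Longrightarrow> s \<preceq> t \<longleftrightarrow> s = t \<cdot> src s"
  by (simp add: sord_def mult_assoc)

lemma le_idemI:
  assumes "t \<in> carrier S" "e \<in> idems S"
  shows "t \<cdot> e \<preceq> t"
proof -
  have "t \<cdot> src (t \<cdot> e) = t \<cdot> (e \<cdot> ((src t) \<cdot> e))"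
    using assms by (simp add: mult_assoc)
  also have "e \<cdot> ((src t) \<cdot> e) = src t \<cdot> (e \<cdot> e)"
    using assms by (intro idem_left_commute) auto
  finally show ?thesis using assms by (simp add: le_iff_src mult_assoc)
qed

lemma le_iff_idem:
  assumes "s \<in> carrier S" "t \<in> carrier S"
  shows "s \<preceq> t \<longleftrightarrow> (\<exists>e\<in>idems S. s = t \<cdot> e)"
  using assms le_idemI le_iff_src by blast

lemma idem_le_iff: "e \<in> idems S \<Longrightarrow> f \<in> idems S \<Longrightarrow> e \<preceq> f \<longleftrightarrow> f \<cdot> e = e"
  by (auto simp: le_iff_src)

lemma zero_natle [simp, intro]: "s \<in> carrier S \<Longrightarrow> \<^bold>0 \<preceq> s"
  by (simp add: le_iff_src)

lemma natle_refl [simp, intro]: "s \<in> carrier S \<Longrightarrow> s \<preceq> s"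
  by (simp add: le_iff_src)

lemma natle_trans:
  assumes "r \<preceq> s" "s \<preceq> t" "r \<in> carrier S" "s \<in> carrier S" "t \<in> carrier S"
  shows "r \<preceq> t"
proof -
  obtain e f where "e \<in> idems S" "f \<in> idems S" "r = s \<cdot> e" "s = t \<cdot> f"
    using assms by (auto simp: le_iff_idem)
  then show ?thesis using assms(5) le_idemI[of t "f \<cdot> e"] by (auto simp: mult_assoc)
qed

lemma natle_antisym:
  assumes "s \<preceq> t" "t \<preceq> s" "s \<in> carrier S" "t \<in> carrier S"
  shows "s = t"
proof -
  obtain e f where ef: "e \<in> idems S" "f \<in> idems S" and s: "s = t \<cdot> e" and t: "t = s \<cdot> f"
    using assms by (auto simp: le_iff_idem)
  have "s = t \<cdot> (e \<cdot> (f \<cdot> e))" using s t ef assms(3,4) by (metis closed(1) idem_closed mult_assoc)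
  also have "e \<cdot> (f \<cdot> e) = e \<cdot> f" using ef by (simp add: idem_commute[of f e])
  also have "t \<cdot> (e \<cdot> f) = t" using s t ef assms(3,4) by (metis idem_closed mult_assoc)
  finally show ?thesis .
qed

end

section \<open>Orthogonal joins in the semigroup\<close>

context inverse_semigroup_zero
begin

abbreviation lub
  where "lub A z \<equiv> least (sord S) z (Upper (sord S) A)"

definition orth_set
  where "orth_set A \<longleftrightarrow> finite A \<and> A \<subseteq> carrier S \<and> pairwise (sorth S) A"

lemma lub_iff:
  "A \<subseteq> carrier S \<Longrightarrow> lub A z \<longleftrightarrow>
    z \<in> carrier S \<and> (\<forall>a\<in>A. a \<preceq> z) \<and> (\<forall>u\<in>carrier S. (\<forall>a\<in>A. a \<preceq> u) \<longrightarrow> z \<preceq> u)"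
  by (auto simp: least_def Upper_def subset_iff)

lemma lub_closed: "lub A z \<Longrightarrow> z \<in> carrier S"
  by (auto simp: least_def Upper_def)

lemma lub_upper: "lub A z \<Longrightarrow> a \<in> A \<Longrightarrow> a \<in> carrier S \<Longrightarrow> a \<preceq> z"
  by (auto simp: least_def Upper_def)

lemma lub_least: "lub A z \<Longrightarrow> u \<in> carrier S \<Longrightarrow> (\<And>a. a \<in> A \<Longrightarrow> a \<preceq> u) \<Longrightarrow> z \<preceq> u"
  by (auto simp: least_def Upper_def)

lemma lub_unique: "lub A z \<Longrightarrow> lub A w \<Longrightarrow> z = w"
  by (rule natle_antisym) (auto simp: least_def)

lemma sup_eq: "lub A z \<Longrightarrow> \<Squnion>\<^bsub>sord S\<^esub> A = z"
  unfolding sup_def by (rule some_equality) (auto intro: lub_unique)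

lemma lub_max: "A \<subseteq> carrier S \<Longrightarrow> z \<in> A \<Longrightarrow> (\<And>a. a \<in> A \<Longrightarrow> a \<preceq> z) \<Longrightarrow> lub A z"
  by (auto simp: lub_iff)

lemma lub_singleton: "x \<in> carrier S \<Longrightarrow> x \<in> A \<Longrightarrow> A \<subseteq> {\<^bold>0, x} \<Longrightarrow> lub A x"
  by (rule lub_max) auto

lemma lub_zeros: "A \<subseteq> {\<^bold>0} \<Longrightarrow> lub A \<^bold>0"
  by (subst lub_iff) auto

text \<open>The zero is below everything, so adding it to a set or removing it changes no upper bound.\<close>

lemma Upper_cong_zero:
  "A - {\<^bold>0} = B - {\<^bold>0} \<Longrightarrow> Upper (sord S) A = Upper (sord S) B"
  by (auto simp: Upper_def)

text \<open>Joins are computed through upper bounds only, so a join of joins is the join of the union; this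
  holds in both directions, which is how iterated joins are rearranged later.\<close>

lemma lub_UN:
  assumes "\<And>i. i \<in> I \<Longrightarrow> A i \<subseteq> carrier S" "\<And>i. i \<in> I \<Longrightarrow> lub (A i) (z i)"
  shows "lub (\<Union>i\<in>I. A i) w \<longleftrightarrow> lub (z ` I) w"
proof -
  have z: "z i \<in> carrier S" if "i \<in> I" for i using assms(2)[OF that] by (rule lub_closed)
  have eq: "(\<forall>a\<in>A i. a \<preceq> u) \<longleftrightarrow> z i \<preceq> u" if "i \<in> I" "u \<in> carrier S" for i u
    using assms(1)[OF that(1)] z[OF that(1)] that(2) assms(2)[OF that(1)]
    by (meson lub_least lub_upper natle_trans subsetD)
  have U1: "Upper (sord S) (\<Union>i\<in>I. A i) = {u \<in> carrier S. \<forall>i\<in>I. \<forall>a\<in>A i. a \<preceq> u}"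
    using assms(1) unfolding Upper_def by auto
  have U2: "Upper (sord S) (z ` I) = {u \<in> carrier S. \<forall>i\<in>I. z i \<preceq> u}"
    using z unfolding Upper_def by auto
  have "Upper (sord S) (\<Union>i\<in>I. A i) = Upper (sord S) (z ` I)"
    unfolding U1 U2 using eq by blast
  then show ?thesis by simp
qed

lemma sorth_sym: "s \<in> carrier S \<Longrightarrow> t \<in> carrier S \<Longrightarrow> sorth S s t \<Longrightarrow> sorth S t s"
  unfolding sorth_def by (metis sinv_closed sinv_mult sinv_sinv sinv_zero)

lemma sorth_idem [simp]: "e \<in> idems S \<Longrightarrow> f \<in> idems S \<Longrightarrow> sorth S e f \<longleftrightarrow> e \<cdot> f = \<^bold>0"
  by (simp add: sorth_def)

text \<open>One-sided orthogonality is orthogonality of the corresponding idempotents.\<close>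

lemma src_mult_src_iff:
  assumes "s \<in> carrier S" "t \<in> carrier S"
  shows "src s \<cdot> src t = \<^bold>0 \<longleftrightarrow> s \<cdot> t\<^sup>\<star> = \<^bold>0"
proof
  assume "src s \<cdot> src t = \<^bold>0"
  then have "s \<cdot> (src s \<cdot> src t) \<cdot> t\<^sup>\<star> = \<^bold>0" using assms by simp
  then show "s \<cdot> t\<^sup>\<star> = \<^bold>0" using assms by (simp add: mult_assoc)
next
  assume "s \<cdot> t\<^sup>\<star> = \<^bold>0"
  then have "s\<^sup>\<star> \<cdot> (s \<cdot> t\<^sup>\<star>) \<cdot> t = \<^bold>0" using assms by simp
  then show "src s \<cdot> src t = \<^bold>0" using assms by (simp add: mult_assoc)
qed

lemma orth_set_idemI:
  "\<lbrakk>finite F; F \<subseteq> idems S; \<And>e f. e \<in> F \<Longrightarrow> f \<in> F \<Longrightarrow> e \<noteq> f \<Longrightarrow> e \<cdot> f = \<^bold>0\<rbrakk> \<Longrightarrow> orth_set F"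
  by (auto simp: orth_set_def pairwise_def subset_iff)

end

context orthogonally_complete
begin

lemma lub_mult_left: "orth_set A \<Longrightarrow> lub A z \<Longrightarrow> s \<in> carrier S \<Longrightarrow> lub ((\<cdot>) s ` A) (s \<cdot> z)"
  using distrib_left unfolding orth_set_def by blast

lemma lub_mult_right:
  "orth_set A \<Longrightarrow> lub A z \<Longrightarrow> s \<in> carrier S \<Longrightarrow> lub ((\<lambda>a. a \<cdot> s) ` A) (z \<cdot> s)"
  using distrib_right unfolding orth_set_def by blast

lemma lub_mult_left_zero:
  assumes "orth_set A" "lub A z" "s \<in> carrier S" "\<And>a. a \<in> A \<Longrightarrow> s \<cdot> a = \<^bold>0"
  shows "s \<cdot> z = \<^bold>0"
  using lub_mult_left[OF assms(1-3)] assms(4) lub_zeros[of "(\<cdot>) s ` A"] lub_unique by blast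

lemma lub_mult_right_zero:
  assumes "orth_set A" "lub A z" "s \<in> carrier S" "\<And>a. a \<in> A \<Longrightarrow> a \<cdot> s = \<^bold>0"
  shows "z \<cdot> s = \<^bold>0"
  using lub_mult_right[OF assms(1-3)] assms(4) lub_zeros[of "(\<lambda>a. a \<cdot> s) ` A"] lub_unique by blast

text \<open>Distributivity read as a principle of locality: elements that agree on an orthogonal cover
  agree on its join.\<close>

lemma lub_mult_cong:
  assumes "orth_set A" "lub A z" "s \<in> carrier S" "t \<in> carrier S" "\<And>a. a \<in> A \<Longrightarrow> s \<cdot> a = t \<cdot> a"
  shows "s \<cdot> z = t \<cdot> z"
proof -
  have "(\<cdot>) s ` A = (\<cdot>) t ` A" using assms(5) by auto
  then show ?thesis
    using lub_mult_left[OF assms(1-3)] lub_mult_left[OF assms(1,2,4)] lub_unique by metis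
qed

lemma sorth_lub:
  assumes "orth_set A" "lub A z" "s \<in> carrier S" "\<And>a. a \<in> A \<Longrightarrow> sorth S s a"
  shows "sorth S s z"
proof -
  have A: "A \<subseteq> carrier S" and z: "z \<in> carrier S"
    using assms by (auto simp: orth_set_def lub_closed)
  have "s\<^sup>\<star> \<cdot> z = \<^bold>0"
    using assms by (intro lub_mult_left_zero[OF assms(1,2)]) (auto simp: sorth_def)
  moreover have "z \<cdot> s\<^sup>\<star> = \<^bold>0"
  proof (rule lub_mult_right_zero[OF assms(1,2)])
    fix a assume "a \<in> A"
    then show "a \<cdot> s\<^sup>\<star> = \<^bold>0"
      using sorth_sym[of s a] assms A unfolding sorth_def by blast
  qed (use assms in auto)
  then have "(z \<cdot> s\<^sup>\<star>)\<^sup>\<star> = \<^bold>0" by simp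
  ultimately show ?thesis using assms(3) z by (simp add: sorth_def)
qed

lemma lub_exists:
  assumes "orth_set A"
  shows "\<exists>z. lub A z"
proof -
  have "finite A" using assms by (simp add: orth_set_def)
  then show ?thesis using assms
  proof (induction A)
    case empty
    then show ?case using lub_zeros by blast
  next
    case (insert a A)
    then have A: "orth_set A" and a: "a \<in> carrier S" "\<And>b. b \<in> A \<Longrightarrow> sorth S a b"
      by (auto simp: orth_set_def pairwise_def)
    then obtain z where z: "lub A z" using insert by blast
    then have "sorth S a z" using sorth_lub[OF A] a by blast
    then obtain w where "lub {a, z} w"
      using orth_join[of a z] a z by (auto simp: has_join_def lub_closed)
    moreover have "(\<Union>b\<in>{True,False}. if b then {a} else A) = insert a A" by auto
    moreover have "lub (\<Union>b\<in>{True,False}. if b then {a} else A) w \<longleftrightarrow>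
        lub ((\<lambda>b. if b then a else z) ` {True,False}) w"
      by (rule lub_UN) (use A a z in \<open>auto simp: orth_set_def intro: lub_singleton\<close>)
    moreover have "(\<lambda>b. if b then a else z) ` {True,False} = {a, z}" by auto
    ultimately show ?case by metis
  qed
qed

text \<open>For \<open>a\<close> below the join \<open>z\<close> we have \<open>z\<^sup>\<star> \<cdot> a = src a\<close>; hence multiplying the join by \<open>z\<^sup>\<star>\<close>
  gives the join of the \<open>src a\<close>.\<close>

lemma lub_src:
  assumes "orth_set A" "lub A z"
  shows "lub (src ` A) (src z)"
proof -
  have A: "A \<subseteq> carrier S" and z: "z \<in> carrier S"
    using assms by (auto simp: orth_set_def lub_closed)
  have "z\<^sup>\<star> \<cdot> a = src a" if "a \<in> A" for a
  proof -
    have a: "a \<in> carrier S" using A that by blast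
    have "a = z \<cdot> src a" using lub_upper[OF assms(2) that a] a z le_iff_src by blast
    then have "z\<^sup>\<star> \<cdot> a = src z \<cdot> src a" "src a = (z \<cdot> src a)\<^sup>\<star> \<cdot> (z \<cdot> src a)"
      using a z by (simp_all add: mult_assoc)
    moreover have "(z \<cdot> src a)\<^sup>\<star> \<cdot> (z \<cdot> src a) = src a \<cdot> (src z \<cdot> src a)"
      using a z by (simp add: mult_assoc)
    moreover have "src a \<cdot> (src z \<cdot> src a) = src z \<cdot> (src a \<cdot> src a)"
      using a z by (intro idem_left_commute) auto
    ultimately show ?thesis using a by simp
  qed
  then have "(\<cdot>) (z\<^sup>\<star>) ` A = src ` A" by auto
  then show ?thesis using lub_mult_left[OF assms, of "z\<^sup>\<star>"] z by simp
qed

lemma lub_idem: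
  assumes "orth_set F" "lub F g" "F \<subseteq> idems S"
  shows "g \<in> idems S"
proof -
  have "src ` F = F" using assms(3) by force
  then have "g = src g" using lub_src[OF assms(1,2)] assms(2) lub_unique by simp
  then show ?thesis using lub_closed[OF assms(2)] src_idem[of g] by simp
qed

end

context inverse_semigroup_zero
begin

text \<open>The range idempotent \<open>a \<cdot> a\<^sup>\<star>\<close> can be moved past \<open>src s\<close>, where it meets \<open>b\<close> and kills it.\<close>

lemma sorth_mult_left:
  assumes "sorth S a b" "a \<in> carrier S" "b \<in> carrier S" "s \<in> carrier S"
  shows "sorth S (s \<cdot> a) (s \<cdot> b)"
proof -
  have "(s \<cdot> a)\<^sup>\<star> \<cdot> (s \<cdot> b) = a\<^sup>\<star> \<cdot> ((a \<cdot> a\<^sup>\<star>) \<cdot> (src s \<cdot> b))"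
    using assms by (simp add: mult_assoc)
  also have "(a \<cdot> a\<^sup>\<star>) \<cdot> (src s \<cdot> b) = src s \<cdot> ((a \<cdot> a\<^sup>\<star>) \<cdot> b)"
    using assms by (intro idem_left_commute) auto
  also have "(a \<cdot> a\<^sup>\<star>) \<cdot> b = \<^bold>0" using assms by (simp add: mult_assoc sorth_def)
  finally have 1: "(s \<cdot> a)\<^sup>\<star> \<cdot> (s \<cdot> b) = \<^bold>0" using assms by simp
  have "(s \<cdot> a) \<cdot> (s \<cdot> b)\<^sup>\<star> = s \<cdot> ((a \<cdot> b\<^sup>\<star>) \<cdot> s\<^sup>\<star>)"
    using assms(2-4) by (simp add: mult_assoc)
  also have "\<dots> = \<^bold>0" using assms by (simp add: sorth_def)
  finally show ?thesis using 1 by (simp add: sorth_def)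
qed

lemma sorth_sinv: "a \<in> carrier S \<Longrightarrow> b \<in> carrier S \<Longrightarrow> sorth S a b \<Longrightarrow> sorth S (a\<^sup>\<star>) (b\<^sup>\<star>)"
  by (auto simp: sorth_def)

lemma sorth_mult_right:
  assumes "sorth S a b" "a \<in> carrier S" "b \<in> carrier S" "s \<in> carrier S"
  shows "sorth S (a \<cdot> s) (b \<cdot> s)"
  using sorth_sinv[OF _ _ sorth_mult_left[OF sorth_sinv[OF _ _ assms(1)], of "s\<^sup>\<star>"]] assms
  by simp

lemma orth_set_mult_left: "orth_set A \<Longrightarrow> s \<in> carrier S \<Longrightarrow> orth_set ((\<cdot>) s ` A)"
  unfolding orth_set_def pairwise_def by (auto intro!: sorth_mult_left)

lemma src_orth_act:
  assumes "e \<in> idems S" "f \<in> idems S" "e \<cdot> f = \<^bold>0" "s \<in> carrier S"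
  shows "src (e \<cdot> s) \<cdot> src (f \<cdot> s) = \<^bold>0"
proof -
  have "sorth S (e \<cdot> s) (f \<cdot> s)"
    using assms by (intro sorth_mult_right) auto
  then show ?thesis using assms by (subst src_mult_src_iff) (auto simp: sorth_def)
qed

end

section \<open>Orthogonal joins in etale sets\<close>

context pointed_etale
begin

abbreviation act_infix (infixl \<open>\<triangleleft>\<close> 70)
  where "x \<triangleleft> s \<equiv> act X x s"

abbreviation pp where "pp x \<equiv> pmap X x"

abbreviation elub
  where "elub A z \<equiv> least (eord X) z (Upper (eord X) A)"

declare act_closed [simp, intro] act_assoc [simp] pmap_idem [simp, intro] act_pmap [simp]
  pt_closed [simp, intro] pmap_pt [simp] act_pt [simp] act_zero [simp]

lemma pmap_act_idem [simp]:
  "x \<in> carrier X \<Longrightarrow> e \<in> idems S \<Longrightarrow> pp (x \<triangleleft> e) = pp x \<cdot> e"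
  using mult_assoc[of e "pp x" e] idem_commute[of e "pp x"]
  by (simp add: pmap_act mult_assoc)

lemma pmap_act_src: "x \<in> carrier X \<Longrightarrow> s \<in> carrier S \<Longrightarrow> pp (x \<triangleleft> s) = src (pp x \<cdot> s)"
  by (simp add: pmap_act mult_assoc)

lemma act_pmap_mult [simp]:
  "x \<in> carrier X \<Longrightarrow> s \<in> carrier S \<Longrightarrow> x \<triangleleft> (pp x \<cdot> s) = x \<triangleleft> s"
  using act_assoc[of x "pp x" s] by simp

lemma carrier_eord [simp]: "carrier (eord X) = carrier X"
  by (simp add: eord_def)

lemma ele_iff: "x \<sqsubseteq>\<^bsub>eord X\<^esub> y \<longleftrightarrow> x = y \<triangleleft> pp x"
  by (simp add: eord_def)

lemma restrict_pmap:
  assumes "y \<in> carrier X" "e \<in> idems S" "x = y \<triangleleft> e"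
  shows "x = y \<triangleleft> pp x"
  using assms by simp

lemma eorth_sym: "x \<in> carrier X \<Longrightarrow> y \<in> carrier X \<Longrightarrow> eorth S X x y \<Longrightarrow> eorth S X y x"
  by (simp add: eorth_def idem_commute[of "pp y"])

lemma eorth_act_zero:
  assumes "eorth S X x y" "x \<in> carrier X" "y \<in> carrier X"
  shows "x \<triangleleft> pp y = pt X"
  using act_pmap_mult[of x "pp y"] assms by (simp add: eorth_def del: act_pmap_mult)

text \<open>An upper bound whose structure value is the join of the structure values. Where elements are
  determined locally, such an element is the join; the description has the advantage that the
  action and every map respecting action and structure values visibly preserve it.\<close>

definition strong_join
  where "strong_join A z \<longleftrightarrow> finite A \<and> A \<subseteq> carrier X \<and> pairwise (eorth S X) A \<and>
    z \<in> carrier X \<and> (\<forall>a\<in>A. a = z \<triangleleft> pp a) \<and> lub (pp ` A) (pp z)"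

lemma strong_joinD:
  assumes "strong_join A z"
  shows "finite A" "A \<subseteq> carrier X" "z \<in> carrier X" "\<And>a. a \<in> A \<Longrightarrow> a = z \<triangleleft> pp a"
    "lub (pp ` A) (pp z)" "\<And>a b. a \<in> A \<Longrightarrow> b \<in> A \<Longrightarrow> a \<noteq> b \<Longrightarrow> pp a \<cdot> pp b = \<^bold>0"
  using assms by (auto simp: strong_join_def pairwise_def eorth_def)

lemma strong_join_pmap:
  assumes "strong_join A z"
  shows "orth_set (pp ` A)" "pp ` A \<subseteq> idems S"
proof -
  show i: "pp ` A \<subseteq> idems S" using assms by (auto simp: strong_join_def)
  show "orth_set (pp ` A)"
    using assms i by (intro orth_set_idemI) (auto simp: strong_join_def pairwise_def eorth_def)
qed

lemma pmap_le_if_upper: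
  assumes "z \<in> carrier X" "a \<in> carrier X" "a = z \<triangleleft> pp a"
  shows "pp z \<cdot> pp a = pp a"
  using assms pmap_act_idem[of z "pp a"] by simp

lemma strong_join_singleton: "x \<in> carrier X \<Longrightarrow> strong_join {x} x"
  by (auto simp: strong_join_def intro: lub_singleton)

lemma strong_join_empty: "strong_join {} (pt X)"
  using lub_zeros[of "{}"] by (simp add: strong_join_def)

lemma elub_unique:
  assumes "elub A z" "elub A w"
  shows "z = w"
proof -
  have "z \<in> carrier X" "w \<in> carrier X" "z = w \<triangleleft> pp z" "w = z \<triangleleft> pp w"
    using assms by (auto simp: least_def Upper_def ele_iff)
  then have "z = z \<triangleleft> (pp w \<cdot> pp z)" "w = z \<triangleleft> pp w"
    using act_assoc[of z "pp w" "pp z"] by auto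
  moreover have "z \<triangleleft> (pp w \<cdot> pp z) = z \<triangleleft> pp w"
    using \<open>z \<in> carrier X\<close> \<open>w \<in> carrier X\<close> by (simp add: idem_commute[of "pp w" "pp z"])
  ultimately show ?thesis by simp
qed

lemma join_eq_elub:
  assumes "elub {x, y} z"
  shows "x \<squnion>\<^bsub>eord X\<^esub> y = z"
  unfolding join_def sup_def
  by (rule some_equality[where P = "elub {x, y}", OF assms]) (use assms elub_unique in auto)

end

locale oc_etale = orthogonally_complete S + pointed_etale S X
  for S :: "('a, 'm) zsemigroup_scheme" (structure) and X :: "('x, 'a) etale"
begin

lemma sup_idem_pair:
  assumes "e \<in> idems S" "f \<in> idems S" "e \<cdot> f = \<^bold>0"
  shows "lub {e, f} (e \<squnion>\<^bsub>sord S\<^esub> f)"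
proof -
  have "orth_set {e, f}"
    using assms by (intro orth_set_idemI) (auto simp: idem_commute[of f e])
  then obtain g where "lub {e, f} g" using lub_exists by blast
  then show ?thesis using sup_eq by (simp add: join_def)
qed

text \<open>Each \<open>x \<triangleleft> s\<close> lies below \<open>x \<triangleleft> t\<close>, and its structure value is \<open>src (p x \<cdot> s)\<close>, so the structure
  values are covered by \<open>lub_src\<close>.\<close>

lemma strong_join_act_lub:
  assumes T: "orth_set T" "lub T t" and x: "x \<in> carrier X"
  shows "strong_join ((\<triangleleft>) x ` T) (x \<triangleleft> t)"
proof -
  have c: "T \<subseteq> carrier S" "t \<in> carrier S" using T by (auto simp: orth_set_def lub_closed)
  have "x \<triangleleft> s = x \<triangleleft> t \<triangleleft> pp (x \<triangleleft> s)" if s: "s \<in> T" for s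
  proof -
    have sc: "s \<in> carrier S" using c s by blast
    have "s = t \<cdot> src s" using lub_upper[OF T(2) s] sc c le_iff_src by blast
    then have "t \<cdot> s\<^sup>\<star> = s \<cdot> s\<^sup>\<star>"
      using c sc by (metis cancel(2) closed(1) mult_assoc sinv_closed)
    then have "t \<cdot> (s\<^sup>\<star> \<cdot> (pp x \<cdot> s)) = (s \<cdot> s\<^sup>\<star>) \<cdot> (pp x \<cdot> s)"
      using c sc x mult_assoc[of t "s\<^sup>\<star>" "pp x \<cdot> s"] by simp
    also have "\<dots> = pp x \<cdot> ((s \<cdot> s\<^sup>\<star>) \<cdot> s)"
      using sc x by (intro idem_left_commute) auto
    finally show ?thesis using c sc x by (simp add: pmap_act_src mult_assoc)
  qed
  moreover have "pairwise (eorth S X) ((\<triangleleft>) x ` T)"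
  proof (rule pairwiseI, clarify)
    fix s r assume sr: "s \<in> T" "r \<in> T" "x \<triangleleft> s \<noteq> x \<triangleleft> r"
    then have c': "s \<in> carrier S" "r \<in> carrier S" using c by auto
    have "s \<cdot> r\<^sup>\<star> = \<^bold>0"
      using T(1) sr by (auto simp: orth_set_def pairwise_def sorth_def)
    then have "pp x \<cdot> ((s \<cdot> r\<^sup>\<star>) \<cdot> pp x) = \<^bold>0" using x by simp
    then have "pp x \<cdot> s \<cdot> (pp x \<cdot> r)\<^sup>\<star> = \<^bold>0" using c' x by (simp add: mult_assoc)
    then have "src (pp x \<cdot> s) \<cdot> src (pp x \<cdot> r) = \<^bold>0"
      using c' x by (subst src_mult_src_iff) auto
    then show "eorth S X (x \<triangleleft> s) (x \<triangleleft> r)" using c' x by (simp add: eorth_def pmap_act_src)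
  qed
  moreover have "lub (pp ` (\<triangleleft>) x ` T) (pp (x \<triangleleft> t))"
  proof -
    have o: "orth_set ((\<cdot>) (pp x) ` T)" using T(1) x by (intro orth_set_mult_left) auto
    have "lub ((\<cdot>) (pp x) ` T) (pp x \<cdot> t)" by (rule lub_mult_left[OF T]) (use x in auto)
    from lub_src[OF o this] have "lub (src ` (\<cdot>) (pp x) ` T) (pp (x \<triangleleft> t))"
      using c x by (simp add: pmap_act_src)
    moreover have "src ` (\<cdot>) (pp x) ` T = pp ` (\<triangleleft>) x ` T"
      unfolding image_image using c x by (intro image_cong) (auto simp: pmap_act_src)
    ultimately show ?thesis by simp
  qed
  ultimately show ?thesis using T(1) c x by (auto simp: strong_join_def orth_set_def)
qed

end

text \<open>The separation axiom says that elements are determined locally. It holds in right ideals,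
  where it is distributivity, and in modules, and it is what makes a strong join unique.\<close>

locale orth_etale = oc_etale +
  assumes act_lub_cong: "\<lbrakk>orth_set F; F \<subseteq> idems S; lub F g; u \<in> carrier X; v \<in> carrier X;
    \<And>f. f \<in> F \<Longrightarrow> act X u f = act X v f\<rbrakk> \<Longrightarrow> act X u g = act X v g"
begin

lemma strong_join_cong:
  assumes "strong_join A z" "u \<in> carrier X" "v \<in> carrier X"
    and "\<And>a. a \<in> A \<Longrightarrow> u \<triangleleft> pp a = v \<triangleleft> pp a"
  shows "u \<triangleleft> pp z = v \<triangleleft> pp z"
  by (rule act_lub_cong[OF strong_join_pmap[OF assms(1)] strong_joinD(5)[OF assms(1)]])
     (use assms in auto)

text \<open>An upper bound agrees with the strong join on each \<open>p a\<close>, hence on their join.\<close>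

lemma strong_join_least:
  assumes "strong_join A z" "u \<in> carrier X" "\<And>a. a \<in> A \<Longrightarrow> a = u \<triangleleft> pp a"
  shows "z = u \<triangleleft> pp z"
proof -
  have "z \<triangleleft> pp z = u \<triangleleft> pp z"
    by (rule strong_join_cong[OF assms(1)]) (use assms strong_joinD[OF assms(1)] in auto)
  then show ?thesis using strong_joinD(3)[OF assms(1)] by simp
qed

lemma strong_join_unique:
  assumes "strong_join A z" "strong_join A w"
  shows "z = w"
proof -
  have "pp z = pp w" using strong_joinD(5) assms lub_unique by blast
  moreover have "z = w \<triangleleft> pp z"
    using strong_join_least[OF assms(1)] strong_joinD[OF assms(2)] by blast
  ultimately show ?thesis using strong_joinD(3)[OF assms(2)] by simp
qed

lemma strong_join_elub:
  assumes "strong_join A z"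
  shows "elub A z"
proof -
  have "\<forall>u\<in>Upper (eord X) A. z = u \<triangleleft> pp z"
    using strong_join_least[OF assms] strong_joinD(2)[OF assms]
    by (auto simp: Upper_def ele_iff subset_iff)
  then show ?thesis using strong_joinD[OF assms] by (auto simp: least_def Upper_def ele_iff)
qed

lemma strong_join_pair:
  assumes "strong_join {x, y} z" "eorth S X x y"
  shows "strongly_orth S X x y" "x \<squnion>\<^bsub>eord X\<^esub> y = z"
proof -
  note j = strong_join_elub[OF assms(1)]
  show e: "x \<squnion>\<^bsub>eord X\<^esub> y = z" by (rule join_eq_elub[OF j])
  have "pp x \<squnion>\<^bsub>sord S\<^esub> pp y = pp z"
    unfolding join_def using strong_joinD(5)[OF assms(1)] by (intro sup_eq) simp
  then show "strongly_orth S X x y"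
    using assms(2) j e by (auto simp: strongly_orth_def has_join_def)
qed

lemma strongly_orth_strong_join:
  assumes "strongly_orth S X x y" "x \<in> carrier X" "y \<in> carrier X"
  shows "strong_join {x, y} (x \<squnion>\<^bsub>eord X\<^esub> y)"
proof -
  have o: "eorth S X x y" using assms(1) by (simp add: strongly_orth_def)
  obtain z where "elub {x, y} z"
    using assms(1) by (auto simp: strongly_orth_def has_join_def)
  then have z: "elub {x, y} (x \<squnion>\<^bsub>eord X\<^esub> y)" unfolding join_def sup_def by (rule someI)
  have "lub {pp x, pp y} (pp (x \<squnion>\<^bsub>eord X\<^esub> y))"
    using assms sup_idem_pair[of "pp x" "pp y"] by (simp add: strongly_orth_def eorth_def)
  then show ?thesis
    using z assms(2,3) o eorth_sym[OF assms(2,3) o]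
    by (auto simp: strong_join_def pairwise_def least_def Upper_def ele_iff)
qed

lemma strong_join_act:
  assumes "strong_join A z" "s \<in> carrier S"
  shows "strong_join ((\<lambda>a. a \<triangleleft> s) ` A) (z \<triangleleft> s)"
proof -
  note D = strong_joinD[OF assms(1)]
  have F: "pp ` (\<lambda>a. a \<triangleleft> s) ` A = (\<lambda>h. h \<cdot> s) ` (\<cdot>) (s\<^sup>\<star>) ` pp ` A"
    unfolding image_image using D(2) assms(2) by (intro image_cong) (auto simp: pmap_act)
  have orth: "pp (a \<triangleleft> s) \<cdot> pp (b \<triangleleft> s) = \<^bold>0" if "a \<in> A" "b \<in> A" "a \<noteq> b" for a b
  proof -
    have ab: "a \<in> carrier X" "b \<in> carrier X" "pp a \<cdot> pp b = \<^bold>0" using D that by auto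
    then show ?thesis using src_orth_act[of "pp a" "pp b" s] assms(2) by (simp add: pmap_act_src)
  qed
  have "orth_set ((\<cdot>) (s\<^sup>\<star>) ` pp ` A)"
    using assms by (intro orth_set_mult_left strong_join_pmap) auto
  then have "lub (pp ` (\<lambda>a. a \<triangleleft> s) ` A) (s\<^sup>\<star> \<cdot> pp z \<cdot> s)"
    unfolding F using lub_mult_left[OF strong_join_pmap(1)[OF assms(1)] D(5), of "s\<^sup>\<star>"] assms(2)
    by (intro lub_mult_right) auto
  moreover have "a \<triangleleft> s = z \<triangleleft> s \<triangleleft> pp (a \<triangleleft> s)" if "a \<in> A" for a
  proof -
    have a: "a \<in> carrier X" "a = z \<triangleleft> pp a" using D that by auto
    have "s \<cdot> pp (a \<triangleleft> s) = pp a \<cdot> s"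
      using idem_move[of s "pp a"] a(1) assms(2) by (simp add: pmap_act mult_assoc)
    then have "z \<triangleleft> s \<triangleleft> pp (a \<triangleleft> s) = z \<triangleleft> pp a \<triangleleft> s" using a(1) D(3) assms(2) by simp
    then show ?thesis using a by simp
  qed
  moreover have "pairwise (eorth S X) ((\<lambda>a. a \<triangleleft> s) ` A)"
  proof (rule pairwiseI, clarify)
    fix a b assume "a \<in> A" "b \<in> A" "a \<triangleleft> s \<noteq> b \<triangleleft> s"
    then show "eorth S X (a \<triangleleft> s) (b \<triangleleft> s)" using orth[of a b] by (auto simp: eorth_def)
  qed
  ultimately show ?thesis
    using D assms(2) unfolding strong_join_def by (auto simp: pmap_act)
qed

lemma strong_join_UN:
  assumes "finite I" "\<And>i. i \<in> I \<Longrightarrow> strong_join (A i) (z i)" "strong_join (z ` I) w"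
    and orth: "\<And>i j. i \<in> I \<Longrightarrow> j \<in> I \<Longrightarrow> i \<noteq> j \<Longrightarrow> pp (z i) \<cdot> pp (z j) = \<^bold>0"
  shows "strong_join (\<Union>i\<in>I. A i) w"
proof -
  have c: "z i \<in> carrier X" "A i \<subseteq> carrier X" if "i \<in> I" for i
    using assms(2)[OF that] by (auto simp: strong_join_def)
  have w: "w \<in> carrier X" using assms(3) by (simp add: strong_join_def)
  have "eorth S X a b" if ij: "i \<in> I" "j \<in> I" and ab: "a \<in> A i" "b \<in> A j" "a \<noteq> b" for i j a b
  proof (cases "i = j")
    case True
    then show ?thesis using assms(2)[OF ij(1)] ab by (auto simp: strong_join_def pairwise_def)
  next
    case False
    have c': "a \<in> carrier X" "b \<in> carrier X" using c ij ab by blast+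
    have "pp (z i) \<cdot> pp a = pp a" "pp (z j) \<cdot> pp b = pp b"
      using pmap_le_if_upper[OF c(1)[OF ij(1)] c'(1) strong_joinD(4)[OF assms(2)[OF ij(1)] ab(1)]]
        pmap_le_if_upper[OF c(1)[OF ij(2)] c'(2) strong_joinD(4)[OF assms(2)[OF ij(2)] ab(2)]]
      by auto
    then have "pp a \<cdot> pp b = (pp a \<cdot> pp (z i)) \<cdot> (pp (z j) \<cdot> pp b)"
      using c' c(1) ij idem_commute[of "pp a" "pp (z i)"] by simp
    also have "\<dots> = pp a \<cdot> ((pp (z i) \<cdot> pp (z j)) \<cdot> pp b)"
      using c' c(1) ij by (simp add: mult_assoc)
    also have "\<dots> = \<^bold>0" using orth[OF ij False] c' by simp
    finally show ?thesis by (simp add: eorth_def)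
  qed
  then have 1: "pairwise (eorth S X) (\<Union>i\<in>I. A i)" by (auto simp: pairwise_def)
  have 2: "a = w \<triangleleft> pp a" if "i \<in> I" "a \<in> A i" for i a
  proof -
    have ac: "a \<in> carrier X" using c that by blast
    have "a = z i \<triangleleft> pp a" using strong_joinD(4)[OF assms(2)] that by blast
    moreover have "z i = w \<triangleleft> pp (z i)" using strong_joinD(4)[OF assms(3)] that by blast
    ultimately have "a = w \<triangleleft> pp (z i) \<triangleleft> pp a" by simp
    then have "a = w \<triangleleft> (pp (z i) \<cdot> pp a)" using w ac c(1)[OF that(1)] by simp
    moreover have "pp (z i) \<cdot> pp (z i \<triangleleft> pp a) = pp (z i \<triangleleft> pp a)"
      using c(1)[OF that(1)] ac by simp
    ultimately show ?thesis using \<open>a = z i \<triangleleft> pp a\<close> by simp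
  qed
  have sub: "pp ` A i \<subseteq> carrier S" if "i \<in> I" for i
    using c(2)[OF that] by auto
  have "lub (\<Union>i\<in>I. pp ` A i) (pp w) \<longleftrightarrow> lub ((\<lambda>i. pp (z i)) ` I) (pp w)"
    by (rule lub_UN) (use sub strong_joinD(5)[OF assms(2)] in auto)
  then have 3: "lub (pp ` (\<Union>i\<in>I. A i)) (pp w)"
    using strong_joinD(5)[OF assms(3)] by (simp add: image_UN image_image)
  show ?thesis
    unfolding strong_join_def
    using 1 2 3 w c assms(1) strong_joinD(1)[OF assms(2)] by blast
qed

lemma strong_join_insert:
  assumes "strong_join A z" "strong_join {a, z} w" "eorth S X a z"
  shows "strong_join (insert a A) w"
proof -
  have a: "a \<in> carrier X" and z: "z \<in> carrier X"
    using assms by (auto simp: strong_join_def)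
  have "{z, a} = {a, z}" by auto
  then have "strong_join (\<Union>b\<in>{True,False}. if b then {a} else A) w"
    using assms eorth_sym[OF a z assms(3)]
    by (intro strong_join_UN[where z = "\<lambda>b. if b then a else z"])
       (auto simp: eorth_def intro: strong_join_singleton[OF a] split: if_splits)
  moreover have "(\<Union>b\<in>{True,False}. if b then {a} else A) = insert a A" by auto
  ultimately show ?thesis by simp
qed

lemma strong_join_cong_zero:
  assumes "strong_join A z" "A - {pt X} = B - {pt X}" 
  shows "strong_join B z"
proof -
  note D = strong_joinD[OF assms(1)]
  have BA: "B \<subseteq> insert (pt X) A" using assms(2) by auto
  then have "pp ` A - {\<^bold>0} = pp ` B - {\<^bold>0}"
    using assms(2) by (auto simp: image_iff)
  then have "lub (pp ` B) (pp z)" using D(5) Upper_cong_zero by metis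
  moreover have "eorth S X a b" if "a \<in> B" "b \<in> B" "a \<noteq> b" for a b
  proof -
    have "a = pt X \<or> a \<in> A" "b = pt X \<or> b \<in> A" "a \<in> carrier X" "b \<in> carrier X"
      using that BA D(2) by auto
    then show ?thesis using D(6)[of a b] that(3) by (auto simp: eorth_def)
  qed
  moreover have "finite B" using BA D(1) finite_subset by blast
  ultimately show ?thesis using D BA by (auto simp: strong_join_def pairwise_def)
qed

lemma strong_join_lub_zero:
  assumes "strong_join A z" "e \<in> idems S" "\<And>a. a \<in> A \<Longrightarrow> e \<cdot> pp a = \<^bold>0"
  shows "e \<cdot> pp z = \<^bold>0"
  by (rule lub_mult_left_zero[OF strong_join_pmap(1)[OF assms(1)] strong_joinD(5)[OF assms(1)]])
     (use assms in auto)

end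

section \<open>Modules\<close>

locale oc_module = orthogonally_complete S + etale_module S X
  for S :: "('a, 'm) zsemigroup_scheme" (structure) and X :: "('x, 'a) etale"

sublocale oc_module \<subseteq> oc_etale ..

text \<open>For an orthogonal cover of \<open>g\<close> by two idempotents, the restrictions of both elements to \<open>g\<close>
  are the join that exists by the first module axiom.\<close>

lemma (in oc_module) module_separated:
  assumes "orth_set F" "F \<subseteq> idems S" "lub F g" "u \<in> carrier X" "v \<in> carrier X"
    and "\<And>f. f \<in> F \<Longrightarrow> u \<triangleleft> f = v \<triangleleft> f"
  shows "u \<triangleleft> g = v \<triangleleft> g"
proof -
  have "finite F" using assms by (simp add: orth_set_def)
  then show ?thesis using assms(1-3) assms(6)
  proof (induction F arbitrary: g)
    case empty
    then have "g = \<^bold>0" using lub_zeros lub_unique by blast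
    then show ?case using assms by simp
  next
    case (insert f F)
    then have F: "orth_set F" "F \<subseteq> idems S" and f: "f \<in> idems S"
      by (auto simp: orth_set_def pairwise_def)
    then obtain h where h: "lub F h" using lub_exists by blast
    have hi: "h \<in> idems S" using lub_idem[OF F(1) h F(2)] .
    have fh: "sorth S f h"
    proof (rule sorth_lub[OF F(1) h])
      fix a assume "a \<in> F"
      then show "sorth S f a"
        using insert.prems(1) insert.hyps by (auto simp: orth_set_def pairwise_def)
    qed (use f in auto)
    have gi: "g \<in> idems S" using lub_idem[OF insert.prems(1,3,2)] .
    have "lub {f, h} g"
    proof -
      have "lub (\<Union>b\<in>{True,False}. if b then {f} else F) g \<longleftrightarrow>
        lub ((\<lambda>b. if b then f else h) ` {True,False}) g"
        by (rule lub_UN) (use F f h in \<open>auto intro: lub_singleton\<close>)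
      moreover have "(\<Union>b\<in>{True,False}. if b then {f} else F) = insert f F"
        "(\<lambda>b. if b then f else h) ` {True,False} = {f, h}" by auto
      ultimately show ?thesis using insert.prems(3) by simp
    qed
    moreover have o: "orth_set {f, h}"
      using f hi fh by (intro orth_set_idemI) (auto simp: idem_commute[of h f])
    ultimately have j: "strong_join {w \<triangleleft> f, w \<triangleleft> h} (w \<triangleleft> g)" if "w \<in> carrier X" for w
      using strong_join_act_lub[of "{f, h}" g w] that by simp
    have eq: "w \<triangleleft> g = (w \<triangleleft> f) \<squnion>\<^bsub>eord X\<^esub> (w \<triangleleft> h)" if w: "w \<in> carrier X" for w
    proof -
      let ?z = "(w \<triangleleft> f) \<squnion>\<^bsub>eord X\<^esub> (w \<triangleleft> h)"
      have "eorth S X (w \<triangleleft> f) (w \<triangleleft> h)"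
        using w f hi fh idem_left_commute[of f "pp w" h] by (simp add: eorth_def mult_assoc)
      then have so: "strongly_orth S X (w \<triangleleft> f) (w \<triangleleft> h)"
        using M1[of "w \<triangleleft> f" "w \<triangleleft> h"] w f hi by (auto simp: strongly_orth_def)
      then obtain z where z: "elub {w \<triangleleft> f, w \<triangleleft> h} z"
        by (auto simp: strongly_orth_def has_join_def)
      then have "elub {w \<triangleleft> f, w \<triangleleft> h} ?z" unfolding join_def sup_def by (rule someI)
      moreover have "w \<triangleleft> g \<in> Upper (eord X) {w \<triangleleft> f, w \<triangleleft> h}"
        using strong_joinD(4)[OF j[OF w]] w gi f hi unfolding Upper_def ele_iff
        by (auto simp del: act_assoc pmap_act_idem)
      ultimately have "?z = w \<triangleleft> g \<triangleleft> pp ?z"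
        by (auto simp: least_def ele_iff)
      moreover have "pp ?z = pp (w \<triangleleft> g)"
      proof -
        have "pp ?z = pp (w \<triangleleft> f) \<squnion>\<^bsub>sord S\<^esub> pp (w \<triangleleft> h)" using so by (simp add: strongly_orth_def)
        then show ?thesis
          using strong_joinD(5)[OF j[OF w]] sup_eq by (simp add: join_def)
      qed
      ultimately show ?thesis using w gi act_pmap[of "w \<triangleleft> g"] by auto
    qed
    have "u \<triangleleft> f = v \<triangleleft> f" using insert.prems(4) by blast
    moreover have "u \<triangleleft> h = v \<triangleleft> h"
      by (rule insert.IH[OF F h]) (use insert.prems(4) in auto)
    ultimately show ?case using eq[OF assms(4)] eq[OF assms(5)] by simp
  qed
qed

sublocale oc_module \<subseteq> orth_etale
  by unfold_locales (rule module_separated)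

context oc_module
begin

lemma strong_join_pair_exists:
  assumes "x \<in> carrier X" "y \<in> carrier X" "eorth S X x y"
  shows "strong_join {x, y} (x \<squnion>\<^bsub>eord X\<^esub> y)"
  using M1[OF assms] assms by (intro strongly_orth_strong_join) (auto simp: strongly_orth_def)

text \<open>The join of a finite family exists by induction: orthogonality to all members passes to their
  join, so only binary joins are needed.\<close>

lemma strong_join_exists:
  assumes "finite A" "A \<subseteq> carrier X" "pairwise (eorth S X) A"
  shows "\<exists>z. strong_join A z"
  using assms
proof (induction A)
  case empty
  then show ?case using strong_join_empty by blast
next
  case (insert a A)
  then have A: "A \<subseteq> carrier X" "pairwise (eorth S X) A" and a: "a \<in> carrier X"
    by (auto simp: pairwise_def)
  then obtain z where z: "strong_join A z" using insert.IH by blast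
  have "eorth S X a z"
    unfolding eorth_def
    by (rule strong_join_lub_zero[OF z])
       (use insert.prems(2) insert.hyps a in \<open>auto simp: pairwise_def eorth_def\<close>)
  then show ?case
    using strong_join_insert[OF z] strong_join_pair_exists[of a z] a strong_joinD(3)[OF z] by blast
qed

end

text \<open>Since an orthogonal join in the sense of \<open>strong_join\<close> is preserved by the action, the second
  module axiom is automatic.\<close>

lemma (in orth_etale) etale_moduleI:
  assumes "\<And>x y. \<lbrakk>x \<in> carrier X; y \<in> carrier X; eorth S X x y\<rbrakk> \<Longrightarrow> \<exists>z. strong_join {x, y} z"
  shows "etale_module S X"
proof
  fix x y assume xy: "x \<in> carrier X" "y \<in> carrier X" "eorth S X x y"
  obtain z where z: "strong_join {x, y} z" using assms[OF xy] by blast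
  show "has_join (eord X) {x, y} \<and> pp (x \<squnion>\<^bsub>eord X\<^esub> y) = pp x \<squnion>\<^bsub>sord S\<^esub> pp y"
    using strong_join_pair(1)[OF z xy(3)] by (simp add: strongly_orth_def)
  fix s assume s: "s \<in> carrier S"
  have j: "strong_join {x \<triangleleft> s, y \<triangleleft> s} (z \<triangleleft> s)"
    using strong_join_act[OF z s] by simp
  show "(x \<squnion>\<^bsub>eord X\<^esub> y) \<triangleleft> s = (x \<triangleleft> s) \<squnion>\<^bsub>eord X\<^esub> (y \<triangleleft> s)"
  proof -
    have "pp (x \<triangleleft> s) \<cdot> pp (y \<triangleleft> s) = \<^bold>0"
      using src_orth_act[of "pp x" "pp y" s] xy s by (simp add: pmap_act_src eorth_def)
    then show ?thesis
      using strong_join_pair(2)[OF j] strong_join_pair(2)[OF z xy(3)] by (simp add: eorth_def)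
  qed
qed

section \<open>Bases\<close>

context pointed_etale
begin

text \<open>The index set is \<open>\<nat>\<close>, with almost all members zero, in order to match the shape of the
  matrices in \<open>M\<^sub>\<omega>(S)\<close>. The freeness condition says that \<open>m i \<triangleleft> s\<close> determines \<open>p(m i) \<cdot> s\<close>, and
  that different members have only the zero element as a common multiple.\<close>

definition is_basis :: "(nat \<Rightarrow> 'x) \<Rightarrow> bool"
  where "is_basis m \<longleftrightarrow> range m \<subseteq> carrier X \<and> finite {i. m i \<noteq> pt X} \<and>
    (\<forall>i j. \<forall>s\<in>carrier S. \<forall>t\<in>carrier S. m i \<triangleleft> s = m j \<triangleleft> t \<longrightarrow>
      pp (m i) \<cdot> s = pp (m j) \<cdot> t \<and> (i \<noteq> j \<longrightarrow> pp (m i) \<cdot> s = \<^bold>0)) \<and>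
    (\<forall>x\<in>carrier X. \<exists>A. strong_join A x \<and> A \<subseteq> {m i \<triangleleft> s | i s. s \<in> carrier S})"

lemma is_basisD:
  assumes "is_basis m"
  shows "m i \<in> carrier X" "finite {i. m i \<noteq> pt X}"
    "\<lbrakk>m i \<triangleleft> s = m j \<triangleleft> t; s \<in> carrier S; t \<in> carrier S\<rbrakk> \<Longrightarrow> pp (m i) \<cdot> s = pp (m j) \<cdot> t"
    "\<lbrakk>m i \<triangleleft> s = m j \<triangleleft> t; i \<noteq> j; s \<in> carrier S; t \<in> carrier S\<rbrakk> \<Longrightarrow> pp (m i) \<cdot> s = \<^bold>0"
    "x \<in> carrier X \<Longrightarrow> \<exists>A. strong_join A x \<and> A \<subseteq> {m i \<triangleleft> s | i s. s \<in> carrier S}"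
proof -
  have range: "range m \<subseteq> carrier X"
    using assms unfolding is_basis_def by (elim conjE)
  have fin: "finite {i. m i \<noteq> pt X}"
    using assms unfolding is_basis_def by (elim conjE)
  have free: "\<forall>i j. \<forall>s\<in>carrier S. \<forall>t\<in>carrier S. m i \<triangleleft> s = m j \<triangleleft> t \<longrightarrow>
      pp (m i) \<cdot> s = pp (m j) \<cdot> t \<and> (i \<noteq> j \<longrightarrow> pp (m i) \<cdot> s = \<^bold>0)"
    using assms unfolding is_basis_def by (elim conjE)
  have gen: "\<forall>x\<in>carrier X. \<exists>A. strong_join A x \<and> A \<subseteq> {m i \<triangleleft> s | i s. s \<in> carrier S}"
    using assms unfolding is_basis_def by (elim conjE)
  show "m i \<in> carrier X" using range by auto
  show "finite {i. m i \<noteq> pt X}" by (rule fin)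
  show "\<lbrakk>m i \<triangleleft> s = m j \<triangleleft> t; s \<in> carrier S; t \<in> carrier S\<rbrakk> \<Longrightarrow> pp (m i) \<cdot> s = pp (m j) \<cdot> t"
    using free by blast
  show "\<lbrakk>m i \<triangleleft> s = m j \<triangleleft> t; i \<noteq> j; s \<in> carrier S; t \<in> carrier S\<rbrakk> \<Longrightarrow> pp (m i) \<cdot> s = \<^bold>0"
    using free by blast
  show "x \<in> carrier X \<Longrightarrow> \<exists>A. strong_join A x \<and> A \<subseteq> {m i \<triangleleft> s | i s. s \<in> carrier S}"
    using gen by blast
qed

text \<open>An equation between multiples of basis elements has a meaning that depends only on the
  structure values; hence it transfers to any other family with the same structure values.\<close>

lemma basis_eq_transfer:
  assumes "is_basis m" "pointed_etale S Y" "\<And>i. n i \<in> carrier Y"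
    and "\<And>i. pmap Y (n i) = pp (m i)" "m i \<triangleleft> s = m j \<triangleleft> t" "s \<in> carrier S" "t \<in> carrier S"
  shows "act Y (n i) s = act Y (n j) t"
proof -
  interpret Y: pointed_etale S Y by fact
  have 1: "pp (m i) \<cdot> s = pp (m j) \<cdot> t" and 2: "i \<noteq> j \<Longrightarrow> pp (m i) \<cdot> s = \<^bold>0"
    using is_basisD(3,4)[OF assms(1,5)] assms(6,7) by auto
  have eq: "act Y (n k) u = act Y (n k) (pp (m k) \<cdot> u)" if "u \<in> carrier S" for k u
    using Y.act_pmap_mult[OF assms(3) that, of k] assms(4) by simp
  show ?thesis
  proof (cases "i = j")
    case True
    then show ?thesis using eq[OF assms(6), of i] eq[OF assms(7), of i] 1 by simp
  next
    case False
    then have "pp (m i) \<cdot> s = \<^bold>0" "pp (m j) \<cdot> t = \<^bold>0" using 1 2 by auto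
    then show ?thesis
      using eq[OF assms(6), of i] eq[OF assms(7), of j] assms(3) by simp
  qed
qed

end

lemma etale_hom_strong_join:
  assumes "pointed_etale S X" "pointed_etale S Y"
    and "\<And>x. x \<in> carrier X \<Longrightarrow> \<alpha> x \<in> carrier Y"
    and "\<And>x s. x \<in> carrier X \<Longrightarrow> s \<in> carrier S \<Longrightarrow> \<alpha> (act X x s) = act Y (\<alpha> x) s"
    and "\<And>x. x \<in> carrier X \<Longrightarrow> pmap Y (\<alpha> x) = pmap X x"
    and "pointed_etale.strong_join S X A x"
  shows "pointed_etale.strong_join S Y (\<alpha> ` A) (\<alpha> x)"
proof -
  interpret X: pointed_etale S X by fact
  interpret Y: pointed_etale S Y by fact
  note D = X.strong_joinD[OF assms(6)]
  have "pmap Y ` \<alpha> ` A = pmap X ` A"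
    unfolding image_image using D(2) assms(5) by (intro image_cong) auto
  moreover have "pairwise (eorth S Y) (\<alpha> ` A)"
  proof (rule pairwiseI, clarify)
    fix a b assume "a \<in> A" "b \<in> A" "\<alpha> a \<noteq> \<alpha> b"
    then show "eorth S Y (\<alpha> a) (\<alpha> b)"
      using D(2) D(6)[of a b] assms(5) by (auto simp: eorth_def subset_iff)
  qed
  moreover have "\<alpha> a = act Y (\<alpha> x) (pmap Y (\<alpha> a))" if "a \<in> A" for a
    using D(2) D(4)[OF that] assms(4)[OF D(3), of "pmap X a"] assms(5)[of a] that by auto
  ultimately show ?thesis
    unfolding Y.strong_join_def using D assms(3,5) by auto
qed

lemma module_iso_basis:
  assumes "pointed_etale S X" "pointed_etale S Y" "module_iso S X Y" "pointed_etale.is_basis S X m"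
  shows "\<exists>n. pointed_etale.is_basis S Y n \<and> (\<forall>i. pmap Y (n i) = pmap X (m i))"
proof -
  interpret X: pointed_etale S X by fact
  interpret Y: pointed_etale S Y by fact
  obtain \<alpha> \<beta> where hom: "\<alpha> \<in> module_hom S X Y" "\<beta> \<in> module_hom S Y X"
    and inv: "\<And>x. x \<in> carrier X \<Longrightarrow> \<beta> (\<alpha> x) = x" "\<And>y. y \<in> carrier Y \<Longrightarrow> \<alpha> (\<beta> y) = y"
    using assms(3) by (auto simp: module_iso_def)
  have c: "\<And>x. x \<in> carrier X \<Longrightarrow> \<alpha> x \<in> carrier Y" "\<And>y. y \<in> carrier Y \<Longrightarrow> \<beta> y \<in> carrier X"
    and a: "\<And>x s. x \<in> carrier X \<Longrightarrow> s \<in> carrier S \<Longrightarrow> \<alpha> (act X x s) = act Y (\<alpha> x) s"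
    and p: "\<And>x. x \<in> carrier X \<Longrightarrow> pmap Y (\<alpha> x) = pmap X x" and pt: "\<alpha> (pt X) = pt Y"
    using hom by (auto simp: module_hom_def)
  note D = X.is_basisD[OF assms(4)]
  have "Y.is_basis (\<lambda>i. \<alpha> (m i))"
    unfolding Y.is_basis_def
  proof (intro conjI allI ballI impI)
    have "{i. \<alpha> (m i) \<noteq> pt Y} \<subseteq> {i. m i \<noteq> pt X}" using pt by auto
    then show "finite {i. \<alpha> (m i) \<noteq> pt Y}" using D(2) finite_subset by blast
  next
    fix i j s t assume st: "s \<in> carrier S" "t \<in> carrier S" "act Y (\<alpha> (m i)) s = act Y (\<alpha> (m j)) t"
    then have "\<alpha> (act X (m i) s) = \<alpha> (act X (m j) t)" using D(1) a by simp
    then have eq: "act X (m i) s = act X (m j) t" using inv(1) D(1) st X.act_closed by metis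
    show "pmap Y (\<alpha> (m i)) \<cdot>\<^bsub>S\<^esub> s = pmap Y (\<alpha> (m j)) \<cdot>\<^bsub>S\<^esub> t"
      using D(3)[OF eq st(1,2)] p D(1) by simp
    show "pmap Y (\<alpha> (m i)) \<cdot>\<^bsub>S\<^esub> s = \<^bold>0\<^bsub>S\<^esub>" if "i \<noteq> j"
      using D(4)[OF eq that st(1,2)] p D(1) by simp
  next
    fix y assume y: "y \<in> carrier Y"
    obtain A where A: "X.strong_join A (\<beta> y)" "A \<subseteq> {act X (m i) s | i s. s \<in> carrier S}"
      using D(5)[OF c(2)[OF y]] by blast
    have "Y.strong_join (\<alpha> ` A) y"
      using etale_hom_strong_join[OF assms(1,2) c(1) a p A(1)] inv(2)[OF y] by simp
    moreover have "\<alpha> ` A \<subseteq> {act Y (\<alpha> (m i)) s | i s. s \<in> carrier S}"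
      using A(2) a D(1) by (auto simp: subset_iff) (metis image_eqI)
    ultimately show "\<exists>A. Y.strong_join A y \<and> A \<subseteq> {act Y (\<alpha> (m i)) s | i s. s \<in> carrier S}" by blast
  qed (use c(1) D(1) in auto)
  then show ?thesis using p D(1) by (intro exI[of _ "\<lambda>i. \<alpha> (m i)"]) auto
qed

text \<open>Preservation of action and structure map is enough: strong joins are described by these two.\<close>

lemma module_homI:
  assumes "oc_module S X" "oc_module S Y"
    and "\<And>x. x \<in> carrier X \<Longrightarrow> \<alpha> x \<in> carrier Y"
    and "\<And>x s. x \<in> carrier X \<Longrightarrow> s \<in> carrier S \<Longrightarrow> \<alpha> (act X x s) = act Y (\<alpha> x) s"
    and "\<And>x. x \<in> carrier X \<Longrightarrow> pmap Y (\<alpha> x) = pmap X x"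
  shows "\<alpha> \<in> module_hom S X Y"
proof -
  interpret X: oc_module S X by fact
  interpret Y: oc_module S Y by fact
  have "\<alpha> (x \<squnion>\<^bsub>eord X\<^esub> y) = \<alpha> x \<squnion>\<^bsub>eord Y\<^esub> \<alpha> y"
    if xy: "x \<in> carrier X" "y \<in> carrier X" "eorth S X x y" for x y
  proof -
    have "Y.strong_join (\<alpha> ` {x, y}) (\<alpha> (x \<squnion>\<^bsub>eord X\<^esub> y))"
      by (rule etale_hom_strong_join[OF X.pointed_etale_axioms Y.pointed_etale_axioms])
         (use assms X.strong_join_pair_exists[OF xy] in auto)
    then show ?thesis
      using Y.strong_join_pair(2)[of "\<alpha> x" "\<alpha> y"] xy assms(5) by (simp add: eorth_def)
  qed
  moreover have "\<alpha> (pt X) = pt Y"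
    using Y.pmap_eq_zero[of "\<alpha> (pt X)"] assms(3,5)[of "pt X"] by simp
  ultimately show ?thesis using assms by (auto simp: module_hom_def)
qed

lemma module_isoI:
  assumes "oc_module S X" "oc_module S Y"
    and c: "\<And>x. x \<in> carrier X \<Longrightarrow> \<alpha> x \<in> carrier Y" "\<And>y. y \<in> carrier Y \<Longrightarrow> \<beta> y \<in> carrier X"
    and i: "\<And>x. x \<in> carrier X \<Longrightarrow> \<beta> (\<alpha> x) = x" "\<And>y. y \<in> carrier Y \<Longrightarrow> \<alpha> (\<beta> y) = y"
    and a: "\<And>x s. x \<in> carrier X \<Longrightarrow> s \<in> carrier S \<Longrightarrow> \<alpha> (act X x s) = act Y (\<alpha> x) s"
    and p: "\<And>x. x \<in> carrier X \<Longrightarrow> pmap Y (\<alpha> x) = pmap X x"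
  shows "module_iso S X Y"
proof -
  interpret X: oc_module S X by fact
  interpret Y: oc_module S Y by fact
  have "\<beta> (act Y y s) = act X (\<beta> y) s" if "y \<in> carrier Y" "s \<in> carrier S" for y s
    using a[of "\<beta> y" s] i(1)[of "act X (\<beta> y) s"] that c i by simp
  moreover have "pmap X (\<beta> y) = pmap Y y" if "y \<in> carrier Y" for y
    using p[of "\<beta> y"] that c i by simp
  ultimately have "\<beta> \<in> module_hom S Y X"
    by (intro module_homI[OF assms(2,1)] c(2))
  moreover have "\<alpha> \<in> module_hom S X Y"
    by (intro module_homI[OF assms(1,2)] c a p)
  ultimately show ?thesis using i by (auto simp: module_iso_def)
qed

lemma module_iso_sym: "module_iso S X Y \<Longrightarrow> module_iso S Y X"
  by (auto simp: module_iso_def)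

subsection \<open>Modules with the same basis idempotents\<close>

locale basis_pair = X: oc_module S X + Y: oc_module S Y
  for S :: "('a, 'm) zsemigroup_scheme" (structure)
    and X :: "('x, 'a) etale" and Y :: "('y, 'a) etale" +
  fixes m :: "nat \<Rightarrow> 'x" and n :: "nat \<Rightarrow> 'y"
  assumes bm: "X.is_basis m" and bn: "Y.is_basis n"
    and pmap_basis: "\<And>i. pmap Y (n i) = pmap X (m i)"
begin

lemma basis_closed [simp]: "m i \<in> carrier X" "n i \<in> carrier Y"
  using X.is_basisD(1)[OF bm] Y.is_basisD(1)[OF bn] by auto

lemma swap: "basis_pair S Y X n m"
  by unfold_locales (use bm bn pmap_basis in auto)

lemma pmap_act_basis: "s \<in> carrier S \<Longrightarrow> pmap Y (act Y (n i) s) = pmap X (act X (m i) s)"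
  by (simp add: X.pmap_act Y.pmap_act pmap_basis)

lemma transfer_eq:
  "act X (m i) s = act X (m j) t \<Longrightarrow> s \<in> carrier S \<Longrightarrow> t \<in> carrier S \<Longrightarrow>
    act Y (n i) s = act Y (n j) t"
  by (rule X.basis_eq_transfer[OF bm Y.pointed_etale_axioms]) (auto simp: pmap_basis)

text \<open>Elements correspond when they lie above corresponding multiples of basis elements.\<close>

definition below
  where "below x y \<longleftrightarrow> (\<forall>i. \<forall>s\<in>carrier S.
    act X (m i) s = act X x (pmap X (act X (m i) s)) \<longrightarrow>
    act Y (n i) s = act Y y (pmap Y (act Y (n i) s)))"

text \<open>If \<open>x\<close> and \<open>y\<close> are joins of corresponding multiples, \<open>m j \<triangleleft> t \<le> x\<close> gives, on each piece
  \<open>m i \<triangleleft> s\<close> of \<open>x\<close>, an equation between multiples of basis elements. It transfers to \<open>n\<close>, and the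
  pieces cover \<open>n j \<triangleleft> t\<close>.\<close>

lemma below_strong_join:
  assumes x: "X.strong_join ((\<lambda>(i, s). act X (m i) s) ` K) x"
    and y: "Y.strong_join ((\<lambda>(i, s). act Y (n i) s) ` K) y"
    and K: "K \<subseteq> UNIV \<times> carrier S"
  shows "pmap X x = pmap Y y" "below x y"
proof -
  have "pmap Y ` (\<lambda>(i, s). act Y (n i) s) ` K = pmap X ` (\<lambda>(i, s). act X (m i) s) ` K"
    unfolding image_image using K by (intro image_cong) (auto simp: pmap_act_basis)
  then show pxy: "pmap X x = pmap Y y"
    using X.strong_joinD(5)[OF x] Y.strong_joinD(5)[OF y] X.lub_unique by metis
  have c: "x \<in> carrier X" "y \<in> carrier Y"
    using X.strong_joinD(3)[OF x] Y.strong_joinD(3)[OF y] by auto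
  show "below x y"
    unfolding below_def
  proof (intro allI ballI impI)
    fix j t assume t: "t \<in> carrier S" and le: "act X (m j) t = act X x (pmap X (act X (m j) t))"
    let ?g = "pmap X (act X (m j) t)"
    let ?u = "act Y (n j) t" and ?v = "act Y y ?g"
    have g: "?g \<in> idems S" using t by simp
    have "act Y ?u (pmap Y y) = act Y ?v (pmap Y y)"
    proof (rule Y.strong_join_cong[OF y])
      fix b assume "b \<in> (\<lambda>(i, s). act Y (n i) s) ` K"
      then obtain i s where isK: "(i, s) \<in> K" and b: "b = act Y (n i) s" by auto
      then have s: "s \<in> carrier S" using K by auto
      let ?f = "pmap X (act X (m i) s)"
      have f: "?f \<in> idems S" "pmap Y b = ?f" using s b by (auto simp: pmap_act_basis)
      have "act X (m i) s = act X x ?f"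
        by (rule X.strong_joinD(4)[OF x]) (use isK in force)
      then have "act X (act X (m i) s) ?g = act X x (?f \<cdot> ?g)"
        using f c g by (metis X.act_assoc X.idem_closed)
      also have "\<dots> = act X x (?g \<cdot> ?f)" using f g by (simp add: X.idem_commute)
      also have "\<dots> = act X (act X x ?g) ?f" using f g c by simp
      also have "\<dots> = act X (act X (m j) t) ?f" using le by simp
      finally have "act X (m j) (t \<cdot> ?f) = act X (m i) (s \<cdot> ?g)" using f g s t by simp
      then have "act Y (n j) (t \<cdot> ?f) = act Y (n i) (s \<cdot> ?g)"
        using transfer_eq f g s t by blast
      also have "\<dots> = act Y b ?g" using b s g by simp
      also have "b = act Y y ?f"
        using Y.strong_joinD(4)[OF y \<open>b \<in> _\<close>] f by simp
      finally have "act Y (n j) (t \<cdot> ?f) = act Y y (?f \<cdot> ?g)" using f g c by simp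
      then show "act Y ?u (pmap Y b) = act Y ?v (pmap Y b)"
        using f g c t by (simp add: X.idem_commute[of ?f ?g])
    qed (use c t g in auto)
    moreover have "pmap Y y \<cdot> ?g = ?g"
      using X.pmap_le_if_upper[OF c(1) _ le] t pxy by simp
    then have "?g \<cdot> pmap Y y = ?g" using X.idem_commute[of ?g "pmap Y y"] g c by simp
    moreover have "act Y ?u (pmap Y y) = act Y ?u (?g \<cdot> pmap Y y)"
      using Y.act_pmap_mult[of ?u "pmap Y y"] t c by (simp add: pmap_act_basis)
    moreover have "act Y ?u ?g = ?u"
      using Y.act_pmap[of ?u] t by (simp add: pmap_act_basis)
    ultimately show "?u = act Y y (pmap Y ?u)"
      using c g t by (simp add: pmap_act_basis)
  qed
qed

text \<open>An inequality \<open>m i \<triangleleft> s \<le> x \<triangleleft> u\<close> is pulled back along \<open>u\<^sup>\<star>\<close>, transferred, and pushed forward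
  along \<open>u\<close>; nothing is lost since \<open>m i \<triangleleft> s\<close> is fixed by \<open>src u\<close>.\<close>

lemma below_act:
  assumes "below x y" "x \<in> carrier X" "y \<in> carrier Y" "u \<in> carrier S"
  shows "below (act X x u) (act Y y u)"
  unfolding below_def
proof (intro allI ballI impI)
  fix i s assume s: "s \<in> carrier S"
    and le: "act X (m i) s = act X (act X x u) (pmap X (act X (m i) s))"
  define e where "e = pmap X (act X (m i) s)"
  have e: "e \<in> idems S" using s by (simp add: e_def)
  have eq: "act X (m i) s = act X x (u \<cdot> e)" using le assms e unfolding e_def[symmetric] by simp
  have "act X (m i) (s \<cdot> u\<^sup>\<star>) = act X (act X (m i) s) (u\<^sup>\<star>)" using s assms by simp
  also have "\<dots> = act X x (u \<cdot> (e \<cdot> u\<^sup>\<star>))"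
    unfolding eq using assms s e by (simp add: X.mult_assoc)
  finally have "act X (m i) (s \<cdot> u\<^sup>\<star>) = act X x (u \<cdot> (e \<cdot> u\<^sup>\<star>))" .
  moreover have "u \<cdot> (e \<cdot> u\<^sup>\<star>) \<in> idems S" using X.conj_idem[of "u\<^sup>\<star>" e] assms e by simp
  ultimately have "act X (m i) (s \<cdot> u\<^sup>\<star>) = act X x (pmap X (act X (m i) (s \<cdot> u\<^sup>\<star>)))"
    using X.restrict_pmap assms(2) by blast
  then have "act Y (n i) (s \<cdot> u\<^sup>\<star>) = act Y y (pmap Y (act Y (n i) (s \<cdot> u\<^sup>\<star>)))"
    using assms(1,4) s unfolding below_def by blast
  moreover define h where "h = pmap Y (act Y (n i) (s \<cdot> u\<^sup>\<star>))"
  ultimately have h: "h \<in> idems S" "act Y (n i) (s \<cdot> u\<^sup>\<star>) = act Y y h" using s assms by auto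
  have "act X (m i) (s \<cdot> X.src u) = act X (act X (m i) s) (X.src u)" using s assms by simp
  also have "\<dots> = act X x (u \<cdot> (e \<cdot> X.src u))"
    unfolding eq using assms s e by (simp add: X.mult_assoc)
  also have "e \<cdot> X.src u = X.src u \<cdot> e" using e assms by (intro X.idem_commute) auto
  also have "act X x (u \<cdot> (X.src u \<cdot> e)) = act X x (u \<cdot> e)"
    using assms e by (simp add: X.mult_assoc)
  finally have "act X (m i) (s \<cdot> X.src u) = act X (m i) s" using eq by simp
  then have "act Y (n i) s = act Y (n i) (s \<cdot> X.src u)"
    using transfer_eq[of i "s \<cdot> X.src u" i s] s assms by simp
  also have "\<dots> = act Y (act Y (n i) (s \<cdot> u\<^sup>\<star>)) u" using s assms by (simp add: X.mult_assoc)
  also have "\<dots> = act Y y (h \<cdot> u)" using h assms by simp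
  also have "\<dots> = act Y (act Y y u) (u\<^sup>\<star> \<cdot> (h \<cdot> u))"
    using X.idem_move[of u h] h assms by simp
  finally show "act Y (n i) s = act Y (act Y y u) (pmap Y (act Y (n i) s))"
    using Y.restrict_pmap[of "act Y y u" "u\<^sup>\<star> \<cdot> (h \<cdot> u)"] h assms by blast
qed

end

context basis_pair
begin

text \<open>All notions for the pair with the two modules exchanged. The interpretation is renewed below
  whenever a further definition has to be available in both directions.\<close>

interpretation rev: basis_pair S Y X n m by (rule swap)

definition matches
  where "matches x y \<longleftrightarrow> x \<in> carrier X \<and> y \<in> carrier Y \<and> pmap X x = pmap Y y \<and>
    below x y \<and> rev.below y x"

end

context basis_pair
begin

interpretation rev: basis_pair S Y X n m by (rule swap)

lemma matches_exists:
  assumes "x \<in> carrier X"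
  shows "\<exists>y. matches x y"
proof -
  obtain A where A: "X.strong_join A x" "A \<subseteq> {act X (m i) s | i s. s \<in> carrier S}"
    using X.is_basisD(5)[OF bm assms] by blast
  have "A \<subseteq> (\<lambda>(i, s). act X (m i) s) ` (UNIV \<times> carrier S)" using A(2) by fastforce
  then obtain K where K: "K \<subseteq> UNIV \<times> carrier S" "finite K" "A = (\<lambda>(i, s). act X (m i) s) ` K"
    using finite_subset_image[OF X.strong_joinD(1)[OF A(1)]] by metis
  let ?B = "(\<lambda>(i, s). act Y (n i) s) ` K"
  have "pairwise (eorth S Y) ?B"
  proof (rule pairwiseI, clarify)
    fix i s j t assume k: "(i, s) \<in> K" "(j, t) \<in> K" "act Y (n i) s \<noteq> act Y (n j) t"
    then have st: "s \<in> carrier S" "t \<in> carrier S" using K(1) by auto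
    then have "act X (m i) s \<noteq> act X (m j) t" using transfer_eq k(3) by blast
    moreover have "act X (m i) s \<in> A" "act X (m j) t \<in> A"
      unfolding K(3) using k(1,2) by force+
    ultimately show "eorth S Y (act Y (n i) s) (act Y (n j) t)"
      using X.strong_joinD(6)[OF A(1)] st by (simp add: eorth_def pmap_act_basis)
  qed
  moreover have "?B \<subseteq> carrier Y" using K(1) by auto
  ultimately obtain y where y: "Y.strong_join ?B y"
    using Y.strong_join_exists[of ?B] K(2) by auto
  have "matches x y"
    using below_strong_join[OF A(1)[unfolded K(3)] y K(1)]
      rev.below_strong_join[OF y A(1)[unfolded K(3)] K(1)] assms Y.strong_joinD(3)[OF y]
    by (auto simp: matches_def)
  then show ?thesis by blast
qed

text \<open>The match of \<open>x\<close> is the join of its multiples of basis elements, all of which lie below any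
  other match.\<close>

lemma matches_unique:
  assumes "matches x y" "matches x z"
  shows "y = z"
proof -
  have yz: "y \<in> carrier Y" "z \<in> carrier Y" "pmap Y y = pmap Y z"
    using assms by (auto simp: matches_def)
  obtain B where B: "Y.strong_join B y" "B \<subseteq> {act Y (n i) s | i s. s \<in> carrier S}"
    using Y.is_basisD(5)[OF bn yz(1)] by blast
  have "y = act Y z (pmap Y y)"
  proof (rule Y.strong_join_least[OF B(1) yz(2)])
    fix b assume b: "b \<in> B"
    then obtain i s where isK: "s \<in> carrier S" "b = act Y (n i) s" using B(2) by blast
    then show "b = act Y z (pmap Y b)"
      using Y.strong_joinD(4)[OF B(1) b] assms
      unfolding matches_def below_def rev.below_def by blast
  qed
  then show ?thesis using yz by simp
qed

lemma matches_act:
  "matches x y \<Longrightarrow> s \<in> carrier S \<Longrightarrow> matches (act X x s) (act Y y s)"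
  using below_act rev.below_act by (auto simp: matches_def X.pmap_act Y.pmap_act)

end

context basis_pair
begin

interpretation rev: basis_pair S Y X n m by (rule swap)

lemma rev_matches: "rev.matches y x \<longleftrightarrow> matches x y"
  unfolding matches_def rev.matches_def by auto

theorem iso_if_same_basis_idempotents: "module_iso S X Y"
proof -
  define \<alpha> where "\<alpha> x = (SOME y. matches x y)" for x
  define \<beta> where "\<beta> y = (SOME x. matches x y)" for y
  have \<alpha>: "matches x (\<alpha> x)" if "x \<in> carrier X" for x
    unfolding \<alpha>_def by (rule someI_ex[OF matches_exists[OF that]])
  have \<beta>: "matches (\<beta> y) y" if "y \<in> carrier Y" for y
    unfolding \<beta>_def by (rule someI_ex) (use rev.matches_exists[OF that] rev_matches in blast)
  have u: "x = x'" if "matches x y" "matches x' y" for x x' y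
    using rev.matches_unique that rev_matches by blast
  have c: "x \<in> carrier X" "y \<in> carrier Y" if "matches x y" for x y
    using that by (auto simp: matches_def)
  show ?thesis
  proof (rule module_isoI[OF X.oc_module_axioms Y.oc_module_axioms, of \<alpha> \<beta>])
    show "\<alpha> (act X x s) = act Y (\<alpha> x) s" if "x \<in> carrier X" "s \<in> carrier S" for x s
      using matches_unique[OF \<alpha> matches_act[OF \<alpha>]] that by simp
    show "pmap Y (\<alpha> x) = pmap X x" if "x \<in> carrier X" for x
      using \<alpha>[OF that] by (simp add: matches_def)
    show "\<beta> (\<alpha> x) = x" if "x \<in> carrier X" for x
      using u[OF \<beta> \<alpha>] c \<alpha> that by metis
    show "\<alpha> (\<beta> y) = y" if "y \<in> carrier Y" for y
      using matches_unique[OF \<alpha> \<beta>] c \<beta> that by metis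
  qed (use c \<alpha> \<beta> in blast)+
qed

end

section \<open>Change of basis\<close>

lemma finite_range_support: "finite {i. f i \<noteq> z} \<Longrightarrow> finite (range f)"
  by (rule finite_subset[of _ "insert z (f ` {i. f i \<noteq> z})"]) auto

context inverse_semigroup_zero
begin

lemma lub_range_single:
  assumes "f i \<in> carrier S" "\<And>k. k \<noteq> i \<Longrightarrow> f k = \<^bold>0"
  shows "lub (range f) (f i)"
proof -
  have "f k \<in> {\<^bold>0, f i}" for k using assms(2) by (cases "k = i") auto
  then have "range f \<subseteq> {\<^bold>0, f i}" by blast
  then show ?thesis using assms(1) by (intro lub_singleton) auto
qed

text \<open>In matrix terms: \<open>a\<close> belongs to \<open>M\<^sub>\<omega>(S)\<close>, and \<open>a\<^sup>\<star> a = diag f\<close>, \<open>a a\<^sup>\<star> = diag e\<close>. The condition is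
  spelled out by entries because it is used for modules before the matrices are studied.\<close>

definition intertwines :: "(nat \<Rightarrow> 'a) \<Rightarrow> (nat \<Rightarrow> 'a) \<Rightarrow> (nat \<Rightarrow> nat \<Rightarrow> 'a) \<Rightarrow> bool"
  where "intertwines e f a \<longleftrightarrow> (\<forall>i j. a i j \<in> carrier S) \<and> finite {(i, j). a i j \<noteq> \<^bold>0} \<and>
    (\<forall>i j k. j \<noteq> k \<longrightarrow> (a i j)\<^sup>\<star> \<cdot> a i k = \<^bold>0) \<and>
    (\<forall>i j k. i \<noteq> j \<longrightarrow> a i k \<cdot> (a j k)\<^sup>\<star> = \<^bold>0) \<and>
    (\<forall>j. lub (range (\<lambda>i. src (a i j))) (f j)) \<and>
    (\<forall>i. lub (range (\<lambda>j. a i j \<cdot> (a i j)\<^sup>\<star>)) (e i))"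

lemma intertwinesD:
  assumes "intertwines e f a"
  shows "a i j \<in> carrier S" "finite {(i, j). a i j \<noteq> \<^bold>0}"
    "j \<noteq> k \<Longrightarrow> (a i j)\<^sup>\<star> \<cdot> a i k = \<^bold>0" "i \<noteq> j \<Longrightarrow> a i k \<cdot> (a j k)\<^sup>\<star> = \<^bold>0"
    "lub (range (\<lambda>i. src (a i j))) (f j)" "lub (range (\<lambda>j. a i j \<cdot> (a i j)\<^sup>\<star>)) (e i)"
  using assms unfolding intertwines_def by blast+

lemma intertwines_sinv:
  assumes "intertwines e f a"
  shows "intertwines f e (\<lambda>i j. (a j i)\<^sup>\<star>)"
proof -
  note D = intertwinesD[OF assms]
  have "{(i, j). (a j i)\<^sup>\<star> \<noteq> \<^bold>0} \<subseteq> prod.swap ` {(i, j). a i j \<noteq> \<^bold>0}" by force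
  then have "finite {(i, j). (a j i)\<^sup>\<star> \<noteq> \<^bold>0}" using D(2) finite_subset by blast
  then show ?thesis using D(1,3-6) by (auto simp: intertwines_def)
qed

lemma orth_set_col:
  assumes "\<And>i. b i \<in> carrier S" "finite {i. b i \<noteq> \<^bold>0}" "\<And>i j. i \<noteq> j \<Longrightarrow> b i \<cdot> (b j)\<^sup>\<star> = \<^bold>0"
  shows "orth_set (range (\<lambda>i. src (b i)))"
proof (rule orth_set_idemI)
  show "finite (range (\<lambda>i. src (b i)))"
    by (rule finite_range_support[where z = "\<^bold>0"], rule finite_subset[OF _ assms(2)]) auto
  fix e f assume "e \<in> range (\<lambda>i. src (b i))" "f \<in> range (\<lambda>i. src (b i))" "e \<noteq> f"
  then obtain i j where ij: "e = src (b i)" "f = src (b j)" "i \<noteq> j" by auto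
  then show "e \<cdot> f = \<^bold>0" using assms src_mult_src_iff[of "b i" "b j"] by simp
qed (use assms in auto)

lemma finite_section:
  "finite {(i, j). a i j \<noteq> \<^bold>0} \<Longrightarrow> finite {i. a i j \<noteq> \<^bold>0}"
  "finite {(i, j). a i j \<noteq> \<^bold>0} \<Longrightarrow> finite {j. a i j \<noteq> \<^bold>0}"
proof -
  assume f: "finite {(i, j). a i j \<noteq> \<^bold>0}"
  have "{i. a i j \<noteq> \<^bold>0} \<subseteq> fst ` {(i, j). a i j \<noteq> \<^bold>0}" by force
  then show "finite {i. a i j \<noteq> \<^bold>0}" using f finite_subset by blast
  have "{j. a i j \<noteq> \<^bold>0} \<subseteq> snd ` {(i, j). a i j \<noteq> \<^bold>0}" by force
  then show "finite {j. a i j \<noteq> \<^bold>0}" using f finite_subset by blast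
qed

lemma intertwines_orth:
  assumes "intertwines e f a"
  shows "orth_set (range (\<lambda>i. src (a i j)))" "orth_set (range (\<lambda>j. a i j \<cdot> (a i j)\<^sup>\<star>))"
proof -
  have *: "orth_set (range (\<lambda>i. src (a i j)))" if "intertwines e f a" for e f a j
    using intertwinesD[OF that] finite_section(1)
    by (intro orth_set_col) auto
  show "orth_set (range (\<lambda>i. src (a i j)))" by (rule *[OF assms])
  show "orth_set (range (\<lambda>j. a i j \<cdot> (a i j)\<^sup>\<star>))"
    using *[OF intertwines_sinv[OF assms], of i] intertwinesD(1)[OF assms] by simp
qed

end

context oc_module
begin

lemma basis_free: "is_basis m \<Longrightarrow> m j \<triangleleft> s = m j \<triangleleft> t \<Longrightarrow> s \<in> carrier S \<Longrightarrow> t \<in> carrier S \<Longrightarrow>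
    pp (m j) \<cdot> s = pp (m j) \<cdot> t"
  by (rule is_basisD(3))

text \<open>A free element \<open>x\<close> has coordinates. If \<open>x\<close> is the join of multiples of basis elements, those
  multiples \<open>m i \<triangleleft> t\<close>, \<open>m i \<triangleleft> t'\<close> that come from the same \<open>i\<close> have orthogonal ranges as well: for
  \<open>u = t\<^sup>\<star> \<cdot> t'\<close> the element \<open>m i \<triangleleft> (t \<cdot> u)\<close> is both \<open>x \<triangleleft> (src t \<cdot> u)\<close> and a restriction of
  \<open>x \<triangleleft> src t'\<close>, so freeness forces \<open>u = \<^bold>0\<close>. Hence their coefficients can be joined in the
  semigroup.\<close>

lemma coordinates:
  assumes m: "is_basis m" and x: "x \<in> carrier X"
    and free: "\<And>s t. \<lbrakk>s \<in> carrier S; t \<in> carrier S; x \<triangleleft> s = x \<triangleleft> t\<rbrakk> \<Longrightarrow> pp x \<cdot> s = pp x \<cdot> t"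
  obtains a where "\<And>i. a i \<in> carrier S" "\<And>i. pp (m i) \<cdot> a i = a i"
    "\<And>i. m i \<triangleleft> a i = x \<triangleleft> src (a i)" "strong_join (range (\<lambda>i. m i \<triangleleft> a i)) x"
    "\<And>i j. i \<noteq> j \<Longrightarrow> src (a i) \<cdot> src (a j) = \<^bold>0"
proof -
  note B = is_basisD[OF m]
  obtain A where A: "strong_join A x" "A \<subseteq> {m i \<triangleleft> s | i s. s \<in> carrier S}"
    using B(5)[OF x] by blast
  note D = strong_joinD[OF A(1)]
  define T where "T i = {t \<in> carrier S. pp (m i) \<cdot> t = t \<and> m i \<triangleleft> t \<in> A}" for i
  have T: "t \<in> carrier S" "pp (m i) \<cdot> t = t" "m i \<triangleleft> t \<in> A" "pp (m i \<triangleleft> t) = src t"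
    "m i \<triangleleft> t = x \<triangleleft> src t" if "t \<in> T i" for t i
  proof -
    show t: "t \<in> carrier S" "pp (m i) \<cdot> t = t" "m i \<triangleleft> t \<in> A" using that by (auto simp: T_def)
    then show p: "pp (m i \<triangleleft> t) = src t" using B(1) by (simp add: pmap_act_src)
    show "m i \<triangleleft> t = x \<triangleleft> src t" using D(4)[OF t(3)] p by simp
  qed
  have cover: "(\<Union>i. (\<triangleleft>) (m i) ` T i) = A"
  proof
    show "A \<subseteq> (\<Union>i. (\<triangleleft>) (m i) ` T i)"
    proof
      fix b assume b: "b \<in> A"
      then obtain i s where s: "s \<in> carrier S" "b = m i \<triangleleft> s" using A(2) by blast
      then have "pp (m i) \<cdot> s \<in> T i" "b = m i \<triangleleft> (pp (m i) \<cdot> s)" using B(1) b by (auto simp: T_def)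
      then show "b \<in> (\<Union>i. (\<triangleleft>) (m i) ` T i)" by blast
    qed
  qed (auto simp: T_def)
  have oT: "orth_set (T i)" for i
    unfolding orth_set_def
  proof (intro conjI)
    have "inj_on ((\<triangleleft>) (m i)) (T i)"
    proof (rule inj_onI)
      fix t t' assume "t \<in> T i" "t' \<in> T i" "m i \<triangleleft> t = m i \<triangleleft> t'"
      then show "t = t'" using B(3)[of i t i t'] T(1,2)[of t i] T(1,2)[of t' i] by simp
    qed
    moreover have "(\<triangleleft>) (m i) ` T i \<subseteq> A" using cover by blast
    then have "finite ((\<triangleleft>) (m i) ` T i)" using finite_subset[OF _ D(1)] by blast
    ultimately show "finite (T i)" using finite_imageD by blast
    show "T i \<subseteq> carrier S" using T by blast
    show "pairwise (sorth S) (T i)"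
      unfolding pairwise_def
    proof (intro ballI impI)
      fix t t' assume t: "t \<in> T i" "t' \<in> T i" "t \<noteq> t'"
      note t1 = T[OF t(1)] and t2 = T[OF t(2)]
      have "m i \<triangleleft> t \<noteq> m i \<triangleleft> t'" using B(3)[of i t i t'] t1(1,2) t2(1,2) t(3) by auto
      then have o: "src t \<cdot> src t' = \<^bold>0" using D(6)[OF t1(3) t2(3)] t1(4) t2(4) by simp
      define u where "u = t\<^sup>\<star> \<cdot> t'"
      have u: "u \<in> carrier S" using t1 t2 by (simp add: u_def)
      define w where "w = t'\<^sup>\<star> \<cdot> ((t \<cdot> t\<^sup>\<star>) \<cdot> t')"
      have w: "w \<in> carrier S" using t1 t2 by (simp add: w_def)
      have "t \<cdot> u = (t \<cdot> t\<^sup>\<star>) \<cdot> t'" using t1(1) t2(1) by (simp add: u_def mult_assoc)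
      also have "\<dots> = t' \<cdot> w" unfolding w_def by (rule idem_move) (use t1 t2 in auto)
      finally have tu: "t \<cdot> u = t' \<cdot> w" .
      have "x \<triangleleft> (src t \<cdot> u) = m i \<triangleleft> (t \<cdot> u)"
        using x u t1(1) B(1) t1(5) act_assoc[of x "src t" u] act_assoc[of "m i" t u] by simp
      also have "\<dots> = x \<triangleleft> (src t' \<cdot> w)"
        unfolding tu using x w t2(1) B(1) t2(5) act_assoc[of x "src t'" w] act_assoc[of "m i" t' w]
        by simp
      finally have "pp x \<cdot> (src t \<cdot> u) = pp x \<cdot> (src t' \<cdot> w)"
        using free x u w t1(1) t2(1) by simp
      moreover have "pp x \<cdot> src t = src t" "pp x \<cdot> src t' = src t'"
        using pmap_le_if_upper[OF x _ D(4)[OF t1(3)]] pmap_le_if_upper[OF x _ D(4)[OF t2(3)]]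
          t1(3,4) t2(3,4) D(2) by auto
      ultimately have "src t \<cdot> u = src t' \<cdot> w"
        using x u w t1(1) t2(1) mult_assoc[of "pp x" "src t" u] mult_assoc[of "pp x" "src t'" w]
        by simp
      then have "src t \<cdot> (src t \<cdot> u) = (src t \<cdot> src t') \<cdot> w"
        using u w t1(1) t2(1) by (simp add: mult_assoc)
      then have "u = \<^bold>0" using o u w t1(1) t2(1) by (simp add: u_def mult_assoc)
      moreover have "t \<cdot> t'\<^sup>\<star> = \<^bold>0" using o t1(1) t2(1) src_mult_src_iff by blast
      ultimately show "sorth S t t'" by (simp add: sorth_def u_def)
    qed
  qed
  define a where "a i = (SOME z. lub (T i) z)" for i
  have a: "lub (T i) (a i)" for i
    unfolding a_def by (rule someI_ex[OF lub_exists[OF oT]])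
  have ac: "a i \<in> carrier S" for i using a lub_closed by blast
  have ae: "pp (m i) \<cdot> a i = a i" for i
  proof -
    have "(\<cdot>) (pp (m i)) ` T i = T i" using T(2) by force
    then show ?thesis
      using lub_mult_left[OF oT a, of "pp (m i)" i] a[of i] B(1) lub_unique by auto
  qed
  have j: "strong_join ((\<triangleleft>) (m i) ` T i) (m i \<triangleleft> a i)" for i
    by (rule strong_join_act_lub[OF oT a B(1)])
  have p: "pp (m i \<triangleleft> a i) = src (a i)" for i using B(1) ac ae by (simp add: pmap_act_src)
  have le: "m i \<triangleleft> a i = x \<triangleleft> src (a i)" for i
    using strong_join_least[OF j x, of i] T(3) D(4) p by fastforce
  have orth: "src (a i) \<cdot> src (a k) = \<^bold>0" if "i \<noteq> k" for i k
  proof -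
    have 1: "src t \<cdot> src r = \<^bold>0" if "t \<in> T i" "r \<in> T k" for t r
    proof (cases "m i \<triangleleft> t = m k \<triangleleft> r")
      case True
      then have "t = \<^bold>0"
        using B(4)[OF True \<open>i \<noteq> k\<close>] T(1,2)[OF that(1)] T(1)[OF that(2)] by simp
      then show ?thesis using T(1)[OF that(2)] by simp
    next
      case False
      then show ?thesis using D(6)[OF T(3)[OF that(1)] T(3)[OF that(2)]] T(4) that by simp
    qed
    have 2: "src t \<cdot> src (a k) = \<^bold>0" if "t \<in> T i" for t
      unfolding p[symmetric, of k]
      by (rule strong_join_lub_zero[OF j]) (use 1[OF that] T that in auto)
    have "src (a k) \<cdot> src (a i) = \<^bold>0"
      unfolding p[symmetric, of i]
    proof (rule strong_join_lub_zero[OF j])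
      fix b assume "b \<in> (\<triangleleft>) (m i) ` T i"
      then obtain t where t: "t \<in> T i" "b = m i \<triangleleft> t" by auto
      then show "src (a k) \<cdot> pp b = \<^bold>0"
        using 2[OF t(1)] T(1,4)[OF t(1)] ac idem_commute[of "src (a k)" "src t"] by simp
    qed (use ac in auto)
    then show ?thesis using ac idem_commute[of "src (a i)"] by simp
  qed
  have "strong_join (range (\<lambda>i. m i \<triangleleft> a i)) x"
    unfolding strong_join_def
  proof (intro conjI ballI)
    have "m i \<triangleleft> a i = pt X" if "m i = pt X" for i using that ac by simp
    then have "{i. m i \<triangleleft> a i \<noteq> pt X} \<subseteq> {i. m i \<noteq> pt X}" by blast
    then show "finite (range (\<lambda>i. m i \<triangleleft> a i))"
      by (rule finite_range_support[OF finite_subset[OF _ B(2)]])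
    show "pairwise (eorth S X) (range (\<lambda>i. m i \<triangleleft> a i))"
    proof (rule pairwiseI, clarify)
      fix i k assume "m i \<triangleleft> a i \<noteq> m k \<triangleleft> a k"
      then have "i \<noteq> k" by auto
      then show "eorth S X (m i \<triangleleft> a i) (m k \<triangleleft> a k)" using orth p by (simp add: eorth_def)
    qed
    fix b assume "b \<in> range (\<lambda>i. m i \<triangleleft> a i)"
    then show "b = x \<triangleleft> pp b" using le p by auto
  next
    have "lub (\<Union>i\<in>UNIV. pp ` (\<triangleleft>) (m i) ` T i) (pp x) \<longleftrightarrow> lub (range (\<lambda>i. pp (m i \<triangleleft> a i))) (pp x)"
      by (rule lub_UN) (use strong_joinD[OF j] in blast)+
    moreover have "(\<Union>i\<in>UNIV. pp ` (\<triangleleft>) (m i) ` T i) = pp ` A" using cover by (simp add: image_UN[symmetric])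
    ultimately show "lub (pp ` range (\<lambda>i. m i \<triangleleft> a i)) (pp x)"
      using D(5) by (simp add: image_image)
  qed (use x B(1) ac in auto)
  then show ?thesis by (rule that[OF ac ae le _ orth])
qed

text \<open>The entries \<open>a i j\<close> are the coordinates of \<open>n j\<close>. Entries in one row are orthogonal because a
  relation between \<open>m i \<triangleleft> a i j\<close> and \<open>m i \<triangleleft> a i k\<close> is a relation between \<open>n j\<close> and \<open>n k\<close>. That the
  ranges in row \<open>i\<close> exhaust \<open>p(m i)\<close> follows by writing \<open>m i\<close> as a join of pieces \<open>n j \<triangleleft> t\<close>: on such
  a piece, with structure value \<open>q\<close>, the equation \<open>m i \<triangleleft> q = \<Or>\<^sub>k m k \<triangleleft> (a k j \<cdot> t)\<close> forces
  \<open>a i j \<cdot> t = q\<close>.\<close>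

theorem bases_intertwine:
  assumes m: "is_basis m" and n: "is_basis n"
  shows "\<exists>a. intertwines (\<lambda>i. pp (m i)) (\<lambda>j. pp (n j)) a"
proof -
  note M = is_basisD[OF m] and N = is_basisD[OF n]
  define coord where "coord j a \<longleftrightarrow> (\<forall>i. a i \<in> carrier S \<and> pp (m i) \<cdot> a i = a i \<and>
      m i \<triangleleft> a i = n j \<triangleleft> src (a i)) \<and> strong_join (range (\<lambda>i. m i \<triangleleft> a i)) (n j) \<and>
    (\<forall>i k. i \<noteq> k \<longrightarrow> src (a i) \<cdot> src (a k) = \<^bold>0)" for j a
  have "\<exists>a. coord j a" for j
  proof -
    obtain a where "\<And>i. a i \<in> carrier S" "\<And>i. pp (m i) \<cdot> a i = a i"
      "\<And>i. m i \<triangleleft> a i = n j \<triangleleft> src (a i)" "strong_join (range (\<lambda>i. m i \<triangleleft> a i)) (n j)"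
      "\<And>i k. i \<noteq> k \<Longrightarrow> src (a i) \<cdot> src (a k) = \<^bold>0"
      using coordinates[OF m N(1) basis_free[OF n]] by blast
    then show ?thesis unfolding coord_def by blast
  qed
  then have "\<exists>b. \<forall>j. coord j (b j)" by (intro choice) blast
  then obtain b where b: "\<And>j. coord j (b j)" by blast
  define a where "a i j = b j i" for i j
  have ac [simp]: "a i j \<in> carrier S" and ae: "pp (m i) \<cdot> a i j = a i j"
    and le: "m i \<triangleleft> a i j = n j \<triangleleft> src (a i j)"
    and join: "strong_join (range (\<lambda>i. m i \<triangleleft> a i j)) (n j)"
    and col: "i \<noteq> k \<Longrightarrow> src (a i j) \<cdot> src (a k j) = \<^bold>0" for i j k
    using b[of j] unfolding a_def coord_def by blast+
  have p: "pp (m i \<triangleleft> a i j) = src (a i j)" for i j using M(1) ae by (simp add: pmap_act_src)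
  have src_le: "pp (n j) \<cdot> src (a i j) = src (a i j)" for i j
  proof -
    have "m i \<triangleleft> a i j \<in> carrier X" "m i \<triangleleft> a i j = n j \<triangleleft> pp (m i \<triangleleft> a i j)"
      unfolding p by (simp add: M(1), rule le)
    then have "pp (n j) \<cdot> pp (m i \<triangleleft> a i j) = pp (m i \<triangleleft> a i j)"
      by (rule pmap_le_if_upper[OF N(1)])
    then show ?thesis unfolding p .
  qed
  have row: "(a i j)\<^sup>\<star> \<cdot> a i k = \<^bold>0" if "j \<noteq> k" for i j k
  proof -
    define u where "u = (a i j)\<^sup>\<star> \<cdot> a i k"
    define w where "w = (a i k)\<^sup>\<star> \<cdot> ((a i j \<cdot> (a i j)\<^sup>\<star>) \<cdot> a i k)"
    have uw: "u \<in> carrier S" "w \<in> carrier S" by (auto simp: u_def w_def)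
    have "a i j \<cdot> u = (a i j \<cdot> (a i j)\<^sup>\<star>) \<cdot> a i k" by (simp add: u_def mult_assoc)
    also have "\<dots> = a i k \<cdot> w" unfolding w_def by (rule idem_move) auto
    finally have "m i \<triangleleft> a i j \<triangleleft> u = m i \<triangleleft> a i k \<triangleleft> w" using M(1) uw by simp
    then have eq: "n j \<triangleleft> (src (a i j) \<cdot> u) = n k \<triangleleft> (src (a i k) \<cdot> w)"
      using N(1) uw by (simp add: le)
    have "pp (n j) \<cdot> (src (a i j) \<cdot> u) = \<^bold>0" by (rule N(4)[OF eq that]) (use uw in auto)
    then have "src (a i j) \<cdot> u = \<^bold>0"
      using mult_assoc[of "pp (n j)" "src (a i j)" u] src_le N(1) uw by simp
    then show ?thesis by (simp add: u_def mult_assoc)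
  qed
  have col': "a i k \<cdot> (a j k)\<^sup>\<star> = \<^bold>0" if "i \<noteq> j" for i j k
    using col[OF that] src_mult_src_iff by simp
  have fin: "finite {(i, j). a i j \<noteq> \<^bold>0}"
  proof (rule finite_subset)
    have "a i j = \<^bold>0" if "m i = pt X" for i j using ae[of i j] that by simp
    moreover have "a i j = \<^bold>0" if "n j = pt X" for i j
      using src_le[of j i] that src_eq_zero[of "a i j"] by simp
    ultimately show "{(i, j). a i j \<noteq> \<^bold>0} \<subseteq> {i. m i \<noteq> pt X} \<times> {j. n j \<noteq> pt X}" by auto
  qed (use M(2) N(2) in auto)
  have 5: "lub (range (\<lambda>i. src (a i j))) (pp (n j))" for j
    using strong_joinD(5)[OF join, of j] p by (simp add: image_image)
  have 6: "lub (range (\<lambda>j. a i j \<cdot> (a i j)\<^sup>\<star>)) (pp (m i))" for i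
  proof (subst lub_iff, use ac in blast, intro conjI ballI impI)
    show "pp (m i) \<in> carrier S" using M(1) by auto
    fix h assume "h \<in> range (\<lambda>j. a i j \<cdot> (a i j)\<^sup>\<star>)"
    then obtain j where h: "h = a i j \<cdot> (a i j)\<^sup>\<star>" by auto
    have "pp (m i) \<cdot> h = h" unfolding h using mult_assoc[of "pp (m i)" "a i j" "(a i j)\<^sup>\<star>"] ae M(1) by simp
    then show "h \<preceq> pp (m i)" using idem_le_iff[of h "pp (m i)"] h M(1) by simp
  next
    fix v assume v: "v \<in> carrier S" and ub: "\<forall>h\<in>range (\<lambda>j. a i j \<cdot> (a i j)\<^sup>\<star>). h \<preceq> v"
    obtain B where B: "strong_join B (m i)" "B \<subseteq> {n j \<triangleleft> t | j t. t \<in> carrier S}"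
      using N(5)[OF M(1)] by blast
    show "pp (m i) \<preceq> v"
    proof (rule lub_least[OF strong_joinD(5)[OF B(1)] v])
      fix q assume "q \<in> pp ` B"
      then obtain c where c: "c \<in> B" "q = pp c" by auto
      then obtain j t where t: "t \<in> carrier S" "c = n j \<triangleleft> t" using B(2) by blast
      have cc: "c \<in> carrier X" using t N(1) by simp
      then have q: "q \<in> idems S" using c by simp
      have cm: "c = m i \<triangleleft> q" using strong_joinD(4)[OF B(1) c(1)] c(2) by simp
      have eq: "pp (m i) \<cdot> q = q"
        unfolding c(2) by (rule pmap_le_if_upper[OF M(1) cc strong_joinD(4)[OF B(1) c(1)]])
      have J: "strong_join (range (\<lambda>k. m k \<triangleleft> (a k j \<cdot> t))) c"
        using strong_join_act[OF join t(1), of j] t M(1) by (simp add: image_image)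
      have pk: "pp (m k \<triangleleft> (a k j \<cdot> t)) = src (a k j \<cdot> t)" for k
        using M(1) t(1) ae[of k j] mult_assoc[of "pp (m k)" "a k j" t] by (simp add: pmap_act_src)
      have ek: "m k \<triangleleft> (a k j \<cdot> t) = m i \<triangleleft> (q \<cdot> src (a k j \<cdot> t))" for k
        using strong_joinD(4)[OF J, of "m k \<triangleleft> (a k j \<cdot> t)"] pk cm M(1) q t(1) by simp
      have ak: "pp (m k) \<cdot> (a k j \<cdot> t) = a k j \<cdot> t" for k
        using ae[of k j] mult_assoc[of "pp (m k)" "a k j" t] t(1) M(1) by simp
      have z: "a k j \<cdot> t = \<^bold>0" if "k \<noteq> i" for k
        using M(4)[OF ek that] ak[of k] t(1) q by simp
      have i: "a i j \<cdot> t = q \<cdot> src (a i j \<cdot> t)"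
        using M(3)[OF ek, of i] ak[of i] t(1) q eq M(1) mult_assoc[of "pp (m i)" q "src (a i j \<cdot> t)"] by simp
      have "lub (range (\<lambda>k. src (a k j \<cdot> t))) (src (a i j \<cdot> t))"
        by (rule lub_range_single[where f = "\<lambda>k. src (a k j \<cdot> t)"])
           (use t(1) in simp, simp add: z del: sinv_mult)
      moreover have "lub (range (\<lambda>k. src (a k j \<cdot> t))) q"
        using strong_joinD(5)[OF J] c(2) pk by (simp add: image_image)
      ultimately have "src (a i j \<cdot> t) = q" using lub_unique by blast
      with i q have at: "a i j \<cdot> t = q" by simp
      have "(a i j \<cdot> (a i j)\<^sup>\<star>) \<cdot> q = q"
        unfolding at[symmetric] using t(1) by (simp add: mult_assoc)
      then have "q \<preceq> a i j \<cdot> (a i j)\<^sup>\<star>" using q by (subst idem_le_iff) auto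
      moreover have "a i j \<cdot> (a i j)\<^sup>\<star> \<preceq> v" using ub by blast
      ultimately show "q \<preceq> v" by (rule natle_trans) (use q v in auto)
    qed
  qed
  show ?thesis
    unfolding intertwines_def
    by (intro exI[of _ a] conjI allI impI) (rule ac fin row col' 5 6; assumption?)+
qed

text \<open>The new basis is \<open>n j = \<Or>\<^sub>i m i \<triangleleft> a i j\<close>. If \<open>n j \<triangleleft> s = n k \<triangleleft> t\<close>, comparing the components over
  the \<open>m i\<close> gives \<open>a i j \<cdot> s = a i k \<cdot> t\<close> for all \<open>i\<close>, and then the row condition and
  \<open>\<Or>\<^sub>i src (a i j) = f j\<close> yield freeness. The \<open>n j\<close> generate, because
  \<open>m i = \<Or>\<^sub>j n j \<triangleleft> (a i j)\<^sup>\<star>\<close>.\<close>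

theorem basis_from_intertwining:
  assumes m: "is_basis m" and a: "intertwines (\<lambda>i. pp (m i)) f a"
  shows "\<exists>n. is_basis n \<and> (\<forall>j. pp (n j) = f j)"
proof -
  note M = is_basisD[OF m] and D = intertwinesD[OF a] and O = intertwines_orth[OF a]
  have ac [simp]: "a i j \<in> carrier S" for i j by (rule D(1))
  have mc [simp]: "m i \<in> carrier X" for i by (rule M(1))
  have ae: "pp (m i) \<cdot> a i j = a i j" for i j
  proof -
    have "a i j \<cdot> (a i j)\<^sup>\<star> \<preceq> pp (m i)" by (rule lub_upper[OF D(6)]) auto
    then have "pp (m i) \<cdot> (a i j \<cdot> (a i j)\<^sup>\<star>) = a i j \<cdot> (a i j)\<^sup>\<star>" by (subst (asm) idem_le_iff) auto
    then have "pp (m i) \<cdot> (a i j \<cdot> (a i j)\<^sup>\<star>) \<cdot> a i j = a i j" by (simp add: mult_assoc)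
    then show ?thesis by (simp add: mult_assoc)
  qed
  have ae': "pp (m i) \<cdot> (a i j \<cdot> s) = a i j \<cdot> s" if "s \<in> carrier S" for i j s
    using mult_assoc[of "pp (m i)" "a i j" s] ae that by simp
  have p: "pp (m i \<triangleleft> (a i j \<cdot> s)) = src (a i j \<cdot> s)" if "s \<in> carrier S" for i j s
    using that ae' by (simp add: pmap_act_src)
  have p1: "pp (m i \<triangleleft> a i j) = src (a i j)" for i j
    using ae by (simp add: pmap_act_src)
  have "\<exists>z. strong_join (range (\<lambda>i. m i \<triangleleft> a i j)) z" for j
  proof (rule strong_join_exists)
    have "m i \<triangleleft> a i j = pt X" if "m i = pt X" for i using that by simp
    then have "{i. m i \<triangleleft> a i j \<noteq> pt X} \<subseteq> {i. m i \<noteq> pt X}" by blast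
    then show "finite (range (\<lambda>i. m i \<triangleleft> a i j))"
      by (rule finite_range_support[OF finite_subset[OF _ M(2)]])
    show "pairwise (eorth S X) (range (\<lambda>i. m i \<triangleleft> a i j))"
    proof (rule pairwiseI, clarify)
      fix i k assume "m i \<triangleleft> a i j \<noteq> m k \<triangleleft> a k j"
      then have "i \<noteq> k" by auto
      then show "eorth S X (m i \<triangleleft> a i j) (m k \<triangleleft> a k j)"
        using D(4) src_mult_src_iff p1 by (simp add: eorth_def)
    qed
  qed auto
  then obtain n where n: "\<And>j. strong_join (range (\<lambda>i. m i \<triangleleft> a i j)) (n j)" by metis
  have nc [simp]: "n j \<in> carrier X" for j using strong_joinD(3)[OF n] .
  have pn: "pp (n j) = f j" for j
  proof -
    have "lub (range (\<lambda>i. src (a i j))) (pp (n j))"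
      using strong_joinD(5)[OF n, of j] p1 by (simp add: image_image)
    then show ?thesis using D(5) lub_unique by blast
  qed
  have ns: "strong_join (range (\<lambda>i. m i \<triangleleft> (a i j \<cdot> s))) (n j \<triangleleft> s)" if "s \<in> carrier S" for j s
    using strong_join_act[OF n that, of j] that by (simp add: image_image)
  have free: "pp (n j) \<cdot> s = pp (n k) \<cdot> t \<and> (j \<noteq> k \<longrightarrow> pp (n j) \<cdot> s = \<^bold>0)"
    if eq: "n j \<triangleleft> s = n k \<triangleleft> t" and s [simp]: "s \<in> carrier S" and t [simp]: "t \<in> carrier S" for j k s t
  proof -
    define q where "q i = src (a i j \<cdot> s)" for i
    define r where "r i = src (a i k \<cdot> t)" for i
    have qr [simp]: "q i \<in> idems S" "r i \<in> idems S" for i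
      unfolding q_def r_def by (rule src_idem, simp)+
    have Q: "m i \<triangleleft> (a i j \<cdot> s) = n j \<triangleleft> (s \<cdot> q i)" for i
      using strong_joinD(4)[OF ns[OF s], of "m i \<triangleleft> (a i j \<cdot> s)" j] p[OF s] by (simp add: q_def)
    have R: "m i \<triangleleft> (a i k \<cdot> t) = n k \<triangleleft> (t \<cdot> r i)" for i
      using strong_joinD(4)[OF ns[OF t], of "m i \<triangleleft> (a i k \<cdot> t)" k] p[OF t] by (simp add: r_def)
    have QR: "m i \<triangleleft> (a i j \<cdot> s \<cdot> r i') = m i' \<triangleleft> (a i' k \<cdot> t \<cdot> q i)" for i i'
    proof -
      have "m i \<triangleleft> (a i j \<cdot> s \<cdot> r i') = m i \<triangleleft> (a i j \<cdot> s) \<triangleleft> r i'" by simp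
      also have "\<dots> = n j \<triangleleft> s \<triangleleft> (q i \<cdot> r i')" unfolding Q by (simp add: mult_assoc)
      also have "\<dots> = n k \<triangleleft> t \<triangleleft> (r i' \<cdot> q i)" unfolding eq by (simp add: idem_commute)
      also have "\<dots> = m i' \<triangleleft> (a i' k \<cdot> t) \<triangleleft> q i" unfolding R by (simp add: mult_assoc)
      also have "\<dots> = m i' \<triangleleft> (a i' k \<cdot> t \<cdot> q i)" by simp
      finally show ?thesis .
    qed
    have diag: "a i j \<cdot> s \<cdot> r i = a i k \<cdot> t \<cdot> q i" for i
      using M(3)[OF QR, of i i] ae' by (simp add: mult_assoc)
    have off: "a i j \<cdot> s \<cdot> r i' = \<^bold>0" if "i \<noteq> i'" for i i'
      using M(4)[OF QR that] ae' by (simp add: mult_assoc)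
    have qr0: "q i \<cdot> r i' = \<^bold>0" if "i \<noteq> i'" for i i'
      using off[OF that] by (simp add: q_def mult_assoc)
    have lubs: "lub (range q) (pp (n j \<triangleleft> s))" "lub (range r) (pp (n j \<triangleleft> s))"
      using strong_joinD(5)[OF ns[OF s], of j] strong_joinD(5)[OF ns[OF t], of k] p eq
      by (simp_all add: image_image q_def r_def)
    have orths: "orth_set (range q)" "orth_set (range r)"
      using strong_join_pmap(1)[OF ns[OF s], of j] strong_join_pmap(1)[OF ns[OF t], of k] p
      by (simp_all add: image_image q_def r_def)
    have half: "q i \<cdot> r i = q i" "r i \<cdot> q i = r i" for i
    proof -
      have q_le: "q i \<cdot> pp (n j \<triangleleft> s) = q i" "r i \<cdot> pp (n j \<triangleleft> s) = r i"
        using lub_upper[OF lubs(1), of "q i"] lub_upper[OF lubs(2), of "r i"]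
          idem_le_iff[of "q i" "pp (n j \<triangleleft> s)"] idem_le_iff[of "r i" "pp (n j \<triangleleft> s)"]
          idem_commute[of "q i" "pp (n j \<triangleleft> s)"] idem_commute[of "r i" "pp (n j \<triangleleft> s)"]
        by simp_all
      have "lub (range (\<lambda>k. q i \<cdot> r k)) (q i \<cdot> r i)"
        by (rule lub_range_single[where f = "\<lambda>k. q i \<cdot> r k"]) (use qr0 in auto)
      then show "q i \<cdot> r i = q i"
        using lub_mult_left[OF orths(2) lubs(2), of "q i"] q_le(1) lub_unique by (auto simp: image_image)
      have rq0: "r i \<cdot> q i' = \<^bold>0" if "i \<noteq> i'" for i'
        using qr0[of i' i] that idem_commute[of "r i" "q i'"] by simp
      have "lub (range (\<lambda>k. r i \<cdot> q k)) (r i \<cdot> q i)"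
        by (rule lub_range_single[where f = "\<lambda>k. r i \<cdot> q k"]) (use rq0 in auto)
      then show "r i \<cdot> q i = r i"
        using lub_mult_left[OF orths(1) lubs(1), of "r i"] q_le(2) lub_unique by (auto simp: image_image)
    qed
    have same: "a i j \<cdot> s = a i k \<cdot> t" for i
    proof -
      have qri: "q i = r i" using half[of i] idem_commute[of "q i" "r i"] by simp
      have "a i j \<cdot> s = a i j \<cdot> s \<cdot> q i" "a i k \<cdot> t = a i k \<cdot> t \<cdot> r i"
        by (simp_all add: q_def r_def mult_assoc del: sinv_mult)
      then show ?thesis using diag[of i] qri by simp
    qed
    have fs: "lub ((\<lambda>h. h \<cdot> u) ` range (\<lambda>i. src (a i l))) (f l \<cdot> u)" if "u \<in> carrier S" for l u
      by (rule lub_mult_right[OF O(1) D(5) that])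
    show ?thesis
    proof (cases "j = k")
      case True
      have "(\<lambda>h. h \<cdot> s) ` range (\<lambda>i. src (a i j)) = (\<lambda>h. h \<cdot> t) ` range (\<lambda>i. src (a i k))"
        unfolding image_image using same True by (intro image_cong) (auto simp: mult_assoc)
      then show ?thesis using fs[OF s, of j] fs[OF t, of k] lub_unique True pn by metis
    next
      case False
      have z: "a i j \<cdot> s = \<^bold>0" for i
      proof -
        have "a i j \<cdot> s = a i j \<cdot> ((a i j)\<^sup>\<star> \<cdot> (a i j \<cdot> s))" by simp
        also have "\<dots> = a i j \<cdot> (((a i j)\<^sup>\<star> \<cdot> a i k) \<cdot> t)" unfolding same by (simp add: mult_assoc)
        also have "\<dots> = \<^bold>0" using D(3)[OF False] by simp
        finally show ?thesis .
      qed
      have "f j \<cdot> s = \<^bold>0"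
        by (rule lub_mult_right_zero[OF O(1) D(5) s]) (use z in \<open>auto simp: mult_assoc\<close>)
      moreover have "f k \<cdot> t = \<^bold>0"
        by (rule lub_mult_right_zero[OF O(1) D(5) t]) (use z same in \<open>auto simp: mult_assoc\<close>)
      ultimately show ?thesis using pn by simp
    qed
  qed
  have m_join: "strong_join (range (\<lambda>j. n j \<triangleleft> (a i j)\<^sup>\<star>)) (m i)" for i
  proof -
    have "n j \<triangleleft> (a i j)\<^sup>\<star> = m i \<triangleleft> (a i j \<cdot> (a i j)\<^sup>\<star>)" for j
    proof -
      have "m i \<triangleleft> a i j = n j \<triangleleft> src (a i j)"
        using strong_joinD(4)[OF n, of "m i \<triangleleft> a i j" j] p1 by simp
      then have "m i \<triangleleft> a i j \<triangleleft> (a i j)\<^sup>\<star> = n j \<triangleleft> src (a i j) \<triangleleft> (a i j)\<^sup>\<star>" by simp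
      then show ?thesis by (simp add: mult_assoc)
    qed
    then have "range (\<lambda>j. n j \<triangleleft> (a i j)\<^sup>\<star>) = (\<triangleleft>) (m i) ` range (\<lambda>j. a i j \<cdot> (a i j)\<^sup>\<star>)"
      by (simp add: image_image)
    then show ?thesis using strong_join_act_lub[OF O(2) D(6), of "m i" i] by simp
  qed
  have gen: "\<exists>A. strong_join A x \<and> A \<subseteq> {n j \<triangleleft> s | j s. s \<in> carrier S}" if x: "x \<in> carrier X" for x
  proof -
    obtain A where A: "strong_join A x" "A \<subseteq> {m i \<triangleleft> s | i s. s \<in> carrier S}"
      using M(5)[OF x] by (elim exE conjE)
    have "\<exists>C. strong_join C b \<and> C \<subseteq> {n j \<triangleleft> s | j s. s \<in> carrier S}" if b: "b \<in> A" for b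
    proof -
      obtain i s where s: "s \<in> carrier S" "b = m i \<triangleleft> s"
        using subsetD[OF A(2) b] by (elim CollectE exE conjE)
      let ?C = "range (\<lambda>j. n j \<triangleleft> ((a i j)\<^sup>\<star> \<cdot> s))"
      have "(\<lambda>c. c \<triangleleft> s) ` range (\<lambda>j. n j \<triangleleft> (a i j)\<^sup>\<star>) = ?C"
        using s(1) by (simp add: image_image)
      then have "strong_join ?C b"
        using strong_join_act[OF m_join s(1), of i] s(2) by simp
      moreover have "(a i j)\<^sup>\<star> \<cdot> s \<in> carrier S" for j using s(1) by simp
      then have "?C \<subseteq> {n j \<triangleleft> s | j s. s \<in> carrier S}" by blast
      ultimately show ?thesis by (intro exI conjI)
    qed
    then have "\<exists>C. \<forall>b\<in>A. strong_join (C b) b \<and> C b \<subseteq> {n j \<triangleleft> s | j s. s \<in> carrier S}"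
      by (intro bchoice ballI)
    then obtain C where C: "\<And>b. b \<in> A \<Longrightarrow> strong_join (C b) b"
      "\<And>b. b \<in> A \<Longrightarrow> C b \<subseteq> {n j \<triangleleft> s | j s. s \<in> carrier S}" by blast
    have "strong_join (\<Union>b\<in>A. C b) x"
      by (rule strong_join_UN[where z = "\<lambda>b. b"]) (use A(1) C(1) strong_joinD[OF A(1)] in auto)
    moreover have "(\<Union>b\<in>A. C b) \<subseteq> {n j \<triangleleft> s | j s. s \<in> carrier S}"
      by (rule UN_least) (rule C(2))
    ultimately show ?thesis by (intro exI conjI)
  qed
  have "n j = pt X" if "\<forall>i. a i j = \<^bold>0" for j
  proof -
    have "range (\<lambda>i. m i \<triangleleft> a i j) \<subseteq> {pt X}" using that by auto
    then have "lub {\<^bold>0} (pp (n j))" using strong_joinD(5)[OF n, of j] that by (simp add: image_image)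
    then have "pp (n j) = \<^bold>0" using lub_zeros[of "{\<^bold>0}"] lub_unique by blast
    then show ?thesis using pmap_eq_zero by simp
  qed
  then have "{j. n j \<noteq> pt X} \<subseteq> snd ` {(i, j). a i j \<noteq> \<^bold>0}" by force
  then have "finite {j. n j \<noteq> pt X}" using D(2) finite_subset by blast
  then have "is_basis n"
    unfolding is_basis_def using nc by (intro conjI allI ballI impI free gen image_subsetI)
  then show ?thesis using pn by blast
qed

end

section \<open>Matrices\<close>

context orthogonally_complete
begin

abbreviation mat_mult (infixl \<open>\<odot>\<close> 70)
  where "A \<odot> B \<equiv> A \<cdot>\<^bsub>Momega S\<^esub> B"

definition dagger :: "(nat \<Rightarrow> nat \<Rightarrow> 'a) \<Rightarrow> nat \<Rightarrow> nat \<Rightarrow> 'a"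
  where "dagger A = (\<lambda>i j. (A j i)\<^sup>\<star>)"

definition diag :: "(nat \<Rightarrow> 'a) \<Rightarrow> nat \<Rightarrow> nat \<Rightarrow> 'a"
  where "diag d = (\<lambda>i j. if i = j then d i else \<^bold>0)"

definition idem_seq :: "(nat \<Rightarrow> 'a) \<Rightarrow> bool"
  where "idem_seq d \<longleftrightarrow> range d \<subseteq> idems S \<and> finite {i. d i \<noteq> \<^bold>0}"

lemma idem_seqD: "idem_seq d \<Longrightarrow> d i \<in> idems S" "idem_seq d \<Longrightarrow> finite {i. d i \<noteq> \<^bold>0}"
  unfolding idem_seq_def by blast+

lemma idem_seqI: "(\<And>i. d i \<in> idems S) \<Longrightarrow> finite {i. d i \<noteq> \<^bold>0} \<Longrightarrow> idem_seq d"
  unfolding idem_seq_def by blast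

lemma carrier_Momega: "A \<in> carrier (Momega S) \<longleftrightarrow>
    (\<forall>i j. A i j \<in> carrier S) \<and> finite {(i, j). A i j \<noteq> \<^bold>0} \<and>
    (\<forall>i j k. j \<noteq> k \<longrightarrow> (A i j)\<^sup>\<star> \<cdot> A i k = \<^bold>0) \<and> (\<forall>i j k. i \<noteq> j \<longrightarrow> A i k \<cdot> (A j k)\<^sup>\<star> = \<^bold>0)"
  by (simp add: Momega_def)

lemma matD:
  assumes "A \<in> carrier (Momega S)"
  shows "A i j \<in> carrier S" "finite {(i, j). A i j \<noteq> \<^bold>0}"
    "j \<noteq> k \<Longrightarrow> (A i j)\<^sup>\<star> \<cdot> A i k = \<^bold>0" "i \<noteq> j \<Longrightarrow> A i k \<cdot> (A j k)\<^sup>\<star> = \<^bold>0"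
  using assms unfolding carrier_Momega by blast+

text \<open>The idempotent \<open>e\<close> commutes with the range idempotent \<open>s \<cdot> s\<^sup>\<star>\<close> that can be split off from
  \<open>s\<^sup>\<star>\<close>.\<close>

lemma sandwich_zero:
  assumes "s\<^sup>\<star> \<cdot> t = \<^bold>0" "s \<in> carrier S" "t \<in> carrier S" "e \<in> idems S"
  shows "s\<^sup>\<star> \<cdot> (e \<cdot> t) = \<^bold>0"
proof -
  have "s\<^sup>\<star> \<cdot> (e \<cdot> t) = s\<^sup>\<star> \<cdot> ((s \<cdot> s\<^sup>\<star>) \<cdot> (e \<cdot> t))" using assms(2-4) by (simp add: mult_assoc)
  also have "(s \<cdot> s\<^sup>\<star>) \<cdot> (e \<cdot> t) = e \<cdot> ((s \<cdot> s\<^sup>\<star>) \<cdot> t)"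
    using assms by (intro idem_left_commute) auto
  also have "\<dots> = \<^bold>0" using assms by (simp add: mult_assoc)
  finally show ?thesis using assms by simp
qed

lemma sandwich_zero':
  assumes "s \<cdot> t\<^sup>\<star> = \<^bold>0" "s \<in> carrier S" "t \<in> carrier S" "e \<in> idems S"
  shows "s \<cdot> (e \<cdot> t\<^sup>\<star>) = \<^bold>0"
  using sandwich_zero[of "s\<^sup>\<star>" "t\<^sup>\<star>" e] assms by simp

text \<open>Two summands \<open>A i l \<cdot> B l j\<close> and \<open>A i n \<cdot> B n k\<close> of the product are separated by the row condition
  of \<open>A\<close> if \<open>l \<noteq> n\<close>, and by that of \<open>B\<close> if \<open>l = n\<close> and \<open>j \<noteq> k\<close>.\<close>

lemma row_entries:
  assumes "A \<in> carrier (Momega S)" "B \<in> carrier (Momega S)" "j \<noteq> k \<or> l \<noteq> n"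
  shows "(A i l \<cdot> B l j)\<^sup>\<star> \<cdot> (A i n \<cdot> B n k) = \<^bold>0"
proof -
  note a = matD[OF assms(1)] and b = matD[OF assms(2)]
  have eq: "(A i l \<cdot> B l j)\<^sup>\<star> \<cdot> (A i n \<cdot> B n k) = (B l j)\<^sup>\<star> \<cdot> (((A i l)\<^sup>\<star> \<cdot> A i n) \<cdot> B n k)"
    using a(1) b(1) by (simp add: mult_assoc)
  show ?thesis
  proof (cases "l = n")
    case False
    then show ?thesis unfolding eq using a(1,3) b(1) by simp
  next
    case True
    then have "(B l j)\<^sup>\<star> \<cdot> B l k = \<^bold>0" using assms(3) b(3) by blast
    from sandwich_zero[OF this b(1) b(1), of "src (A i l)"] True a(1) show ?thesis
      unfolding eq by auto
  qed
qed

lemma column_entries: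
  assumes "A \<in> carrier (Momega S)" "B \<in> carrier (Momega S)" "i \<noteq> j \<or> l \<noteq> n"
  shows "(A i l \<cdot> B l k) \<cdot> (A j n \<cdot> B n k)\<^sup>\<star> = \<^bold>0"
proof -
  note a = matD[OF assms(1)] and b = matD[OF assms(2)]
  have eq: "(A i l \<cdot> B l k) \<cdot> (A j n \<cdot> B n k)\<^sup>\<star> = A i l \<cdot> ((B l k \<cdot> (B n k)\<^sup>\<star>) \<cdot> (A j n)\<^sup>\<star>)"
    using a(1) b(1) by (simp add: mult_assoc)
  show ?thesis
  proof (cases "l = n")
    case False
    then show ?thesis unfolding eq using a(1) b(1,4) by simp
  next
    case True
    then have "A i l \<cdot> (A j l)\<^sup>\<star> = \<^bold>0" using assms(3) a(4) by blast
    from sandwich_zero'[OF this a(1) a(1), of "B l k \<cdot> (B l k)\<^sup>\<star>"] True b(1) show ?thesis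
      unfolding eq by auto
  qed
qed

lemma mat_mult_orth:
  assumes "A \<in> carrier (Momega S)" "B \<in> carrier (Momega S)"
  shows "orth_set (range (\<lambda>k. A i k \<cdot> B k j))"
  unfolding orth_set_def
proof (intro conjI)
  note a = matD[OF assms(1)] and b = matD[OF assms(2)]
  have "A i k \<cdot> B k j = \<^bold>0" if "A i k = \<^bold>0" for k using that b(1) by simp
  then have "{k. A i k \<cdot> B k j \<noteq> \<^bold>0} \<subseteq> {k. A i k \<noteq> \<^bold>0}" by blast
  then show "finite (range (\<lambda>k. A i k \<cdot> B k j))"
    by (rule finite_range_support[OF finite_subset[OF _ finite_section(2)[OF a(2)]]])
  show "range (\<lambda>k. A i k \<cdot> B k j) \<subseteq> carrier S" using a(1) b(1) by auto
  show "pairwise (sorth S) (range (\<lambda>k. A i k \<cdot> B k j))"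
  proof (rule pairwiseI, clarify)
    fix k l assume "A i k \<cdot> B k j \<noteq> A i l \<cdot> B l j"
    then have "k \<noteq> l" by auto
    then show "sorth S (A i k \<cdot> B k j) (A i l \<cdot> B l j)"
      using row_entries[OF assms, of j j k l i] column_entries[OF assms, of i i k l j]
      unfolding sorth_def by blast
  qed
qed

lemma mat_mult_lub:
  assumes "A \<in> carrier (Momega S)" "B \<in> carrier (Momega S)"
  shows "lub (range (\<lambda>k. A i k \<cdot> B k j)) ((A \<odot> B) i j)"
proof -
  obtain z where z: "lub (range (\<lambda>k. A i k \<cdot> B k j)) z"
    using lub_exists[OF mat_mult_orth[OF assms]] by blast
  have "{A i k \<cdot> B k j |k. True} = range (\<lambda>k. A i k \<cdot> B k j)" by auto
  then have "(A \<odot> B) i j = z" using sup_eq[OF z] by (simp add: Momega_def)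
  then show ?thesis using z by simp
qed

lemma mat_mult_eqI:
  assumes "A \<in> carrier (Momega S)" "B \<in> carrier (Momega S)"
    and "lub (range (\<lambda>k. A i k \<cdot> B k j)) z"
  shows "(A \<odot> B) i j = z"
  using mat_mult_lub[OF assms(1,2)] assms(3) lub_unique by blast

lemma mat_mult_closed:
  assumes "A \<in> carrier (Momega S)" "B \<in> carrier (Momega S)"
  shows "A \<odot> B \<in> carrier (Momega S)"
  unfolding carrier_Momega
proof (intro conjI allI impI)
  note a = matD[OF assms(1)] and b = matD[OF assms(2)] and L = mat_mult_lub[OF assms]
    and O = mat_mult_orth[OF assms]
  show c: "(A \<odot> B) i j \<in> carrier S" for i j using lub_closed[OF L] .
  show "finite {(i, j). (A \<odot> B) i j \<noteq> \<^bold>0}"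
  proof (rule finite_subset)
    show "finite (fst ` {(i, j). A i j \<noteq> \<^bold>0} \<times> snd ` {(i, j). B i j \<noteq> \<^bold>0})"
      using a(2) b(2) by blast
    have "\<exists>k. A i k \<noteq> \<^bold>0 \<and> B k j \<noteq> \<^bold>0" if "(A \<odot> B) i j \<noteq> \<^bold>0" for i j
    proof (rule ccontr)
      assume "\<not> ?thesis"
      then have "A i k = \<^bold>0 \<or> B k j = \<^bold>0" for k by blast
      then have "A i k \<cdot> B k j = \<^bold>0" for k using a(1)[of i k] b(1)[of k j] by (metis zero_mult)
      then have "range (\<lambda>k. A i k \<cdot> B k j) \<subseteq> {\<^bold>0}" by blast
      then show False using mat_mult_eqI[OF assms lub_zeros] that by blast
    qed
    then show "{(i, j). (A \<odot> B) i j \<noteq> \<^bold>0} \<subseteq>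
        fst ` {(i, j). A i j \<noteq> \<^bold>0} \<times> snd ` {(i, j). B i j \<noteq> \<^bold>0}" by force
  qed
  show "((A \<odot> B) i j)\<^sup>\<star> \<cdot> (A \<odot> B) i k = \<^bold>0" if "j \<noteq> k" for i j k
  proof (rule lub_mult_left_zero[OF O L])
    fix y assume "y \<in> range (\<lambda>l. A i l \<cdot> B l k)"
    then obtain l where y: "y = A i l \<cdot> B l k" by blast
    have yc: "y \<in> carrier S" unfolding y using a(1) b(1) by simp
    have "y\<^sup>\<star> \<cdot> (A \<odot> B) i j = \<^bold>0"
      by (rule lub_mult_left_zero[OF O L])
         (use yc row_entries[OF assms] that in \<open>auto simp: y simp del: sinv_mult\<close>)
    then have "(y\<^sup>\<star> \<cdot> (A \<odot> B) i j)\<^sup>\<star> = \<^bold>0" by simp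
    then show "((A \<odot> B) i j)\<^sup>\<star> \<cdot> y = \<^bold>0" using c yc by simp
  qed (use c in simp)
  show "(A \<odot> B) i k \<cdot> ((A \<odot> B) j k)\<^sup>\<star> = \<^bold>0" if "i \<noteq> j" for i j k
  proof (rule lub_mult_right_zero[OF O L])
    fix y assume "y \<in> range (\<lambda>l. A i l \<cdot> B l k)"
    then obtain l where y: "y = A i l \<cdot> B l k" by blast
    have yc: "y \<in> carrier S" unfolding y using a(1) b(1) by simp
    have "(A \<odot> B) j k \<cdot> y\<^sup>\<star> = \<^bold>0"
      by (rule lub_mult_right_zero[OF O L])
         (use yc column_entries[OF assms] that in \<open>auto simp: y simp del: sinv_mult\<close>)
    then have "((A \<odot> B) j k \<cdot> y\<^sup>\<star>)\<^sup>\<star> = \<^bold>0" by simp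
    then show "y \<cdot> ((A \<odot> B) j k)\<^sup>\<star> = \<^bold>0" using c yc by simp
  qed (use c in simp)
qed

text \<open>Both bracketings are the join of all the products \<open>A i l \<cdot> B l k \<cdot> C k j\<close>.\<close>

lemma mat_mult_assoc:
  assumes A: "A \<in> carrier (Momega S)" and B: "B \<in> carrier (Momega S)" and C: "C \<in> carrier (Momega S)"
  shows "A \<odot> B \<odot> C = A \<odot> (B \<odot> C)"
proof (intro ext)
  fix i j
  note a = matD(1)[OF A] and b = matD(1)[OF B] and c = matD(1)[OF C]
  have "lub (\<Union>k. range (\<lambda>l. A i l \<cdot> B l k \<cdot> C k j)) ((A \<odot> B \<odot> C) i j)"
  proof (subst lub_UN)
    show "lub (range (\<lambda>l. A i l \<cdot> B l k \<cdot> C k j)) ((A \<odot> B) i k \<cdot> C k j)" for k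
      using lub_mult_right[OF mat_mult_orth[OF A B] mat_mult_lub[OF A B] c] by (simp add: image_image)
    show "lub (range (\<lambda>k. (A \<odot> B) i k \<cdot> C k j)) ((A \<odot> B \<odot> C) i j)"
      by (rule mat_mult_lub[OF mat_mult_closed[OF A B] C])
  qed (use a b c in auto)
  moreover have "lub (\<Union>l. range (\<lambda>k. A i l \<cdot> (B l k \<cdot> C k j))) ((A \<odot> (B \<odot> C)) i j)"
  proof (subst lub_UN)
    show "lub (range (\<lambda>k. A i l \<cdot> (B l k \<cdot> C k j))) (A i l \<cdot> (B \<odot> C) l j)" for l
      using lub_mult_left[OF mat_mult_orth[OF B C] mat_mult_lub[OF B C] a] by (simp add: image_image)
    show "lub (range (\<lambda>l. A i l \<cdot> (B \<odot> C) l j)) ((A \<odot> (B \<odot> C)) i j)"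
      by (rule mat_mult_lub[OF A mat_mult_closed[OF B C]])
  qed (use a b c in auto)
  moreover have "(\<Union>k. range (\<lambda>l. A i l \<cdot> B l k \<cdot> C k j)) = (\<Union>l. range (\<lambda>k. A i l \<cdot> (B l k \<cdot> C k j)))"
    using a b c by (auto simp: mult_assoc)
  ultimately show "(A \<odot> B \<odot> C) i j = (A \<odot> (B \<odot> C)) i j" using lub_unique by simp
qed

lemma dagger_closed: "A \<in> carrier (Momega S) \<Longrightarrow> dagger A \<in> carrier (Momega S)"
proof -
  assume A: "A \<in> carrier (Momega S)"
  note a = matD[OF A]
  have "{(i, j). (A j i)\<^sup>\<star> \<noteq> \<^bold>0} \<subseteq> prod.swap ` {(i, j). A i j \<noteq> \<^bold>0}" by force
  then have "finite {(i, j). (A j i)\<^sup>\<star> \<noteq> \<^bold>0}" using a(2) finite_subset by blast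
  then show ?thesis unfolding carrier_Momega dagger_def using a(1,3,4) by simp
qed

lemma dagger_dagger: "A \<in> carrier (Momega S) \<Longrightarrow> dagger (dagger A) = A"
  using matD(1) by (auto simp: dagger_def)

lemma dagger_diag: "idem_seq d \<Longrightarrow> dagger (diag d) = diag d"
  using idem_seqD(1) by (intro ext) (auto simp: dagger_def diag_def)

lemma diag_closed:
  assumes "idem_seq d"
  shows "diag d \<in> carrier (Momega S)"
proof -
  note d = idem_seqD[OF assms]
  have "{(i, j). diag d i j \<noteq> \<^bold>0} \<subseteq> (\<lambda>i. (i, i)) ` {i. d i \<noteq> \<^bold>0}"
    by (auto simp: diag_def split: if_splits)
  then have "finite {(i, j). diag d i j \<noteq> \<^bold>0}" using d(2) finite_subset by blast
  moreover have "diag d i j \<in> idems S" for i j using d(1) by (simp add: diag_def)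
  moreover have "j \<noteq> k \<Longrightarrow> diag d i j \<cdot> diag d i k = \<^bold>0" "i \<noteq> j \<Longrightarrow> diag d i k \<cdot> diag d j k = \<^bold>0" for i j k
    using d(1) by (auto simp: diag_def)
  ultimately show ?thesis unfolding carrier_Momega by simp
qed

lemma diag_mult_left:
  assumes "idem_seq d" "A \<in> carrier (Momega S)"
  shows "diag d \<odot> A = (\<lambda>i j. d i \<cdot> A i j)"
proof (intro ext)
  fix i j
  note d = idem_seqD[OF assms(1)] and a = matD(1)[OF assms(2)]
  have "lub (range (\<lambda>k. diag d i k \<cdot> A k j)) (diag d i i \<cdot> A i j)"
    by (rule lub_range_single[where f = "\<lambda>k. diag d i k \<cdot> A k j"]) (use a d in \<open>auto simp: diag_def\<close>)
  then show "(diag d \<odot> A) i j = d i \<cdot> A i j"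
    using mat_mult_eqI[OF diag_closed[OF assms(1)] assms(2)] by (simp add: diag_def)
qed

lemma diag_mult_right:
  assumes "idem_seq d" "A \<in> carrier (Momega S)"
  shows "A \<odot> diag d = (\<lambda>i j. A i j \<cdot> d j)"
proof (intro ext)
  fix i j
  note d = idem_seqD[OF assms(1)] and a = matD(1)[OF assms(2)]
  have "lub (range (\<lambda>k. A i k \<cdot> diag d k j)) (A i j \<cdot> diag d j j)"
    by (rule lub_range_single[where f = "\<lambda>k. A i k \<cdot> diag d k j"]) (use a d in \<open>auto simp: diag_def\<close>)
  then show "(A \<odot> diag d) i j = A i j \<cdot> d j"
    using mat_mult_eqI[OF assms(2) diag_closed[OF assms(1)]] by (simp add: diag_def)
qed

lemma idem_seq_mult: "idem_seq c \<Longrightarrow> idem_seq d \<Longrightarrow> idem_seq (\<lambda>i. c i \<cdot> d i)"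
proof (rule idem_seqI)
  assume cd: "idem_seq c" "idem_seq d"
  show "c i \<cdot> d i \<in> idems S" for i using idem_seqD(1) cd by blast
  have "c i \<cdot> d i = \<^bold>0" if "c i = \<^bold>0" for i using that idem_seqD(1)[OF cd(2), of i] by simp
  then have "{i. c i \<cdot> d i \<noteq> \<^bold>0} \<subseteq> {i. c i \<noteq> \<^bold>0}" by blast
  then show "finite {i. c i \<cdot> d i \<noteq> \<^bold>0}" using idem_seqD(2)[OF cd(1)] finite_subset by blast
qed

lemma diag_mult_diag:
  assumes "idem_seq c" "idem_seq d"
  shows "diag c \<odot> diag d = diag (\<lambda>i. c i \<cdot> d i)"
  unfolding diag_mult_left[OF assms(1) diag_closed[OF assms(2)]]
  using idem_seqD(1)[OF assms(1)] by (intro ext) (auto simp: diag_def)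

lemma diag_inject: "diag c = diag d \<Longrightarrow> c = d"
  by (rule ext) (metis diag_def)

lemma mult_dagger_diag:
  assumes "A \<in> carrier (Momega S)"
  obtains d where "idem_seq d" "A \<odot> dagger A = diag d" "\<And>i. lub (range (\<lambda>j. A i j \<cdot> (A i j)\<^sup>\<star>)) (d i)"
proof -
  note a = matD[OF assms]
  define d where "d i = (A \<odot> dagger A) i i" for i
  note L = mat_mult_lub[OF assms dagger_closed[OF assms], unfolded dagger_def]
    and O = mat_mult_orth[OF assms dagger_closed[OF assms], unfolded dagger_def]
  have l: "lub (range (\<lambda>j. A i j \<cdot> (A i j)\<^sup>\<star>)) (d i)" for i
    using L[of i i] unfolding d_def dagger_def .
  have "d i \<in> idems S" for i by (rule lub_idem[OF O l]) (use a(1) in auto)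
  moreover have off: "(A \<odot> dagger A) i k = \<^bold>0" if "i \<noteq> k" for i k
    by (rule mat_mult_eqI[OF assms dagger_closed[OF assms]], rule lub_zeros)
       (use a(4)[OF that] in \<open>auto simp: dagger_def\<close>)
  moreover have "finite {i. d i \<noteq> \<^bold>0}"
  proof (rule finite_subset)
    show "finite (fst ` {(i, j). (A \<odot> dagger A) i j \<noteq> \<^bold>0})"
      using matD(2)[OF mat_mult_closed[OF assms dagger_closed[OF assms]]] by blast
    show "{i. d i \<noteq> \<^bold>0} \<subseteq> fst ` {(i, j). (A \<odot> dagger A) i j \<noteq> \<^bold>0}"
      unfolding d_def by force
  qed
  ultimately have "idem_seq d" by (intro idem_seqI)
  moreover have "A \<odot> dagger A = diag d"
    using off by (auto simp: diag_def d_def fun_eq_iff)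
  ultimately show ?thesis using l that by blast
qed

text \<open>The \<open>i\<close>-th diagonal entry of \<open>A \<odot> A\<^sup>\<dagger>\<close> lies above the range idempotents of all entries in row \<open>i\<close>
  of \<open>A\<close>.\<close>

lemma mult_dagger_mult:
  assumes "A \<in> carrier (Momega S)"
  shows "A \<odot> dagger A \<odot> A = A"
proof -
  note a = matD(1)[OF assms]
  obtain d where d: "idem_seq d" "A \<odot> dagger A = diag d"
    "\<And>i. lub (range (\<lambda>j. A i j \<cdot> (A i j)\<^sup>\<star>)) (d i)"
    using mult_dagger_diag[OF assms] by blast
  note di = idem_seqD(1)[OF d(1)]
  have "d i \<cdot> A i j = A i j" for i j
  proof -
    have "A i j \<cdot> (A i j)\<^sup>\<star> \<preceq> d i" by (rule lub_upper[OF d(3)]) (use a in auto)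
    then have eq: "d i \<cdot> (A i j \<cdot> (A i j)\<^sup>\<star>) = A i j \<cdot> (A i j)\<^sup>\<star>"
      using di a by (subst (asm) idem_le_iff) auto
    have "d i \<cdot> A i j = d i \<cdot> (A i j \<cdot> (A i j)\<^sup>\<star>) \<cdot> A i j"
      using a di by (simp add: mult_assoc)
    also have "\<dots> = A i j" unfolding eq using a by (simp add: mult_assoc)
    finally show ?thesis .
  qed
  then show ?thesis unfolding d(2) diag_mult_left[OF d(1) assms] by (intro ext)
qed

lemma dagger_mult_dagger:
  assumes "A \<in> carrier (Momega S)"
  shows "dagger A \<odot> A \<odot> dagger A = dagger A"
  using mult_dagger_mult[OF dagger_closed[OF assms]] dagger_dagger[OF assms] by simp

text \<open>For an idempotent \<open>E\<close>, the inverse \<open>E\<^sup>\<dagger> = E\<^sup>\<dagger> \<odot> (E \<odot> E) \<odot> E\<^sup>\<dagger>\<close> is a product of the two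
  diagonal matrices \<open>E\<^sup>\<dagger> \<odot> E\<close> and \<open>E \<odot> E\<^sup>\<dagger>\<close>.\<close>

lemma idempotent_diag:
  assumes E: "E \<in> carrier (Momega S)" and idem: "E \<odot> E = E"
  obtains d where "idem_seq d" "E = diag d"
proof -
  note E' = dagger_closed[OF E]
  obtain c where c: "idem_seq c" "E \<odot> dagger E = diag c"
    using mult_dagger_diag[OF E] by blast
  obtain d where d: "idem_seq d" "dagger E \<odot> E = diag d"
    using mult_dagger_diag[OF E'] unfolding dagger_dagger[OF E] by blast
  have "dagger E = dagger E \<odot> (E \<odot> E) \<odot> dagger E"
    using dagger_mult_dagger[OF E] idem by simp
  also have "\<dots> = dagger E \<odot> E \<odot> (E \<odot> dagger E)"
    using E E' by (simp add: mat_mult_assoc mat_mult_closed)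
  also have "\<dots> = diag (\<lambda>i. d i \<cdot> c i)"
    unfolding c(2) d(2) by (rule diag_mult_diag[OF d(1) c(1)])
  finally have *: "dagger E = diag (\<lambda>i. d i \<cdot> c i)" .
  have i: "idem_seq (\<lambda>i. d i \<cdot> c i)" by (rule idem_seq_mult[OF d(1) c(1)])
  have "E = dagger (dagger E)" using dagger_dagger[OF E] by simp
  also have "\<dots> = diag (\<lambda>i. d i \<cdot> c i)" unfolding * by (rule dagger_diag[OF i])
  finally show ?thesis using that[OF i] by blast
qed

lemma idempotents_commute:
  assumes "E \<in> carrier (Momega S)" "E \<odot> E = E" "F \<in> carrier (Momega S)" "F \<odot> F = F"
  shows "E \<odot> F = F \<odot> E"
proof -
  obtain c d where "idem_seq c" "E = diag c" "idem_seq d" "F = diag d"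
    using idempotent_diag[OF assms(1,2)] idempotent_diag[OF assms(3,4)] by metis
  then show ?thesis
    using idem_commute[OF idem_seqD(1) idem_seqD(1), of c d] by (simp add: diag_mult_diag)
qed

text \<open>The usual argument that inverses are unique if idempotents commute: both inverses equal
  \<open>C \<odot> A \<odot> B\<close>.\<close>

lemma mat_inverse_unique:
  assumes A: "A \<in> carrier (Momega S)" and B: "B \<in> carrier (Momega S)" and C: "C \<in> carrier (Momega S)"
    and AB: "A \<odot> B \<odot> A = A" "B \<odot> A \<odot> B = B" and AC: "A \<odot> C \<odot> A = A" "C \<odot> A \<odot> C = C"
  shows "B = C"
proof -
  note [simp] = mat_mult_closed A B C
  note assoc = mat_mult_assoc
  have com: "(B \<odot> A) \<odot> (C \<odot> A) = (C \<odot> A) \<odot> (B \<odot> A)" "(A \<odot> B) \<odot> (A \<odot> C) = (A \<odot> C) \<odot> (A \<odot> B)"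
  proof -
    have "B \<odot> A \<odot> (B \<odot> A) = B \<odot> A \<odot> B \<odot> A" "C \<odot> A \<odot> (C \<odot> A) = C \<odot> A \<odot> C \<odot> A"
      "A \<odot> B \<odot> (A \<odot> B) = A \<odot> B \<odot> A \<odot> B" "A \<odot> C \<odot> (A \<odot> C) = A \<odot> C \<odot> A \<odot> C"
      by (simp_all add: assoc)
    then show "(B \<odot> A) \<odot> (C \<odot> A) = (C \<odot> A) \<odot> (B \<odot> A)" "(A \<odot> B) \<odot> (A \<odot> C) = (A \<odot> C) \<odot> (A \<odot> B)"
      unfolding AB AC by (intro idempotents_commute; simp)+
  qed
  have "B = B \<odot> (A \<odot> C \<odot> A) \<odot> B" using AB AC by simp
  also have "\<dots> = (B \<odot> A) \<odot> (C \<odot> A) \<odot> B" by (simp add: assoc)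
  also have "\<dots> = C \<odot> (A \<odot> B \<odot> A) \<odot> B" unfolding com by (simp add: assoc)
  also have "\<dots> = C \<odot> (A \<odot> B)" unfolding AB by (simp add: assoc)
  finally have b: "B = C \<odot> (A \<odot> B)" .
  have "C = C \<odot> (A \<odot> B \<odot> A) \<odot> C" using AB AC by simp
  also have "\<dots> = C \<odot> ((A \<odot> B) \<odot> (A \<odot> C))" by (simp add: assoc)
  also have "\<dots> = C \<odot> (A \<odot> C \<odot> A) \<odot> B" unfolding com by (simp add: assoc)
  also have "\<dots> = C \<odot> (A \<odot> B)" unfolding AC by (simp add: assoc)
  finally show ?thesis using b by simp
qed

theorem Momega_inverse_semigroup: "inverse_semigroup_zero (Momega S)"
proof
  show z: "\<^bold>0\<^bsub>Momega S\<^esub> \<in> carrier (Momega S)"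
    by (simp add: Momega_def)
  fix A assume A: "A \<in> carrier (Momega S)"
  show "\<exists>!B. B \<in> carrier (Momega S) \<and> A \<odot> B \<odot> A = A \<and> B \<odot> A \<odot> B = B"
    by (rule ex1I[of _ "dagger A"])
       (use A dagger_closed mult_dagger_mult dagger_mult_dagger mat_inverse_unique in blast)+
  have zd: "\<^bold>0\<^bsub>Momega S\<^esub> = diag (\<lambda>_. \<^bold>0)" "idem_seq (\<lambda>_. \<^bold>0)"
    by (auto simp: Momega_def diag_def intro: idem_seqI)
  note a = matD(1)[OF A]
  show "\<^bold>0\<^bsub>Momega S\<^esub> \<odot> A = \<^bold>0\<^bsub>Momega S\<^esub>"
    unfolding zd(1) diag_mult_left[OF zd(2) A] using a by (auto simp: diag_def)
  show "A \<odot> \<^bold>0\<^bsub>Momega S\<^esub> = \<^bold>0\<^bsub>Momega S\<^esub>"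
    unfolding zd(1) diag_mult_right[OF zd(2) A] using a by (auto simp: diag_def)
qed (auto intro: mat_mult_closed mat_mult_assoc)

interpretation Mat: inverse_semigroup_zero "Momega S"
  by (rule Momega_inverse_semigroup)

lemma sinv_Momega: "A \<in> carrier (Momega S) \<Longrightarrow> sinv (Momega S) A = dagger A"
  by (rule Mat.sinv_unique) (simp_all add: dagger_closed mult_dagger_mult dagger_mult_dagger)

lemma zero_Momega: "\<^bold>0\<^bsub>Momega S\<^esub> = diag (\<lambda>_. \<^bold>0)"
  by (auto simp: Momega_def diag_def)

lemma diag_idem: "idem_seq d \<Longrightarrow> diag d \<in> idems (Momega S)"
proof (rule Mat.idemI)
  assume d: "idem_seq d"
  then have "(\<lambda>i. d i \<cdot> d i) = d" using idem_seqD(1)[OF d] by auto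
  then show "diag d \<odot> diag d = diag d" using diag_mult_diag[OF d d] by simp
qed (rule diag_closed)

lemma idems_Momega: "idems (Momega S) = {diag d | d. idem_seq d}"
proof
  show "idems (Momega S) \<subseteq> {diag d | d. idem_seq d}"
  proof
    fix E assume "E \<in> idems (Momega S)"
    then have "E \<in> carrier (Momega S)" "E \<odot> E = E" using Mat.idem_closed Mat.idem_mult by blast+
    then obtain d where "idem_seq d" "E = diag d" by (rule idempotent_diag)
    then show "E \<in> {diag d | d. idem_seq d}" by blast
  qed
qed (use diag_idem in blast)

lemma D_rel_Momega_iff:
  assumes e: "idem_seq e" and f: "idem_seq f"
  shows "(diag f, diag e) \<in> D_rel (Momega S) \<longleftrightarrow> (\<exists>a. intertwines e f a)"
proof -
  have *: "A \<odot> dagger A = diag d \<longleftrightarrow> (\<forall>i. lub (range (\<lambda>j. A i j \<cdot> (A i j)\<^sup>\<star>)) (d i))"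
    if A: "A \<in> carrier (Momega S)" for A d
  proof -
    obtain c where c: "A \<odot> dagger A = diag c" "\<And>i. lub (range (\<lambda>j. A i j \<cdot> (A i j)\<^sup>\<star>)) (c i)"
      using mult_dagger_diag[OF A] by blast
    have "(\<forall>i. lub (range (\<lambda>j. A i j \<cdot> (A i j)\<^sup>\<star>)) (d i)) \<longleftrightarrow> c = d"
      using c(2) lub_unique by blast
    then show ?thesis using c(1) diag_inject by auto
  qed
  have "sinv (Momega S) A \<odot> A = diag f \<and> A \<odot> sinv (Momega S) A = diag e \<longleftrightarrow> intertwines e f A"
    if A: "A \<in> carrier (Momega S)" for A
  proof -
    have "dagger A \<odot> A = diag f \<longleftrightarrow> (\<forall>j. lub (range (\<lambda>i. src (A i j))) (f j))"
      using *[OF dagger_closed[OF A], of f] matD(1)[OF A]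
      unfolding dagger_dagger[OF A] by (simp add: dagger_def)
    then show ?thesis
      using *[OF A, of e] A unfolding sinv_Momega[OF A] intertwines_def carrier_Momega by blast
  qed
  moreover have "A \<in> carrier (Momega S)" if "intertwines e f A" for A
    using that unfolding intertwines_def carrier_Momega by blast
  ultimately show ?thesis using diag_idem e f unfolding D_rel_def by auto
qed

lemma sorth_diag_iff:
  assumes "idem_seq e" "idem_seq f"
  shows "sorth (Momega S) (diag e) (diag f) \<longleftrightarrow> (\<forall>i. e i \<cdot> f i = \<^bold>0)"
proof -
  have "sorth (Momega S) (diag e) (diag f) \<longleftrightarrow> diag (\<lambda>i. e i \<cdot> f i) = diag (\<lambda>_. \<^bold>0)"
    using assms by (simp add: diag_idem diag_mult_diag zero_Momega)
  then show ?thesis using diag_inject by (auto simp: fun_eq_iff)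
qed

text \<open>An upper bound \<open>B\<close> of two diagonal idempotents need not be diagonal, but on the columns that
  they meet it agrees with the identity, and so it lies above the entrywise join.\<close>

lemma join_diag:
  assumes e: "idem_seq e" and f: "idem_seq f" and g: "idem_seq g"
    and ef: "\<And>i. e i \<cdot> f i = \<^bold>0" "\<And>i. lub {e i, f i} (g i)"
  shows "diag e \<squnion>\<^bsub>sord (Momega S)\<^esub> diag f = diag g"
proof -
  note ei = idem_seqD(1)[OF e] and fi = idem_seqD(1)[OF f] and gi = idem_seqD(1)[OF g]
  note ec = diag_closed[OF e] and fc = diag_closed[OF f] and gc = diag_closed[OF g]
  have le: "diag d \<sqsubseteq>\<^bsub>sord (Momega S)\<^esub> B \<longleftrightarrow> diag d = B \<odot> diag d"
    if "idem_seq d" "B \<in> carrier (Momega S)" for d B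
    using that diag_closed[OF that(1)] diag_idem[OF that(1)] by (simp add: Mat.le_iff_src)
  have ge: "g i \<cdot> e i = e i" "g i \<cdot> f i = f i" for i
    using lub_upper[OF ef(2), of "e i" i] lub_upper[OF ef(2), of "f i" i]
      idem_le_iff[OF ei gi, of i i] idem_le_iff[OF fi gi, of i i] ei fi by auto
  have "least (sord (Momega S)) (diag g) (Upper (sord (Momega S)) {diag e, diag f})"
  proof (subst Mat.lub_iff)
    show "{diag e, diag f} \<subseteq> carrier (Momega S)" using ec fc by simp
    have "diag e = diag g \<odot> diag e" "diag f = diag g \<odot> diag f"
      using e f g ge by (simp_all add: diag_mult_diag)
    moreover have "diag g = B \<odot> diag g"
      if B: "B \<in> carrier (Momega S)" "diag e = B \<odot> diag e" "diag f = B \<odot> diag f" for B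
    proof (intro ext)
      fix i j
      have be: "B i j \<cdot> e j = diag e i j"
        using fun_cong[OF fun_cong[OF B(2)], of i j] diag_mult_right[OF e B(1)] by simp
      have bf: "B i j \<cdot> f j = diag f i j"
        using fun_cong[OF fun_cong[OF B(3)], of i j] diag_mult_right[OF f B(1)] by simp
      have o: "orth_set {e j, f j}"
        using ef(1)[of j] ei fi idem_commute[OF fi ei, of j j] by (intro orth_set_idemI) auto
      have "B i j \<cdot> g j = (if i = j then g j else \<^bold>0) \<cdot> g j"
        by (rule lub_mult_cong[OF o ef(2)])
           (use be bf ge ei fi gi matD(1)[OF B(1)] in \<open>auto simp: diag_def\<close>)
      also have "\<dots> = diag g i j" using gi by (simp add: diag_def)
      finally show "diag g i j = (B \<odot> diag g) i j" by (simp add: diag_mult_right[OF g B(1)])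
    qed
    ultimately show "diag g \<in> carrier (Momega S) \<and>
        (\<forall>a\<in>{diag e, diag f}. a \<sqsubseteq>\<^bsub>sord (Momega S)\<^esub> diag g) \<and>
        (\<forall>u\<in>carrier (Momega S). (\<forall>a\<in>{diag e, diag f}. a \<sqsubseteq>\<^bsub>sord (Momega S)\<^esub> u) \<longrightarrow>
          diag g \<sqsubseteq>\<^bsub>sord (Momega S)\<^esub> u)"
      using le[OF e] le[OF f] le[OF g] gc by auto
  qed
  then show ?thesis unfolding join_def by (rule Mat.sup_eq)
qed

end

section \<open>The module generated by a premodule\<close>

context orth_etale
begin

lemma orth_list_iff:
  "orth_list S X xs \<longleftrightarrow> xs \<noteq> [] \<and> set xs \<subseteq> carrier X \<and> sorted_wrt (eorth S X) xs"
proof -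
  have "(\<forall>i<length xs. \<forall>j<length xs. i \<noteq> j \<longrightarrow> eorth S X (xs ! i) (xs ! j)) \<longleftrightarrow>
    (\<forall>i j. i < j \<longrightarrow> j < length xs \<longrightarrow> eorth S X (xs ! i) (xs ! j))" if "set xs \<subseteq> carrier X"
  proof -
    have "eorth S X (xs ! j) (xs ! i)" if "eorth S X (xs ! i) (xs ! j)" "i < length xs" "j < length xs" for i j
      using eorth_sym[OF _ _ that(1)] that(2,3) \<open>set xs \<subseteq> carrier X\<close> by (simp add: subset_iff)
    moreover have "i < j \<or> j < i" if "i \<noteq> j" for i j :: nat using that by linarith
    ultimately show ?thesis by (auto dest: order_less_trans) blast
  qed
  then show ?thesis unfolding orth_list_def sorted_wrt_iff_nth_less by blast
qed

lemma orth_listD: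
  assumes "orth_list S X xs"
  shows "xs \<noteq> []" "set xs \<subseteq> carrier X"
    "\<And>x y. x \<in> set xs \<Longrightarrow> y \<in> set xs \<Longrightarrow> x \<noteq> y \<Longrightarrow> pp x \<cdot> pp y = \<^bold>0"
proof -
  show "xs \<noteq> []" "set xs \<subseteq> carrier X" using assms by (auto simp: orth_list_def)
  fix x y assume "x \<in> set xs" "y \<in> set xs" "x \<noteq> y"
  then obtain i j where "i < length xs" "j < length xs" "xs ! i = x" "xs ! j = y" "i \<noteq> j"
    by (metis in_set_conv_nth)
  then show "pp x \<cdot> pp y = \<^bold>0" using assms unfolding orth_list_def eorth_def by blast
qed

definition orth_family
  where "orth_family A \<longleftrightarrow> finite A \<and> A \<subseteq> carrier X \<and> (\<forall>x\<in>A. \<forall>y\<in>A. x \<noteq> y \<longrightarrow> pp x \<cdot> pp y = \<^bold>0)"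

lemma orth_list_family: "orth_list S X xs \<Longrightarrow> orth_family (set xs)"
  using orth_listD unfolding orth_family_def by blast

lemma orth_family_pmap:
  assumes "orth_family A"
  shows "orth_set (pp ` A)" "pp ` A \<subseteq> idems S"
proof -
  show i: "pp ` A \<subseteq> idems S" using assms by (auto simp: orth_family_def)
  show "orth_set (pp ` A)"
    using assms i by (intro orth_set_idemI) (auto simp: orth_family_def)
qed

lemma orth_family_lub:
  assumes "orth_family A"
  obtains g where "lub (pp ` A) g" "g \<in> idems S"
  using lub_exists lub_idem orth_family_pmap[OF assms] by metis

lemma act_lub_upper:
  assumes "lub (pp ` A) g" "g \<in> idems S" "x \<in> A" "A \<subseteq> carrier X"
  shows "g \<cdot> pp x = pp x" "pp x \<cdot> g = pp x" "x \<triangleleft> g = x"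
proof -
  have x: "x \<in> carrier X" using assms by blast
  then have "pp x \<preceq> g" using lub_upper[OF assms(1), of "pp x"] assms(3) by auto
  then show "g \<cdot> pp x = pp x" using idem_le_iff assms(2) x by simp
  then show "pp x \<cdot> g = pp x" using idem_commute[of g "pp x"] assms(2) x by simp
  then show "x \<triangleleft> g = x" using act_pmap_mult[OF x, of g] assms(2) x by simp
qed

lemma lub_pmap_act:
  assumes "orth_family A" "lub (pp ` A) g" "s \<in> carrier S"
  shows "lub (pp ` (\<lambda>x. x \<triangleleft> s) ` A) (s\<^sup>\<star> \<cdot> g \<cdot> s)"
proof -
  have A: "A \<subseteq> carrier X" using assms(1) by (simp add: orth_family_def)
  note o = orth_family_pmap[OF assms(1)]
  have "lub ((\<lambda>h. h \<cdot> s) ` (\<cdot>) (s\<^sup>\<star>) ` pp ` A) (s\<^sup>\<star> \<cdot> g \<cdot> s)"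
    using assms by (intro lub_mult_right orth_set_mult_left lub_mult_left o) auto
  moreover have "(\<lambda>h. h \<cdot> s) ` (\<cdot>) (s\<^sup>\<star>) ` pp ` A = pp ` (\<lambda>x. x \<triangleleft> s) ` A"
    unfolding image_image using A assms(3) by (intro image_cong) (auto simp: pmap_act)
  ultimately show ?thesis by simp
qed

lemma orth_family_act:
  assumes "orth_family A" "s \<in> carrier S"
  shows "orth_family ((\<lambda>x. x \<triangleleft> s) ` A)"
  unfolding orth_family_def
proof (intro conjI ballI impI)
  fix u v assume "u \<in> (\<lambda>x. x \<triangleleft> s) ` A" "v \<in> (\<lambda>x. x \<triangleleft> s) ` A" "u \<noteq> v"
  then obtain x y where xy: "x \<in> A" "y \<in> A" "x \<noteq> y" "u = x \<triangleleft> s" "v = y \<triangleleft> s" by blast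
  then have c: "x \<in> carrier X" "y \<in> carrier X" "pp x \<cdot> pp y = \<^bold>0"
    using assms(1) by (auto simp: orth_family_def)
  show "pp u \<cdot> pp v = \<^bold>0"
    unfolding xy(4,5) using src_orth_act[of "pp x" "pp y" s] c assms(2) by (simp add: pmap_act_src)
qed (use assms in \<open>auto simp: orth_family_def\<close>)

text \<open>The relation below describes when two orthogonal families have the same join in every module
  to which they are mapped: they agree locally and cover the same idempotent.\<close>

definition same_join
  where "same_join A B \<longleftrightarrow> (\<forall>x\<in>A. \<forall>y\<in>B. x \<triangleleft> pp y = y \<triangleleft> pp x) \<and>
    (\<exists>g. lub (pp ` A) g \<and> lub (pp ` B) g)"

lemma same_joinD:
  assumes "same_join A B"
  shows "x \<in> A \<Longrightarrow> y \<in> B \<Longrightarrow> x \<triangleleft> pp y = y \<triangleleft> pp x" "lub (pp ` A) g \<Longrightarrow> lub (pp ` B) g"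
  using assms lub_unique unfolding same_join_def by blast+

lemma same_join_sym: "same_join A B \<Longrightarrow> same_join B A"
  unfolding same_join_def by metis

lemma orth_family_compat:
  assumes "orth_family A" "x \<in> A" "y \<in> A"
  shows "x \<triangleleft> pp y = y \<triangleleft> pp x"
proof (cases "x = y")
  case False
  have "x \<in> carrier X" "y \<in> carrier X" "eorth S X x y" "eorth S X y x"
    using assms False by (auto simp: orth_family_def eorth_def)
  then show ?thesis using eorth_act_zero by simp
qed simp

lemma same_join_refl:
  assumes "orth_family A"
  shows "same_join A A"
  using orth_family_lub[OF assms] orth_family_compat[OF assms] unfolding same_join_def by metis

text \<open>The middle family covers the structure values of the outer ones, and on each \<open>p y\<close> the elements
  \<open>x\<close> and \<open>z\<close> both restrict to \<open>y\<close>.\<close>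

lemma same_join_trans:
  assumes AB: "same_join A B" and BC: "same_join B C" and B: "orth_family B"
    and A: "A \<subseteq> carrier X" and C: "C \<subseteq> carrier X"
  shows "same_join A C"
proof -
  obtain g where g: "lub (pp ` B) g" "g \<in> idems S" by (rule orth_family_lub[OF B])
  have lubs: "lub (pp ` A) g" "lub (pp ` C) g"
    using same_joinD(2)[OF same_join_sym[OF AB] g(1)] same_joinD(2)[OF BC g(1)] by auto
  have "x \<triangleleft> pp z = z \<triangleleft> pp x" if xz: "x \<in> A" "z \<in> C" for x z
  proof -
    have c: "x \<in> carrier X" "z \<in> carrier X" using A C xz by auto
    let ?h = "pp x \<cdot> pp z"
    have h: "?h \<in> idems S" "pp z \<cdot> pp x = ?h" using c by (auto simp: idem_commute[of "pp z"])
    have "x \<triangleleft> ?h \<triangleleft> g = z \<triangleleft> ?h \<triangleleft> g"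
    proof (rule act_lub_cong[OF orth_family_pmap[OF B] g(1)])
      fix f assume "f \<in> pp ` B"
      then obtain y where y: "y \<in> B" "f = pp y" by blast
      then have yc: "y \<in> carrier X" using B by (auto simp: orth_family_def)
      have "x \<triangleleft> ?h \<triangleleft> f = x \<triangleleft> pp y \<triangleleft> ?h"
        using c yc y h by (simp add: idem_commute[of ?h "pp y"] del: act_pmap_mult)
      also have "\<dots> = y \<triangleleft> pp x \<triangleleft> ?h" using same_joinD(1)[OF AB xz(1) y(1)] by simp
      also have "\<dots> = y \<triangleleft> pp z \<triangleleft> ?h"
        using c yc idem_left_commute[of "pp x" "pp z" "pp x"] idem_left_commute[of "pp z" "pp x" "pp z"] h
        by (simp add: idem_commute[of "pp z" "pp x"])
      also have "\<dots> = z \<triangleleft> pp y \<triangleleft> ?h" using same_joinD(1)[OF BC y(1) xz(2)] by simp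
      also have "\<dots> = z \<triangleleft> ?h \<triangleleft> f"
        using c yc y h by (simp add: idem_commute[of ?h "pp y"] del: act_pmap_mult)
      finally show "x \<triangleleft> ?h \<triangleleft> f = z \<triangleleft> ?h \<triangleleft> f" .
    qed (use c h in auto)
    moreover have hg: "?h \<cdot> g = ?h"
      using act_lub_upper(2)[OF lubs(2) g(2) xz(2) C] c g(2) by (simp add: mult_assoc)
    have "w \<triangleleft> ?h \<triangleleft> g = w \<triangleleft> ?h" if "w \<in> carrier X" for w
      using act_assoc[OF that idem_closed[OF h(1)] idem_closed[OF g(2)]] unfolding hg .
    ultimately have "x \<triangleleft> ?h = z \<triangleleft> ?h" using c by (simp only:)
    moreover have "z \<triangleleft> ?h = z \<triangleleft> pp x" using act_pmap_mult[of z "pp x"] c h by simp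
    ultimately show ?thesis using act_pmap_mult[of x "pp z"] c by simp
  qed
  then show ?thesis using lubs unfolding same_join_def by blast
qed

lemma same_join_act:
  assumes AB: "same_join A B" and A: "orth_family A" and B: "orth_family B" and s: "s \<in> carrier S"
  shows "same_join ((\<lambda>x. x \<triangleleft> s) ` A) ((\<lambda>x. x \<triangleleft> s) ` B)"
proof -
  obtain g where g: "lub (pp ` A) g" "g \<in> idems S" by (rule orth_family_lub[OF A])
  have "x \<triangleleft> s \<triangleleft> pp (y \<triangleleft> s) = y \<triangleleft> s \<triangleleft> pp (x \<triangleleft> s)" if xy: "x \<in> A" "y \<in> B" for x y
  proof -
    have c: "x \<in> carrier X" "y \<in> carrier X" using A B xy by (auto simp: orth_family_def)
    have *: "u \<triangleleft> s \<triangleleft> pp (v \<triangleleft> s) = u \<triangleleft> pp v \<triangleleft> s" if "u \<in> carrier X" "v \<in> carrier X" for u v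
      using that s idem_move[of s "pp v"] by (simp add: pmap_act mult_assoc)
    show ?thesis unfolding *[OF c] *[OF c(2,1)] using same_joinD(1)[OF AB xy] by simp
  qed
  moreover have "lub (pp ` (\<lambda>x. x \<triangleleft> s) ` A) (s\<^sup>\<star> \<cdot> g \<cdot> s)" "lub (pp ` (\<lambda>x. x \<triangleleft> s) ` B) (s\<^sup>\<star> \<cdot> g \<cdot> s)"
    using lub_pmap_act[OF A g(1) s] lub_pmap_act[OF B same_joinD(2)[OF AB g(1)] s] by auto
  ultimately show ?thesis unfolding same_join_def by blast
qed

lemma Upper_pmap_zero:
  assumes "A - {pt X} = B - {pt X}"
  shows "Upper (sord S) (pp ` A) = Upper (sord S) (pp ` B)"
proof (rule Upper_cong_zero)
  have "pp ` C - {\<^bold>0} = pp ` (C - {pt X}) - {\<^bold>0}" for C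
  proof
    show "pp ` C - {\<^bold>0} \<subseteq> pp ` (C - {pt X}) - {\<^bold>0}"
    proof
      fix e assume "e \<in> pp ` C - {\<^bold>0}"
      then obtain c where "c \<in> C" "e = pp c" "e \<noteq> \<^bold>0" by blast
      moreover from this have "c \<noteq> pt X" by auto
      ultimately show "e \<in> pp ` (C - {pt X}) - {\<^bold>0}" by blast
    qed
  qed blast
  then show "pp ` A - {\<^bold>0} = pp ` B - {\<^bold>0}" using assms by metis
qed

lemma same_join_zero:
  assumes "orth_family A" "A - {pt X} = B - {pt X}"
  shows "same_join A B" "orth_family B"
proof -
  have B: "B \<subseteq> insert (pt X) A" using assms(2) by blast
  have A: "orth_family (insert (pt X) A)"
    using assms(1) unfolding orth_family_def by auto
  show "orth_family B" using A B unfolding orth_family_def by (meson finite_subset order_trans subsetD)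
  obtain g where "lub (pp ` A) g" "g \<in> idems S" by (rule orth_family_lub[OF assms(1)])
  moreover from this have "lub (pp ` B) g" using Upper_pmap_zero[OF assms(2)] by simp
  moreover have "x \<triangleleft> pp y = y \<triangleleft> pp x" if "x \<in> A" "y \<in> B" for x y
    using orth_family_compat[OF A] B that by blast
  ultimately show "same_join A B" unfolding same_join_def by blast
qed

lemma same_join_pair:
  assumes J: "strong_join {x, y} z" and F: "orth_family ({x, y} \<union> Z)"
    and xy: "\<And>w. w \<in> Z \<Longrightarrow> pp x \<cdot> pp w = \<^bold>0" "\<And>w. w \<in> Z \<Longrightarrow> pp y \<cdot> pp w = \<^bold>0"
  shows "same_join ({x, y} \<union> Z) ({z} \<union> Z)"
proof -
  note D = strong_joinD[OF J]
  have Zc: "Z \<subseteq> carrier X" using F by (auto simp: orth_family_def)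
  have zw: "pp w \<cdot> pp z = \<^bold>0" if "w \<in> Z" for w
  proof (rule strong_join_lub_zero[OF J])
    fix a assume "a \<in> {x, y}"
    then show "pp w \<cdot> pp a = \<^bold>0"
      using xy[OF that] D(2) Zc that idem_commute[of "pp w" "pp a"] by auto
  qed (use Zc that in auto)
  have "u \<triangleleft> pp v = v \<triangleleft> pp u" if u: "u \<in> {x, y} \<union> Z" and v: "v \<in> {z} \<union> Z" for u v
  proof (cases "v \<in> Z")
    case True
    then show ?thesis using orth_family_compat[OF F u] by blast
  next
    case False
    then have v: "v = z" using v by simp
    show ?thesis
    proof (cases "u \<in> Z")
      case True
      then have "eorth S X u z" "eorth S X z u" "u \<in> carrier X"
        using zw[OF True] Zc D(3) idem_commute[of "pp z" "pp u"] by (auto simp: eorth_def)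
      then show ?thesis using eorth_act_zero D(3) v by simp
    next
      case False
      then have u: "u \<in> {x, y}" using u by blast
      then have "u \<in> carrier X" "u = z \<triangleleft> pp u" using D(2,4) by auto
      moreover from this have "u \<triangleleft> pp z = u"
        using act_lub_upper(3)[OF D(5) _ u D(2)] D(3) by simp
      ultimately show ?thesis using v by simp
    qed
  qed
  moreover have "lub (pp ` ({x, y} \<union> Z)) g \<longleftrightarrow> lub (pp ` ({z} \<union> Z)) g" for g
  proof -
    have sing: "lub {pp w} (pp w)" if "w \<in> Z" for w
      using that Zc by (intro lub_singleton) auto
    have "lub (\<Union>w\<in>insert None (Some ` Z). case w of None \<Rightarrow> {pp x, pp y} | Some w \<Rightarrow> {pp w}) g \<longleftrightarrow>
      lub ((\<lambda>w. case w of None \<Rightarrow> pp z | Some w \<Rightarrow> pp w) ` insert None (Some ` Z)) g"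
      by (rule lub_UN) (use Zc D(2,5) sing in auto)
    moreover have "(\<Union>w\<in>insert None (Some ` Z). case w of None \<Rightarrow> {pp x, pp y} | Some w \<Rightarrow> {pp w}) =
      pp ` ({x, y} \<union> Z)" by auto
    moreover have "(\<lambda>w. case w of None \<Rightarrow> pp z | Some w \<Rightarrow> pp w) ` insert None (Some ` Z) =
      pp ` ({z} \<union> Z)" by (simp add: image_image)
    ultimately show ?thesis by simp
  qed
  ultimately show ?thesis using orth_family_lub[OF F] unfolding same_join_def by metis
qed

text \<open>Passing to order ideals does not affect local agreement, since that is inherited by smaller
  elements, nor the upper bounds of the structure values.\<close>

lemma same_join_down:
  assumes "A \<subseteq> carrier X" "B \<subseteq> carrier X"
  shows "same_join (down X A) (down X B) \<longleftrightarrow> same_join A B"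
proof -
  have mem: "x \<in> down X A \<longleftrightarrow> x \<in> carrier X \<and> (\<exists>a\<in>A. x = a \<triangleleft> pp x)" for x A
    by (simp add: down_def ele_iff)
  have sub: "A \<subseteq> down X A" if A: "A \<subseteq> carrier X" for A
  proof
    fix x assume "x \<in> A"
    moreover from this have "x \<in> carrier X" "x = x \<triangleleft> pp x" using A by auto
    ultimately show "x \<in> down X A" unfolding mem by blast
  qed
  have U: "Upper (sord S) (pp ` down X A) = Upper (sord S) (pp ` A)" if A: "A \<subseteq> carrier X" for A
  proof
    show "Upper (sord S) (pp ` down X A) \<subseteq> Upper (sord S) (pp ` A)"
      using sub[OF A] by (auto simp: Upper_def)
    show "Upper (sord S) (pp ` A) \<subseteq> Upper (sord S) (pp ` down X A)"
    proof
      fix u assume u: "u \<in> Upper (sord S) (pp ` A)"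
      then have uc: "u \<in> carrier S" by (simp add: Upper_def)
      have "pp x \<preceq> u" if x: "x \<in> down X A" for x
      proof -
        obtain a where a: "a \<in> A" "x = a \<triangleleft> pp x" "x \<in> carrier X"
          using x unfolding mem by blast
        then have ac: "a \<in> carrier X" using A by blast
        have "pp x \<preceq> pp a"
          using pmap_le_if_upper[OF ac a(3,2)] idem_le_iff ac a(3) by simp
        moreover have "pp a \<preceq> u" using u a(1) ac by (auto simp: Upper_def)
        ultimately show ?thesis by (rule natle_trans) (use ac a(3) uc in auto)
      qed
      then show "u \<in> Upper (sord S) (pp ` down X A)" using uc by (auto simp: Upper_def)
    qed
  qed
  have compat: "(\<forall>x\<in>down X A. \<forall>y\<in>down X B. x \<triangleleft> pp y = y \<triangleleft> pp x) \<longleftrightarrow>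
      (\<forall>x\<in>A. \<forall>y\<in>B. x \<triangleleft> pp y = y \<triangleleft> pp x)"
  proof
    assume "\<forall>x\<in>down X A. \<forall>y\<in>down X B. x \<triangleleft> pp y = y \<triangleleft> pp x"
    then show "\<forall>x\<in>A. \<forall>y\<in>B. x \<triangleleft> pp y = y \<triangleleft> pp x" using sub assms by blast
  next
    assume *: "\<forall>x\<in>A. \<forall>y\<in>B. x \<triangleleft> pp y = y \<triangleleft> pp x"
    show "\<forall>x\<in>down X A. \<forall>y\<in>down X B. x \<triangleleft> pp y = y \<triangleleft> pp x"
    proof (intro ballI)
      fix x y assume "x \<in> down X A" "y \<in> down X B"
      then obtain a b where ab: "a \<in> A" "b \<in> B" "x = a \<triangleleft> pp x" "y = b \<triangleleft> pp y"
        and c: "x \<in> carrier X" "y \<in> carrier X" unfolding mem by blast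
      have abc: "a \<in> carrier X" "b \<in> carrier X" using ab assms by auto
      let ?h = "pp x \<cdot> pp y"
      have h: "?h \<in> idems S" "pp y \<cdot> pp x = ?h" using c by (auto simp: idem_commute[of "pp y"])
      have le: "pp a \<cdot> pp x = pp x" "pp b \<cdot> pp y = pp y"
        using pmap_le_if_upper[OF abc(1) c(1) ab(3)] pmap_le_if_upper[OF abc(2) c(2) ab(4)] by auto
      have "pp b \<cdot> ?h = pp x \<cdot> (pp b \<cdot> pp y)" "pp a \<cdot> ?h = (pp a \<cdot> pp x) \<cdot> pp y"
        using abc c idem_left_commute[of "pp b" "pp x" "pp y"] by (simp_all add: mult_assoc)
      then have le': "pp b \<cdot> ?h = ?h" "pp a \<cdot> ?h = ?h" unfolding le .
      have "x \<triangleleft> pp y = a \<triangleleft> ?h" using act_assoc[of a "pp x" "pp y"] ab(3) abc c by simp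
      also have "\<dots> = a \<triangleleft> pp b \<triangleleft> ?h" using act_assoc[of a "pp b" ?h] le' abc h by simp
      also have "\<dots> = b \<triangleleft> pp a \<triangleleft> ?h" using bspec[OF bspec[OF * ab(1)] ab(2)] by (simp only:)
      also have "\<dots> = b \<triangleleft> (pp y \<cdot> pp x)" using act_assoc[of b "pp a" ?h] le' abc h by simp
      also have "\<dots> = y \<triangleleft> pp x" using act_assoc[of b "pp y" "pp x"] ab(4) abc c by simp
      finally show "x \<triangleleft> pp y = y \<triangleleft> pp x" .
    qed
  qed
  show ?thesis unfolding same_join_def compat U[OF assms(1)] U[OF assms(2)] ..
qed

lemma orth_ideals_mem: "I \<in> orth_ideals S X \<longleftrightarrow> (\<exists>xs. orth_list S X xs \<and> I = down X (set xs))"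
  unfolding orth_ideals_def by blast

lemma orth_list_join:
  assumes "orth_list S X (x # y # zs)" "strongly_orth S X x y"
  shows "strong_join {x, y} (x \<squnion>\<^bsub>eord X\<^esub> y)" "orth_list S X ((x \<squnion>\<^bsub>eord X\<^esub> y) # zs)"
    "same_join (set (x # y # zs)) (set ((x \<squnion>\<^bsub>eord X\<^esub> y) # zs))"
proof -
  let ?z = "x \<squnion>\<^bsub>eord X\<^esub> y"
  have o: "x \<in> carrier X" "y \<in> carrier X" "set zs \<subseteq> carrier X" "sorted_wrt (eorth S X) zs"
    and z: "\<And>w. w \<in> set zs \<Longrightarrow> pp x \<cdot> pp w = \<^bold>0" "\<And>w. w \<in> set zs \<Longrightarrow> pp y \<cdot> pp w = \<^bold>0"
    using assms(1) unfolding orth_list_iff by (auto simp: eorth_def)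
  show J: "strong_join {x, y} ?z" by (rule strongly_orth_strong_join[OF assms(2) o(1,2)])
  note D = strong_joinD[OF J]
  have "pp ?z \<cdot> pp w = \<^bold>0" if w: "w \<in> set zs" for w
  proof -
    have wc: "w \<in> carrier X" using o(3) w by blast
    have "pp w \<cdot> pp ?z = \<^bold>0"
    proof (rule strong_join_lub_zero[OF J])
      fix a assume "a \<in> {x, y}"
      then show "pp w \<cdot> pp a = \<^bold>0" using z[OF w] o wc idem_commute[of "pp w" "pp a"] by auto
    qed (use wc in auto)
    then show ?thesis using idem_commute[of "pp ?z" "pp w"] D(3) wc by simp
  qed
  then show "orth_list S X (?z # zs)" unfolding orth_list_iff using o D(3) by (simp add: eorth_def)
  have "orth_family ({x, y} \<union> set zs)" using orth_list_family[OF assms(1)] by simp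
  from same_join_pair[OF J this z] show "same_join (set (x # y # zs)) (set (?z # zs))" by simp
qed

lemma sharp_rel_sound:
  "(I, J) \<in> sharp_rel S X \<Longrightarrow> I \<in> orth_ideals S X \<and> J \<in> orth_ideals S X \<and> same_join I J"
proof (induction rule: sharp_rel.induct)
  case (refl I)
  then obtain xs where "orth_list S X xs" "I = down X (set xs)" using orth_ideals_mem by blast
  then show ?case
    using refl same_join_refl[OF orth_list_family] same_join_down[of "set xs" "set xs"] orth_listD(2) by blast
next
  case (sym I J)
  then show ?case using same_join_sym by blast
next
  case (trans I J K)
  then obtain xs ys zs where o: "orth_list S X xs" "orth_list S X ys" "orth_list S X zs"
    and eq: "I = down X (set xs)" "J = down X (set ys)" "K = down X (set zs)"
    unfolding orth_ideals_mem by blast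
  note c = orth_listD(2)[OF o(1)] orth_listD(2)[OF o(2)] orth_listD(2)[OF o(3)]
  have "same_join (set xs) (set zs)"
    by (rule same_join_trans[of _ "set ys"])
       (use trans eq c same_join_down orth_list_family[OF o(2)] in auto)
  then show ?case using trans eq same_join_down[OF c(1,3)] by simp
next
  case (join x y zs)
  note j = orth_list_join[OF join]
  have "same_join (down X (set (x # y # zs))) (down X (set ((x \<squnion>\<^bsub>eord X\<^esub> y) # zs)))"
    using j(3) same_join_down[OF orth_listD(2)[OF join(1)] orth_listD(2)[OF j(2)]] by blast
  then show ?case using join(1) j(2) unfolding orth_ideals_mem by blast
qed

text \<open>Conversely, two families with the same join have the common refinement
  \<open>{x \<triangleleft> pp y} = {y \<triangleleft> pp x}\<close>, and each of them arises from it by successive joins of pairs.\<close>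

lemma split_one:
  assumes "fs \<noteq> []" "set fs \<subseteq> idems S" "sorted_wrt (\<lambda>e f. e \<cdot> f = \<^bold>0) fs" "lub (set fs) g"
    and "x \<in> carrier X" "set zs \<subseteq> carrier X" "sorted_wrt (eorth S X) zs"
    and "\<And>e z. e \<in> set fs \<Longrightarrow> z \<in> set zs \<Longrightarrow> eorth S X (x \<triangleleft> e) z"
  shows "(down X (set (map ((\<triangleleft>) x) fs @ zs)), down X (set ((x \<triangleleft> g) # zs))) \<in> sharp_rel S X"
  using assms
proof (induction fs arbitrary: g zs)
  case Nil
  then show ?case by simp
next
  case (Cons f fs)
  have f: "f \<in> idems S" and fs: "set fs \<subseteq> idems S" using Cons.prems by auto
  show ?case
  proof (cases "fs = []")
    case True
    then have "g = f" using Cons.prems(4) f lub_singleton[of f "{f}"] lub_unique by auto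
    moreover have "orth_list S X ((x \<triangleleft> f) # zs)"
      unfolding orth_list_iff using Cons.prems(5-8) f by auto
    then have "down X (set ((x \<triangleleft> f) # zs)) \<in> orth_ideals S X" unfolding orth_ideals_mem by blast
    ultimately show ?thesis using True sharp_rel.refl by auto
  next
    case False
    have ofs: "sorted_wrt (\<lambda>e f. e \<cdot> f = \<^bold>0) fs" and ff: "\<And>e. e \<in> set fs \<Longrightarrow> f \<cdot> e = \<^bold>0"
      using Cons.prems(3) by auto
    have oset: "orth_set (set fs)"
    proof (rule orth_set_idemI[OF _ fs])
      fix e e' assume "e \<in> set fs" "e' \<in> set fs" "e \<noteq> e'"
      then obtain i j where ij: "i < length fs" "j < length fs" "fs ! i = e" "fs ! j = e'" "i \<noteq> j"
        by (metis in_set_conv_nth)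
      have "e \<in> idems S" "e' \<in> idems S" using \<open>e \<in> set fs\<close> \<open>e' \<in> set fs\<close> fs by auto
      show "e \<cdot> e' = \<^bold>0"
      proof (cases "i < j")
        case True
        then show ?thesis using ofs ij unfolding sorted_wrt_iff_nth_less by blast
      next
        case False
        then have "e' \<cdot> e = \<^bold>0" using ofs ij unfolding sorted_wrt_iff_nth_less
          by (metis linorder_neqE_nat)
        then show ?thesis using idem_commute \<open>e \<in> idems S\<close> \<open>e' \<in> idems S\<close> by simp
      qed
    qed simp
    obtain h where h: "lub (set fs) h" using lub_exists[OF oset] by blast
    have hi: "h \<in> idems S" by (rule lub_idem[OF oset h fs])
    have fh: "f \<cdot> h = \<^bold>0" by (rule lub_mult_left_zero[OF oset h]) (use f ff in auto)
    have hf: "h \<cdot> f = \<^bold>0" using fh idem_commute[OF f hi] by simp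
    have ofh: "orth_set {h, f}" using f hi fh hf by (intro orth_set_idemI) auto
    have "lub (\<Union>b\<in>{True,False}. if b then set fs else {f}) g \<longleftrightarrow>
      lub ((\<lambda>b. if b then h else f) ` {True,False}) g"
      by (rule lub_UN) (use fs f h in \<open>auto intro: lub_singleton\<close>)
    moreover have "(\<Union>b\<in>{True,False}. if b then set fs else {f}) = set (f # fs)"
      "(\<lambda>b. if b then h else f) ` {True,False} = {h, f}" by auto
    ultimately have g: "lub {h, f} g" using Cons.prems(4) by simp
    have J: "strong_join {x \<triangleleft> h, x \<triangleleft> f} (x \<triangleleft> g)"
      using strong_join_act_lub[OF ofh g Cons.prems(5)] by simp
    have o: "eorth S X (x \<triangleleft> h) (x \<triangleleft> f)"
    proof -
      have "pp x \<cdot> h \<cdot> (pp x \<cdot> f) = pp x \<cdot> (h \<cdot> f)"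
        using Cons.prems(5) hi f idem_left_commute[of h "pp x" f] by (simp add: mult_assoc)
      then show ?thesis using Cons.prems(5) hi f hf by (simp add: eorth_def)
    qed
    have xo: "eorth S X (x \<triangleleft> h) z" "eorth S X (x \<triangleleft> f) z" if z: "z \<in> set zs" for z
    proof -
      show "eorth S X (x \<triangleleft> f) z" using Cons.prems(8) z by simp
      have zc: "z \<in> carrier X" using Cons.prems(6) z by blast
      have "pp z \<cdot> pp x \<cdot> h = \<^bold>0"
      proof (rule lub_mult_left_zero[OF oset h])
        fix e assume e: "e \<in> set fs"
        then have ei: "e \<in> idems S" using fs by blast
        have "pp x \<cdot> e \<cdot> pp z = \<^bold>0"
          using Cons.prems(8)[of e z] e z ei Cons.prems(5) by (simp add: eorth_def)
        then show "pp z \<cdot> pp x \<cdot> e = \<^bold>0"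
          using ei zc Cons.prems(5) idem_commute[of "pp x \<cdot> e" "pp z"] by (simp add: mult_assoc)
      qed (use zc Cons.prems(5) in auto)
      then have "pp x \<cdot> h \<cdot> pp z = \<^bold>0"
        using hi zc Cons.prems(5) idem_commute[of "pp x \<cdot> h" "pp z"] by (simp add: mult_assoc)
      then show "eorth S X (x \<triangleleft> h) z" using hi Cons.prems(5) by (simp add: eorth_def)
    qed
    have "(down X (set (map ((\<triangleleft>) x) fs @ (x \<triangleleft> f) # zs)), down X (set ((x \<triangleleft> h) # (x \<triangleleft> f) # zs)))
      \<in> sharp_rel S X"
    proof (rule Cons.IH[OF False fs ofs h Cons.prems(5)])
      show "set ((x \<triangleleft> f) # zs) \<subseteq> carrier X" using Cons.prems(5,6) f by auto
      show "sorted_wrt (eorth S X) ((x \<triangleleft> f) # zs)" using Cons.prems(7) xo(2) by simp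
      fix e z assume e: "e \<in> set fs" and z: "z \<in> set ((x \<triangleleft> f) # zs)"
      have ei: "e \<in> idems S" using e fs by blast
      have "pp x \<cdot> e \<cdot> (pp x \<cdot> f) = pp x \<cdot> (f \<cdot> e)"
        using Cons.prems(5) ei f idem_left_commute[of e "pp x" f] idem_commute[of e f]
        by (simp add: mult_assoc)
      then have "eorth S X (x \<triangleleft> e) (x \<triangleleft> f)"
        using Cons.prems(5) ei f ff[OF e] by (simp add: eorth_def)
      then show "eorth S X (x \<triangleleft> e) z" using z Cons.prems(8)[of e z] e by auto
    qed
    moreover have "set (map ((\<triangleleft>) x) (f # fs) @ zs) = set (map ((\<triangleleft>) x) fs @ (x \<triangleleft> f) # zs)" by auto
    moreover have "(down X (set ((x \<triangleleft> h) # (x \<triangleleft> f) # zs)), down X (set ((x \<triangleleft> g) # zs))) \<in> sharp_rel S X"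
      using sharp_rel.join[of S X "x \<triangleleft> h" "x \<triangleleft> f" zs] strong_join_pair[OF J o] xo o
        Cons.prems(5-7) hi f unfolding orth_list_iff by auto
    ultimately show ?thesis using sharp_rel.trans by metis
  qed
qed

text \<open>All members of a family are split along the same cover at once; \<open>zs\<close> collects the members that
  have been treated already.\<close>

lemma split_all:
  assumes fs: "fs \<noteq> []" "set fs \<subseteq> idems S" "sorted_wrt (\<lambda>e f. e \<cdot> f = \<^bold>0) fs" "lub (set fs) g"
    and "orth_list S X (xs @ zs)" "\<And>x. x \<in> set xs \<Longrightarrow> x \<triangleleft> g = x"
  shows "(down X (set (concat (map (\<lambda>x. map ((\<triangleleft>) x) fs) xs) @ zs)), down X (set (xs @ zs)))
    \<in> sharp_rel S X"
  using assms(5,6)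
proof (induction xs arbitrary: zs)
  case Nil
  then show ?case by (auto intro!: sharp_rel.refl simp: orth_ideals_mem)
next
  case (Cons x xs)
  have x: "x \<in> carrier X" "x \<triangleleft> g = x" and xs: "set xs \<subseteq> carrier X" "set zs \<subseteq> carrier X"
    and so: "sorted_wrt (eorth S X) (xs @ zs)" "\<And>w. w \<in> set (xs @ zs) \<Longrightarrow> eorth S X x w"
    using Cons.prems unfolding orth_list_iff by auto
  have xe: "eorth S X (x \<triangleleft> e) w" if e: "e \<in> set fs" and w: "w \<in> set (xs @ zs)" for e w
  proof -
    have c: "e \<in> idems S" "w \<in> carrier X" using e w fs(2) xs by auto
    have "pp x \<cdot> e \<cdot> pp w = e \<cdot> (pp x \<cdot> pp w)"
      using x c by (simp add: idem_commute[of "pp x" e] mult_assoc)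
    then show ?thesis using so(2)[OF w] x(1) c by (simp add: eorth_def)
  qed
  have xee: "sorted_wrt (eorth S X) (map ((\<triangleleft>) x) fs)"
    unfolding sorted_wrt_map
  proof (rule sorted_wrt_mono_rel[OF _ fs(3)])
    fix e f assume "e \<in> set fs" "f \<in> set fs" and ef: "e \<cdot> f = \<^bold>0"
    then have c: "e \<in> idems S" "f \<in> idems S" using fs(2) by auto
    have "pp x \<cdot> e \<cdot> (pp x \<cdot> f) = pp x \<cdot> (e \<cdot> f)"
      using x c idem_left_commute[of e "pp x" f] by (simp add: mult_assoc)
    then show "eorth S X (x \<triangleleft> e) (x \<triangleleft> f)" using x(1) c ef by (simp add: eorth_def)
  qed
  have xfc: "set (map ((\<triangleleft>) x) fs) \<subseteq> carrier X" using x fs(2) by auto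
  have sym: "eorth S X w u" if "eorth S X u w" "u \<in> set (map ((\<triangleleft>) x) fs)" "w \<in> set (xs @ zs)" for u w
    using eorth_sym[OF _ _ that(1)] that(2,3) xfc xs by auto
  have o: "orth_list S X (xs @ (map ((\<triangleleft>) x) fs @ zs))"
    unfolding orth_list_iff sorted_wrt_append
  proof (intro conjI ballI)
    fix w u assume w: "w \<in> set xs" and u: "u \<in> set (map ((\<triangleleft>) x) fs @ zs)"
    show "eorth S X w u"
    proof (cases "u \<in> set zs")
      case True
      then show ?thesis using so(1) w by (simp add: sorted_wrt_append)
    next
      case False
      then have u': "u \<in> set (map ((\<triangleleft>) x) fs)" using u by simp
      then obtain e where "e \<in> set fs" "u = x \<triangleleft> e" by auto
      then have "eorth S X u w" using xe[of e w] w by simp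
      then show ?thesis using sym[OF _ u'] w by simp
    qed
  qed (use xfc xs so xee xe fs(1) in \<open>auto simp: sorted_wrt_append\<close>)
  have "(down X (set (concat (map (\<lambda>x. map ((\<triangleleft>) x) fs) xs) @ (map ((\<triangleleft>) x) fs @ zs))),
      down X (set (xs @ (map ((\<triangleleft>) x) fs @ zs)))) \<in> sharp_rel S X"
    using Cons.IH[OF o] Cons.prems(2) by simp
  moreover have "(down X (set (map ((\<triangleleft>) x) fs @ (xs @ zs))), down X (set ((x \<triangleleft> g) # (xs @ zs))))
      \<in> sharp_rel S X"
    by (rule split_one[OF fs x(1) _ so(1) xe]) (use xs in auto)
  moreover have "set (xs @ (map ((\<triangleleft>) x) fs @ zs)) = set (map ((\<triangleleft>) x) fs @ (xs @ zs))"
    "set (concat (map (\<lambda>x. map ((\<triangleleft>) x) fs) xs) @ (map ((\<triangleleft>) x) fs @ zs)) =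
     set (concat (map (\<lambda>x. map ((\<triangleleft>) x) fs) (x # xs)) @ zs)" by auto
  ultimately show ?case using sharp_rel.trans x(2) by (metis append_Cons)
qed

lemma sharp_rel_complete:
  assumes xs: "orth_list S X xs" and ys: "orth_list S X ys" and sj: "same_join (set xs) (set ys)"
  shows "(down X (set xs), down X (set ys)) \<in> sharp_rel S X"
proof -
  obtain g where g: "lub (pp ` set xs) g" "g \<in> idems S"
    by (rule orth_family_lub[OF orth_list_family[OF xs]])
  have g': "lub (pp ` set ys) g" by (rule same_joinD(2)[OF sj g(1)])
  have refine: "(down X (\<Union>x\<in>set us. (\<lambda>v. x \<triangleleft> pp v) ` set vs), down X (set us)) \<in> sharp_rel S X"
    if us: "orth_list S X us" and vs: "orth_list S X vs"
      and lu: "lub (pp ` set us) g" and lv: "lub (pp ` set vs) g" for us vs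
  proof -
    have "(down X (set (concat (map (\<lambda>x. map ((\<triangleleft>) x) (map pp vs)) us) @ [])), down X (set (us @ [])))
      \<in> sharp_rel S X"
    proof (rule split_all)
      show "map pp vs \<noteq> []" "set (map pp vs) \<subseteq> idems S" using orth_listD(1,2)[OF vs] by auto
      show "sorted_wrt (\<lambda>e f. e \<cdot> f = \<^bold>0) (map pp vs)"
        using vs unfolding orth_list_iff sorted_wrt_map eorth_def by simp
      show "lub (set (map pp vs)) g" using lv by simp
      show "orth_list S X (us @ [])" using us by simp
      show "x \<triangleleft> g = x" if "x \<in> set us" for x
        by (rule act_lub_upper(3)[OF lu g(2) that orth_listD(2)[OF us]])
    qed
    moreover have "set (concat (map (\<lambda>x. map ((\<triangleleft>) x) (map pp vs)) us) @ []) =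
      (\<Union>x\<in>set us. (\<lambda>v. x \<triangleleft> pp v) ` set vs)" by auto
    ultimately show ?thesis by simp
  qed
  have "(\<Union>x\<in>set xs. (\<lambda>v. x \<triangleleft> pp v) ` set ys) = (\<Union>y\<in>set ys. (\<lambda>v. y \<triangleleft> pp v) ` set xs)"
  proof (intro equalityI subsetI)
    fix w assume "w \<in> (\<Union>x\<in>set xs. (\<lambda>v. x \<triangleleft> pp v) ` set ys)"
    then obtain x y where "x \<in> set xs" "y \<in> set ys" "w = x \<triangleleft> pp y" by blast
    then show "w \<in> (\<Union>y\<in>set ys. (\<lambda>v. y \<triangleleft> pp v) ` set xs)" using same_joinD(1)[OF sj] by blast
  next
    fix w assume "w \<in> (\<Union>y\<in>set ys. (\<lambda>v. y \<triangleleft> pp v) ` set xs)"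
    then obtain x y where xy: "x \<in> set xs" "y \<in> set ys" and w: "w = y \<triangleleft> pp x" by blast
    have "w = x \<triangleleft> pp y" unfolding w by (rule same_joinD(1)[OF sj xy, symmetric])
    then show "w \<in> (\<Union>x\<in>set xs. (\<lambda>v. x \<triangleleft> pp v) ` set ys)" using xy by blast
  qed
  then show ?thesis
    using refine[OF xs ys g(1) g'] refine[OF ys xs g' g(1)] sharp_rel.sym sharp_rel.trans by metis
qed

end

context orth_etale
begin

text \<open>From here on the defining relation of \<open>X\<^sup>\<sharp>\<close> enters only through this criterion.\<close>

lemma sharp_class_eq_iff:
  assumes xs: "orth_list S X xs" and ys: "orth_list S X ys"
  shows "sharp_class S X xs = sharp_class S X ys \<longleftrightarrow> same_join (set xs) (set ys)"
proof
  assume eq: "sharp_class S X xs = sharp_class S X ys"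
  have "down X (set ys) \<in> sharp_class S X ys"
    unfolding sharp_class_def using ys by (auto intro!: sharp_rel.refl simp: orth_ideals_mem)
  then have "(down X (set xs), down X (set ys)) \<in> sharp_rel S X"
    unfolding eq[symmetric] by (simp add: sharp_class_def)
  then show "same_join (set xs) (set ys)"
    using sharp_rel_sound same_join_down[OF orth_listD(2)[OF xs] orth_listD(2)[OF ys]] by blast
next
  assume "same_join (set xs) (set ys)"
  then have r: "(down X (set xs), down X (set ys)) \<in> sharp_rel S X" by (rule sharp_rel_complete[OF xs ys])
  show "sharp_class S X xs = sharp_class S X ys"
    unfolding sharp_class_def
    using sharp_rel.trans[OF r] sharp_rel.trans[OF sharp_rel.sym[OF r]] by blast
qed

lemma sharp_class_set_eq:
  "orth_list S X xs \<Longrightarrow> set xs = set ys \<Longrightarrow> sharp_class S X xs = sharp_class S X ys"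
  by (simp add: sharp_class_def)

lemma carrier_sharp: "C \<in> carrier (sharp S X) \<longleftrightarrow> (\<exists>xs. orth_list S X xs \<and> C = sharp_class S X xs)"
  unfolding sharp_def quotient_def sharp_class_def orth_ideals_def by auto

lemma eorth_act:
  assumes "eorth S X x y" "x \<in> carrier X" "y \<in> carrier X" "s \<in> carrier S"
  shows "eorth S X (x \<triangleleft> s) (y \<triangleleft> s)"
  using src_orth_act[of "pp x" "pp y" s] assms by (simp add: eorth_def pmap_act_src)

lemma orth_list_act:
  assumes "orth_list S X xs" "s \<in> carrier S"
  shows "orth_list S X (map (\<lambda>x. x \<triangleleft> s) xs)"
  unfolding orth_list_iff sorted_wrt_map
proof (intro conjI)
  have o: "xs \<noteq> []" "set xs \<subseteq> carrier X" "sorted_wrt (eorth S X) xs"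
    using assms(1) unfolding orth_list_iff by auto
  show "map (\<lambda>x. x \<triangleleft> s) xs \<noteq> []" "set (map (\<lambda>x. x \<triangleleft> s) xs) \<subseteq> carrier X" using o assms(2) by auto
  show "sorted_wrt (\<lambda>x y. eorth S X (x \<triangleleft> s) (y \<triangleleft> s)) xs"
  proof (rule sorted_wrt_mono_rel[OF _ o(3)])
    fix x y assume "x \<in> set xs" "y \<in> set xs" "eorth S X x y"
    then show "eorth S X (x \<triangleleft> s) (y \<triangleleft> s)"
      using o(2) eorth_act assms(2) by blast
  qed
qed

lemma act_sharp:
  assumes xs: "orth_list S X xs" and s: "s \<in> carrier S"
  shows "act (sharp S X) (sharp_class S X xs) s = sharp_class S X (map (\<lambda>x. x \<triangleleft> s) xs)"
proof -
  have "sharp_class S X (map (\<lambda>x. x \<triangleleft> s) ys) = sharp_class S X (map (\<lambda>x. x \<triangleleft> s) xs)"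
    if ys: "orth_list S X ys" and eq: "sharp_class S X xs = sharp_class S X ys" for ys
  proof -
    have "same_join (set ys) (set xs)" using sharp_class_eq_iff[OF ys xs] eq by simp
    from same_join_act[OF this orth_list_family[OF ys] orth_list_family[OF xs] s]
    show ?thesis using sharp_class_eq_iff[OF orth_list_act[OF ys s] orth_list_act[OF xs s]] by simp
  qed
  then have "(THE D. \<exists>ys. orth_list S X ys \<and> sharp_class S X xs = sharp_class S X ys \<and>
      D = sharp_class S X (map (\<lambda>x. x \<triangleleft> s) ys)) = sharp_class S X (map (\<lambda>x. x \<triangleleft> s) xs)"
    using xs by (intro the_equality) blast+
  then show ?thesis by (simp add: sharp_def)
qed

lemma pmap_sharp:
  assumes xs: "orth_list S X xs" and g: "lub (pp ` set xs) g"
  shows "pmap (sharp S X) (sharp_class S X xs) = g"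
proof -
  have "\<Squnion>\<^bsub>sord S\<^esub> (pp ` set ys) = g"
    if ys: "orth_list S X ys" and eq: "sharp_class S X xs = sharp_class S X ys" for ys
  proof -
    have "same_join (set xs) (set ys)" using sharp_class_eq_iff[OF xs ys] eq by simp
    from same_joinD(2)[OF this g] show ?thesis by (rule sup_eq)
  qed
  then have "(THE e. \<exists>ys. orth_list S X ys \<and> sharp_class S X xs = sharp_class S X ys \<and>
      e = \<Squnion>\<^bsub>sord S\<^esub> (pp ` set ys)) = g"
    using xs by (intro the_equality) (blast, metis)
  then show ?thesis by (simp add: sharp_def)
qed

lemma sharp_repr:
  assumes "C \<in> carrier (sharp S X)"
  obtains xs g where "orth_list S X xs" "C = sharp_class S X xs" "lub (pp ` set xs) g"
    "g \<in> idems S" "pmap (sharp S X) C = g"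
proof -
  obtain xs where xs: "orth_list S X xs" "C = sharp_class S X xs"
    using assms carrier_sharp by blast
  obtain g where g: "lub (pp ` set xs) g" "g \<in> idems S"
    by (rule orth_family_lub[OF orth_list_family[OF xs(1)]])
  show ?thesis using that[OF xs g] pmap_sharp[OF xs(1) g(1)] xs(2) by simp
qed

lemma orth_list_single: "x \<in> carrier X \<Longrightarrow> orth_list S X [x]"
  unfolding orth_list_iff by simp

lemma pt_sharp: "pt (sharp S X) = sharp_class S X [pt X]"
  by (simp add: sharp_def)

lemma sharp_pointed_etale: "pointed_etale S (sharp S X)"
proof unfold_locales
  let ?N = "sharp S X"
  have closed: "act ?N C s \<in> carrier ?N" if C: "C \<in> carrier ?N" and s: "s \<in> carrier S" for C s
  proof -
    obtain xs where xs: "orth_list S X xs" "C = sharp_class S X xs"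
      using C carrier_sharp by blast
    then show ?thesis
      unfolding xs(2) act_sharp[OF xs(1) s] carrier_sharp using orth_list_act[OF xs(1) s] by blast
  qed
  then show "act ?N C s \<in> carrier ?N" if "C \<in> carrier ?N" "s \<in> carrier S" for C s using that .
  show "act ?N (act ?N C s) t = act ?N C (s \<cdot> t)"
    if C: "C \<in> carrier ?N" and s: "s \<in> carrier S" and t: "t \<in> carrier S" for C s t
  proof -
    obtain xs where xs: "orth_list S X xs" "C = sharp_class S X xs"
      using C carrier_sharp by blast
    have "map (\<lambda>x. x \<triangleleft> t) (map (\<lambda>x. x \<triangleleft> s) xs) = map (\<lambda>x. x \<triangleleft> (s \<cdot> t)) xs"
      using orth_listD(2)[OF xs(1)] s t by auto
    then show ?thesis
      unfolding xs(2) act_sharp[OF xs(1) s] act_sharp[OF orth_list_act[OF xs(1) s] t]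
        act_sharp[OF xs(1) mult_closed[OF s t]]
      by (simp only:)
  qed
  show idem: "pmap ?N C \<in> idems S" if "C \<in> carrier ?N" for C
    by (rule sharp_repr[OF that]) simp
  show act_p: "act ?N C (pmap ?N C) = C" if "C \<in> carrier ?N" for C
  proof (rule sharp_repr[OF that])
    fix xs g assume xs: "orth_list S X xs" "C = sharp_class S X xs" and g: "lub (pp ` set xs) g"
      "g \<in> idems S" "pmap ?N C = g"
    have "map (\<lambda>x. x \<triangleleft> g) xs = xs"
      by (rule map_idI) (rule act_lub_upper(3)[OF g(1,2) _ orth_listD(2)[OF xs(1)]])
    then show "act ?N C (pmap ?N C) = C"
      using act_sharp[OF xs(1) idem_closed[OF g(2)]] g(3) xs(2) by simp
  qed
  show "{act ?N C s | C s. C \<in> carrier ?N \<and> s \<in> carrier S} = carrier ?N"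
  proof (intro equalityI subsetI)
    fix C assume C: "C \<in> carrier ?N"
    then have "C = act ?N C (pmap ?N C)" "pmap ?N C \<in> carrier S" using act_p idem by auto
    then show "C \<in> {act ?N C s | C s. C \<in> carrier ?N \<and> s \<in> carrier S}" using C by blast
  qed (use closed in blast)
  show "pmap ?N (act ?N C s) = s\<^sup>\<star> \<cdot> pmap ?N C \<cdot> s" if C: "C \<in> carrier ?N" and s: "s \<in> carrier S" for C s
  proof (rule sharp_repr[OF C])
    fix xs g assume xs: "orth_list S X xs" "C = sharp_class S X xs" and g: "lub (pp ` set xs) g"
      "g \<in> idems S" "pmap ?N C = g"
    have "lub (pp ` set (map (\<lambda>x. x \<triangleleft> s) xs)) (s\<^sup>\<star> \<cdot> g \<cdot> s)"
      using lub_pmap_act[OF orth_list_family[OF xs(1)] g(1) s] by simp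
    from pmap_sharp[OF orth_list_act[OF xs(1) s] this]
    show "pmap ?N (act ?N C s) = s\<^sup>\<star> \<cdot> pmap ?N C \<cdot> s"
      using act_sharp[OF xs(1) s] xs(2) g(3) by simp
  qed
  have pt: "orth_list S X [pt X]" by (rule orth_list_single) simp
  show "pt ?N \<in> carrier ?N" unfolding pt_sharp carrier_sharp using pt by blast
  show "pmap ?N (pt ?N) = \<^bold>0"
    unfolding pt_sharp by (rule pmap_sharp[OF pt]) (simp add: lub_zeros)
  have const: "sharp_class S X xs = pt ?N" if "orth_list S X xs" "set xs \<subseteq> {pt X}" for xs
  proof -
    have "set xs = {pt X}" using that orth_listD(1)[OF that(1)] by (cases xs) auto
    then show ?thesis unfolding pt_sharp by (intro sharp_class_set_eq that) simp
  qed
  show "C = pt ?N" if C: "C \<in> carrier ?N" and z: "pmap ?N C = \<^bold>0" for C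
  proof (rule sharp_repr[OF C])
    fix xs g assume xs: "orth_list S X xs" "C = sharp_class S X xs" and g: "lub (pp ` set xs) g"
      "g \<in> idems S" "pmap ?N C = g"
    have "x = pt X" if x: "x \<in> set xs" for x
    proof -
      have xc: "x \<in> carrier X" using orth_listD(2)[OF xs(1)] x by blast
      have "g = \<^bold>0" using g(3) z by simp
      then show ?thesis
        using act_lub_upper(3)[OF g(1,2) x orth_listD(2)[OF xs(1)]] act_zero[OF xc] by simp
    qed
    then show "C = pt ?N" unfolding xs(2) by (intro const xs(1)) blast
  qed
  show "act ?N (pt ?N) s = pt ?N" if "s \<in> carrier S" for s
    using act_sharp[OF pt that] that by (simp add: pt_sharp)
  show "act ?N C \<^bold>0 = pt ?N" if C: "C \<in> carrier ?N" for C
  proof (rule sharp_repr[OF C])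
    fix xs assume xs: "orth_list S X xs" "C = sharp_class S X xs"
    show "act ?N C \<^bold>0 = pt ?N"
      unfolding xs(2) act_sharp[OF xs(1) zero_closed]
      by (rule const[OF orth_list_act[OF xs(1) zero_closed]]) (use orth_listD(2)[OF xs(1)] in auto)
  qed
qed

end

context orth_etale
begin

interpretation N: pointed_etale S "sharp S X"
  by (rule sharp_pointed_etale)

lemma eorth_sharp_append:
  assumes xs: "orth_list S X xs" and ys: "orth_list S X ys"
    and g: "lub (pp ` set xs) g" "g \<in> idems S" and h: "lub (pp ` set ys) h" "h \<in> idems S"
    and gh: "g \<cdot> h = \<^bold>0"
  shows "orth_list S X (xs @ ys)" "\<And>x. x \<in> set xs \<Longrightarrow> x \<triangleleft> h = pt X" "\<And>y. y \<in> set ys \<Longrightarrow> y \<triangleleft> g = pt X"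
proof -
  note xc = orth_listD(2)[OF xs] and yc = orth_listD(2)[OF ys]
  have hg: "h \<cdot> g = \<^bold>0" using gh idem_commute[OF h(2) g(2)] by simp
  have x: "x \<triangleleft> h = pt X" "pp x \<cdot> h = \<^bold>0" if "x \<in> set xs" for x
  proof -
    have c: "x \<in> carrier X" using that xc by blast
    note u = act_lub_upper[OF g that xc]
    have "x \<triangleleft> g \<triangleleft> h = pt X" using gh c g(2) h(2) by simp
    then show "x \<triangleleft> h = pt X" unfolding u(3) .
    have "pp x \<cdot> g \<cdot> h = \<^bold>0" using gh c g(2) h(2) by (simp add: mult_assoc)
    then show "pp x \<cdot> h = \<^bold>0" unfolding u(2) .
  qed
  show "y \<triangleleft> g = pt X" if "y \<in> set ys" for y
  proof -
    have c: "y \<in> carrier X" using that yc by blast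
    note u = act_lub_upper[OF h that yc]
    have "y \<triangleleft> h \<triangleleft> g = pt X" using hg c g(2) h(2) by simp
    then show "y \<triangleleft> g = pt X" unfolding u(3) .
  qed
  show "x \<triangleleft> h = pt X" if "x \<in> set xs" for x using x(1)[OF that] .
  have "eorth S X x y" if "x \<in> set xs" "y \<in> set ys" for x y
  proof -
    have c: "x \<in> carrier X" "y \<in> carrier X" using that xc yc by auto
    have "pp x \<cdot> pp y = pp x \<cdot> (h \<cdot> pp y)" using act_lub_upper(1)[OF h that(2) yc] by simp
    also have "\<dots> = \<^bold>0" using x(2)[OF that(1)] c h(2) mult_assoc[of "pp x" h "pp y"] by simp
    finally show ?thesis by (simp add: eorth_def)
  qed
  then show "orth_list S X (xs @ ys)"
    using xs ys unfolding orth_list_iff by (auto simp: sorted_wrt_append)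
qed

text \<open>The join of two orthogonal classes is the class of the concatenation. The first two families are
  recovered from it by restriction, up to zeros. If an upper bound restricts to both of them, it
  agrees locally with each member, so its restriction to the total structure value has the same
  join as the concatenation.\<close>

lemma sharp_join:
  assumes xs: "orth_list S X xs" and ys: "orth_list S X ys"
    and CD: "eorth S (sharp S X) (sharp_class S X xs) (sharp_class S X ys)"
  shows "orth_list S X (xs @ ys)"
    and "N.elub {sharp_class S X xs, sharp_class S X ys} (sharp_class S X (xs @ ys))"
    and "lub {N.pp (sharp_class S X xs), N.pp (sharp_class S X ys)} (N.pp (sharp_class S X (xs @ ys)))"
proof -
  let ?C = "sharp_class S X xs" and ?D = "sharp_class S X ys"
  obtain g where g: "lub (pp ` set xs) g" "g \<in> idems S"
    by (rule orth_family_lub[OF orth_list_family[OF xs]])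
  obtain h where h: "lub (pp ` set ys) h" "h \<in> idems S"
    by (rule orth_family_lub[OF orth_list_family[OF ys]])
  have pC: "N.pp ?C = g" and pD: "N.pp ?D = h"
    using pmap_sharp[OF xs g(1)] pmap_sharp[OF ys h(1)] by auto
  note xc = orth_listD(2)[OF xs] and yc = orth_listD(2)[OF ys]
  have gh: "g \<cdot> h = \<^bold>0" using CD pC pD by (simp add: eorth_def)
  note app = eorth_sharp_append[OF xs ys g h gh]
  let ?J = "sharp_class S X (xs @ ys)"
  obtain k where k: "lub (pp ` set (xs @ ys)) k" "k \<in> idems S"
    by (rule orth_family_lub[OF orth_list_family[OF app(1)]])
  have pJ: "N.pp ?J = k" by (rule pmap_sharp[OF app(1) k(1)])
  have "lub (\<Union>b\<in>{True,False}. if b then pp ` set xs else pp ` set ys) k \<longleftrightarrow>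
      lub ((\<lambda>b. if b then g else h) ` {True,False}) k"
    by (rule lub_UN) (use xc yc g(1) h(1) in auto)
  moreover have "(\<Union>b\<in>{True,False}. if b then pp ` set xs else pp ` set ys) = pp ` set (xs @ ys)"
    "(\<lambda>b. if b then g else h) ` {True,False} = {g, h}" by auto
  ultimately have lk: "lub {g, h} k" using k(1) by simp
  have restr: "act (sharp S X) ?J e = sharp_class S X us"
    if "orth_list S X us" "e \<in> carrier S" "(\<lambda>x. x \<triangleleft> e) ` set (xs @ ys) - {pt X} = set us - {pt X}" for e us
  proof -
    have "same_join ((\<lambda>x. x \<triangleleft> e) ` set (xs @ ys)) (set us)"
      by (rule same_join_zero(1)[OF orth_family_act[OF orth_list_family[OF app(1)] that(2)] that(3)])
    then show ?thesis
      unfolding act_sharp[OF app(1) that(2)]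
        sharp_class_eq_iff[OF orth_list_act[OF app(1) that(2)] that(1)] set_map .
  qed
  have JC: "act (sharp S X) ?J g = ?C"
  proof (rule restr[OF xs idem_closed[OF g(2)]])
    have "(\<lambda>x. x \<triangleleft> g) ` set xs = set xs"
      using act_lub_upper(3)[OF g _ xc] by (simp cong: image_cong_simp)
    moreover have "(\<lambda>x. x \<triangleleft> g) ` set ys \<subseteq> {pt X}" using app(3) by blast
    ultimately show "(\<lambda>x. x \<triangleleft> g) ` set (xs @ ys) - {pt X} = set xs - {pt X}"
      unfolding set_append image_Un by blast
  qed
  have JD: "act (sharp S X) ?J h = ?D"
  proof (rule restr[OF ys idem_closed[OF h(2)]])
    have "(\<lambda>x. x \<triangleleft> h) ` set ys = set ys"
      using act_lub_upper(3)[OF h _ yc] by (simp cong: image_cong_simp)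
    moreover have "(\<lambda>x. x \<triangleleft> h) ` set xs \<subseteq> {pt X}" using app(2) by blast
    ultimately show "(\<lambda>x. x \<triangleleft> h) ` set (xs @ ys) - {pt X} = set ys - {pt X}"
      unfolding set_append image_Un by blast
  qed
  have least: "?J = act (sharp S X) U k"
    if U: "U \<in> carrier (sharp S X)" and UC: "?C = act (sharp S X) U g" and UD: "?D = act (sharp S X) U h" for U
  proof -
    obtain zs w where zs: "orth_list S X zs" "U = sharp_class S X zs"
      and w: "lub (pp ` set zs) w" "w \<in> idems S" and pU: "N.pp U = w" by (rule sharp_repr[OF U]) blast
    note zc = orth_listD(2)[OF zs(1)]
    have part: "x \<triangleleft> pp z = z \<triangleleft> pp x"
      if us: "orth_list S X us" "sharp_class S X us = act (sharp S X) U e" "lub (pp ` set us) e" "e \<in> idems S"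
        and x: "x \<in> set us" and z: "z \<in> set zs" for us e x z
    proof -
      have uc: "set us \<subseteq> carrier X" by (rule orth_listD(2)[OF us(1)])
      have ec: "e \<in> carrier S" using us(4) by auto
      have "same_join (set us) ((\<lambda>x. x \<triangleleft> e) ` set zs)"
        using us(2) sharp_class_eq_iff[OF us(1) orth_list_act[OF zs(1) ec]]
        unfolding zs(2) act_sharp[OF zs(1) ec] by simp
      from same_joinD(1)[OF this x, of "z \<triangleleft> e"] z
      have eq: "x \<triangleleft> pp (z \<triangleleft> e) = z \<triangleleft> e \<triangleleft> pp x" by blast
      have c: "x \<in> carrier X" "z \<in> carrier X" using uc zc x z by auto
      note u = act_lub_upper[OF us(3,4) x uc]
      have "x \<triangleleft> pp (z \<triangleleft> e) = x \<triangleleft> e \<triangleleft> pp z"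
        using c us(4) by (simp add: idem_commute[of "pp z" e])
      moreover have "z \<triangleleft> e \<triangleleft> pp x = z \<triangleleft> (e \<cdot> pp x)" using c us(4) by simp
      ultimately show ?thesis using eq unfolding u(1,3) by simp
    qed
    have gw: "w \<cdot> g = g" "w \<cdot> h = h"
      using N.pmap_act_idem[OF U g(2)] N.pmap_act_idem[OF U h(2)] UC UD pC pD pU by auto
    have "g \<preceq> w" "h \<preceq> w" using gw idem_le_iff g(2) h(2) w(2) by auto
    then have "k \<preceq> w" using lub_least[OF lk, of w] w(2) by auto
    then have wk: "w \<cdot> k = k" using idem_le_iff k(2) w(2) by blast
    have lz: "lub (pp ` (\<lambda>x. x \<triangleleft> k) ` set zs) k"
    proof -
      have "k \<cdot> w \<cdot> k = k" using wk k(2) w(2) by (simp add: mult_assoc)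
      then show ?thesis
        using lub_pmap_act[OF orth_list_family[OF zs(1)] w(1), of k] k(2) by simp
    qed
    have "x \<triangleleft> pp (z \<triangleleft> k) = z \<triangleleft> k \<triangleleft> pp x" if x: "x \<in> set (xs @ ys)" and z: "z \<in> set zs" for x z
    proof -
      have c: "x \<in> carrier X" "z \<in> carrier X" using xc yc zc x z by auto
      note u = act_lub_upper[OF k x orth_listD(2)[OF app(1)]]
      have "x \<triangleleft> pp (z \<triangleleft> k) = x \<triangleleft> k \<triangleleft> pp z"
        using c k(2) by (simp add: idem_commute[of "pp z" k])
      also have "\<dots> = x \<triangleleft> pp z" unfolding u(3) ..
      also have "\<dots> = z \<triangleleft> pp x"
      proof (cases "x \<in> set xs")
        case True
        show ?thesis by (rule part[OF xs _ g True z]) (rule UC)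
      next
        case False
        then have "x \<in> set ys" using x by simp
        then show ?thesis by (intro part[OF ys _ h _ z]) (rule UD)
      qed
      also have "\<dots> = z \<triangleleft> (k \<cdot> pp x)" unfolding u(1) ..
      also have "\<dots> = z \<triangleleft> k \<triangleleft> pp x" using c k(2) by simp
      finally show ?thesis .
    qed
    then have "same_join (set (xs @ ys)) ((\<lambda>x. x \<triangleleft> k) ` set zs)"
      unfolding same_join_def using k(1) lz by blast
    then show ?thesis
      unfolding zs(2) act_sharp[OF zs(1) idem_closed[OF k(2)]]
        sharp_class_eq_iff[OF app(1) orth_list_act[OF zs(1) idem_closed[OF k(2)]]] set_map .
  qed
  have c: "?J \<in> carrier (sharp S X)" "?C \<in> carrier (sharp S X)" "?D \<in> carrier (sharp S X)"
    using app(1) xs ys carrier_sharp by blast+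
  show "N.elub {?C, ?D} ?J"
    unfolding least_def
  proof (intro conjI ballI)
    show "?J \<in> Upper (eord (sharp S X)) {?C, ?D}"
      using c JC JD by (auto simp: Upper_def N.ele_iff pC pD)
    fix U assume "U \<in> Upper (eord (sharp S X)) {?C, ?D}"
    then have "U \<in> carrier (sharp S X)" "?C = act (sharp S X) U g" "?D = act (sharp S X) U h"
      using c(2,3) pC pD unfolding Upper_def N.ele_iff by auto
    then show "?J \<sqsubseteq>\<^bsub>eord (sharp S X)\<^esub> U" unfolding N.ele_iff pJ by (rule least)
  qed (auto simp: Upper_def)
  show "orth_list S X (xs @ ys)" by (rule app(1))
  show "lub {N.pp ?C, N.pp ?D} (N.pp ?J)" using lk pC pD pJ by simp
qed

theorem sharp_module: "etale_module S (sharp S X)"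
proof
  fix C D assume CD: "C \<in> carrier (sharp S X)" "D \<in> carrier (sharp S X)" "eorth S (sharp S X) C D"
  obtain xs ys where xs: "orth_list S X xs" "C = sharp_class S X xs"
    and ys: "orth_list S X ys" "D = sharp_class S X ys"
    using CD(1,2) unfolding carrier_sharp by blast
  note J = sharp_join[OF xs(1) ys(1) CD(3)[unfolded xs(2) ys(2)], folded xs(2) ys(2)]
  have j: "C \<squnion>\<^bsub>eord (sharp S X)\<^esub> D = sharp_class S X (xs @ ys)" by (rule N.join_eq_elub[OF J(2)])
  show "has_join (eord (sharp S X)) {C, D} \<and>
    N.pp (C \<squnion>\<^bsub>eord (sharp S X)\<^esub> D) = N.pp C \<squnion>\<^bsub>sord S\<^esub> N.pp D"
    unfolding j using J(2) sup_eq[OF J(3)] by (auto simp: has_join_def join_def)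
  fix s assume s: "s \<in> carrier S"
  let ?f = "map (\<lambda>x. x \<triangleleft> s)"
  note xs' = orth_list_act[OF xs(1) s] and ys' = orth_list_act[OF ys(1) s]
  have Cs: "act (sharp S X) C s = sharp_class S X (?f xs)"
    and Ds: "act (sharp S X) D s = sharp_class S X (?f ys)"
    unfolding xs(2) ys(2) using act_sharp[OF _ s] xs(1) ys(1) by auto
  have "eorth S (sharp S X) (act (sharp S X) C s) (act (sharp S X) D s)"
    using src_orth_act[of "N.pp C" "N.pp D" s] CD s by (simp add: eorth_def N.pmap_act_src)
  then have "eorth S (sharp S X) (sharp_class S X (?f xs)) (sharp_class S X (?f ys))"
    unfolding Cs Ds .
  from N.join_eq_elub[OF sharp_join(2)[OF xs' ys' this]]
  show "act (sharp S X) (C \<squnion>\<^bsub>eord (sharp S X)\<^esub> D) s =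
    act (sharp S X) C s \<squnion>\<^bsub>eord (sharp S X)\<^esub> act (sharp S X) D s"
    unfolding j Cs Ds act_sharp[OF J(1) s] by simp
qed

lemma sharp_strong_join:
  assumes xs: "orth_list S X xs"
  shows "N.strong_join ((\<lambda>x. sharp_class S X [x]) ` set xs) (sharp_class S X xs)"
proof -
  note xc = orth_listD(2)[OF xs]
  obtain g where g: "lub (pp ` set xs) g" "g \<in> idems S"
    by (rule orth_family_lub[OF orth_list_family[OF xs]])
  have single: "N.pp (sharp_class S X [x]) = pp x" if "x \<in> carrier X" for x
    by (rule pmap_sharp[OF orth_list_single[OF that]]) (use that in \<open>auto intro: lub_singleton\<close>)
  have pg: "N.pp (sharp_class S X xs) = g" by (rule pmap_sharp[OF xs g(1)])
  have im: "N.pp ` (\<lambda>x. sharp_class S X [x]) ` set xs = pp ` set xs"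
    unfolding image_image using single xc by (intro image_cong) auto
  have le: "sharp_class S X [x] = act (sharp S X) (sharp_class S X xs) (N.pp (sharp_class S X [x]))"
    if x: "x \<in> set xs" for x
  proof -
    have c: "x \<in> carrier X" using x xc by blast
    have pc: "pp x \<in> carrier S" using c by auto
    have "(\<lambda>y. y \<triangleleft> pp x) ` set xs - {pt X} = set [x] - {pt X}"
    proof -
      have "y \<triangleleft> pp x = pt X" if y: "y \<in> set xs" "y \<noteq> x" for y
        using eorth_act_zero[of y x] orth_listD(3)[OF xs y(1) x y(2)] y(1) xc c
        by (auto simp: eorth_def)
      then have "(\<lambda>y. y \<triangleleft> pp x) ` set xs \<subseteq> {pt X, x}" using c by auto (metis act_pmap)
      moreover have "x \<in> (\<lambda>y. y \<triangleleft> pp x) ` set xs" using x c by (metis act_pmap imageI)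
      ultimately show ?thesis by auto
    qed
    then have "same_join ((\<lambda>y. y \<triangleleft> pp x) ` set xs) (set [x])"
      by (rule same_join_zero(1)[OF orth_family_act[OF orth_list_family[OF xs] pc]])
    then have "sharp_class S X (map (\<lambda>y. y \<triangleleft> pp x) xs) = sharp_class S X [x]"
      using sharp_class_eq_iff[OF orth_list_act[OF xs pc] orth_list_single[OF c]] by simp
    then show ?thesis unfolding single[OF c] act_sharp[OF xs pc] by simp
  qed
  show ?thesis
    unfolding N.strong_join_def im pg
  proof (intro conjI ballI)
    show "(\<lambda>x. sharp_class S X [x]) ` set xs \<subseteq> carrier (sharp S X)"
      using xc orth_list_single carrier_sharp by blast
    show "sharp_class S X xs \<in> carrier (sharp S X)" using xs carrier_sharp by blast
    show "pairwise (eorth S (sharp S X)) ((\<lambda>x. sharp_class S X [x]) ` set xs)"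
    proof (rule pairwiseI, clarify)
      fix x y assume xy: "x \<in> set xs" "y \<in> set xs" "sharp_class S X [x] \<noteq> sharp_class S X [y]"
      then have "x \<noteq> y" by auto
      then show "eorth S (sharp S X) (sharp_class S X [x]) (sharp_class S X [y])"
        using orth_listD(3)[OF xs xy(1,2)] single xy(1,2) xc by (simp add: eorth_def subset_iff)
    qed
  qed (use g(1) le in auto)
qed

end

section \<open>The module generated by a principal right ideal\<close>

context orthogonally_complete
begin

lemma right_ideal_simps [simp]:
  "act (right_ideal S e) = (\<lambda>x s. x \<cdot> s)" "pmap (right_ideal S e) = (\<lambda>s. src s)"
  "pt (right_ideal S e) = \<^bold>0"
  by (auto simp: right_ideal_def)

lemma carrier_right_ideal: "e \<in> idems S \<Longrightarrow> x \<in> carrier (right_ideal S e) \<longleftrightarrow> x \<in> carrier S \<and> e \<cdot> x = x"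
  unfolding right_ideal_def by (auto intro: exI[of _ x])

lemma right_ideal_pointed_etale:
  assumes e: "e \<in> idems S"
  shows "pointed_etale S (right_ideal S e)"
proof unfold_locales
  note c = carrier_right_ideal[OF e]
  have ec: "e \<in> carrier S" using e by auto
  let ?R = "right_ideal S e"
  show closed: "act ?R x s \<in> carrier ?R" if "x \<in> carrier ?R" "s \<in> carrier S" for x s
    using that mult_assoc[of e x s] ec unfolding c by auto
  show "{act ?R x s | x s. x \<in> carrier ?R \<and> s \<in> carrier S} = carrier ?R"
  proof (intro equalityI subsetI)
    fix x assume x: "x \<in> carrier ?R"
    then have "x = act ?R x (src x)" "src x \<in> carrier S" unfolding c by auto
    then show "x \<in> {act ?R x s | x s. x \<in> carrier ?R \<and> s \<in> carrier S}" using x by blast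
  qed (use closed in blast)
  show "x = pt ?R" if "x \<in> carrier ?R" "pmap ?R x = \<^bold>0" for x
    using that src_eq_zero unfolding c by simp
qed (use e in \<open>auto simp: carrier_right_ideal mult_assoc\<close>)

text \<open>In a right ideal the separation axiom is left distributivity.\<close>

lemma right_ideal_orth_etale:
  assumes e: "e \<in> idems S"
  shows "orth_etale S (right_ideal S e)"
proof -
  interpret R: pointed_etale S "right_ideal S e" by (rule right_ideal_pointed_etale[OF e])
  show ?thesis
    by unfold_locales (use carrier_right_ideal[OF e] lub_mult_cong in simp)
qed

lemma sharp_right_ideal_module:
  assumes "e \<in> idems S"
  shows "oc_module S (sharp S (right_ideal S e))"
proof -
  interpret R: orth_etale S "right_ideal S e" by (rule right_ideal_orth_etale[OF assms])
  interpret N: etale_module S "sharp S (right_ideal S e)" by (rule R.sharp_module)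
  show ?thesis by unfold_locales
qed

text \<open>The class of \<open>e\<close> freely generates \<open>(eS)\<^sup>\<sharp>\<close>; its position \<open>i\<close> in the basis is arbitrary.\<close>

lemma sharp_right_ideal_basis:
  assumes e: "e \<in> idems S"
  shows "pointed_etale.is_basis S (sharp S (right_ideal S e))
      (\<lambda>k. if k = i then sharp_class S (right_ideal S e) [e] else pt (sharp S (right_ideal S e)))"
    and "pmap (sharp S (right_ideal S e)) (sharp_class S (right_ideal S e) [e]) = e"
proof -
  let ?R = "right_ideal S e" and ?N = "sharp S (right_ideal S e)"
  interpret R: orth_etale S ?R by (rule right_ideal_orth_etale[OF e])
  interpret N: oc_module S ?N by (rule sharp_right_ideal_module[OF e])
  note c = carrier_right_ideal[OF e]
  let ?b = "sharp_class S ?R [e]"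
  define m where "m k = (if k = i then ?b else pt ?N)" for k
  have eR: "e \<in> carrier ?R" using e c by auto
  note e1 = R.orth_list_single[OF eR]
  have bc: "?b \<in> carrier ?N" using R.carrier_sharp e1 by blast
  show pb: "pmap ?N ?b = e"
    by (rule R.pmap_sharp[OF e1]) (use e in \<open>auto intro: lub_singleton\<close>)
  have bs: "act ?N ?b s = sharp_class S ?R [e \<cdot> s]" if "s \<in> carrier S" for s
    using R.act_sharp[OF e1 that] by simp
  have free: "e \<cdot> s = e \<cdot> t" if s: "s \<in> carrier S" and t: "t \<in> carrier S" and eq: "act ?N ?b s = act ?N ?b t" for s t
  proof -
    have es: "e \<cdot> s \<in> carrier ?R" "e \<cdot> t \<in> carrier ?R" using R.act_closed[OF eR] s t by auto
    have sj: "R.same_join (set [e \<cdot> s]) (set [e \<cdot> t])"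
      using eq R.sharp_class_eq_iff[OF R.orth_list_single[OF es(1)] R.orth_list_single[OF es(2)]]
      unfolding bs[OF s] bs[OF t] by simp
    have "e \<cdot> s \<cdot> src (e \<cdot> t) = e \<cdot> t \<cdot> src (e \<cdot> s)"
      using R.same_joinD(1)[OF sj, of "e \<cdot> s" "e \<cdot> t"] by (simp del: sinv_mult)
    moreover have "src (e \<cdot> s) = src (e \<cdot> t)"
    proof -
      have ec: "e \<in> carrier S" using e by auto
      have 1: "lub {src (e \<cdot> s)} (src (e \<cdot> s))" "lub {src (e \<cdot> t)} (src (e \<cdot> t))"
        using s t ec by (auto intro!: lub_singleton simp del: sinv_mult)
      then have "lub {src (e \<cdot> t)} (src (e \<cdot> s))"
        using R.same_joinD(2)[OF sj, of "src (e \<cdot> s)"] by (simp del: sinv_mult)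
      then show ?thesis using 1(2) lub_unique by blast
    qed
    moreover have "e \<cdot> s \<cdot> src (e \<cdot> s) = e \<cdot> s" "e \<cdot> t \<cdot> src (e \<cdot> t) = e \<cdot> t"
      using cancel(1)[of "e \<cdot> s"] cancel(1)[of "e \<cdot> t"] e s t by auto
    ultimately show ?thesis by metis
  qed
  have zero: "e \<cdot> s = \<^bold>0" if "s \<in> carrier S" "act ?N ?b s = pt ?N" for s
    using free[of s "\<^bold>0"] that bc e by simp
  have "N.is_basis m"
    unfolding N.is_basis_def
  proof (intro conjI allI ballI impI)
    show "range m \<subseteq> carrier ?N" using bc by (auto simp: m_def)
    have "{k. m k \<noteq> pt ?N} \<subseteq> {i}" by (auto simp: m_def)
    then show "finite {k. m k \<noteq> pt ?N}" by (rule finite_subset) simp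
    fix k l s t assume s: "s \<in> carrier S" and t: "t \<in> carrier S" and eq: "act ?N (m k) s = act ?N (m l) t"
    show "N.pp (m k) \<cdot> s = N.pp (m l) \<cdot> t"
      using eq s t free[OF s t] zero[OF s] zero[OF t] pb by (auto simp: m_def split: if_splits)
    show "N.pp (m k) \<cdot> s = \<^bold>0" if "k \<noteq> l"
      using eq s t zero[OF s] pb that by (auto simp: m_def split: if_splits)
  next
    fix C assume "C \<in> carrier ?N"
    then obtain xs where xs: "orth_list S ?R xs" "C = sharp_class S ?R xs"
      using R.carrier_sharp by blast
    have "(\<lambda>x. sharp_class S ?R [x]) ` set xs \<subseteq> {act ?N (m k) s | k s. s \<in> carrier S}"
    proof clarify
      fix x assume "x \<in> set xs"
      then have "x \<in> carrier ?R" using R.orth_listD(2)[OF xs(1)] by blast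
      then have "x \<in> carrier S" "e \<cdot> x = x" using c by auto
      then have "sharp_class S ?R [x] = act ?N (m i) x" using bs[of x] by (simp add: m_def)
      then show "\<exists>k s. sharp_class S ?R [x] = act ?N (m k) s \<and> s \<in> carrier S"
        using \<open>x \<in> carrier S\<close> by blast
    qed
    then show "\<exists>A. N.strong_join A C \<and> A \<subseteq> {act ?N (m k) s | k s. s \<in> carrier S}"
      using R.sharp_strong_join[OF xs(1)] xs(2) by blast
  qed
  then show "N.is_basis (\<lambda>k. if k = i then ?b else pt ?N)" by (simp add: m_def[abs_def])
qed

end

section \<open>Orthogonal sums of modules\<close>

text \<open>The binary direct sum and the iterated one are both modules of orthogonal families; the
  projections \<open>\<pi>\<close> abstract from the representation of the families as pairs or lists.\<close>

locale orthogonal_sum = orthogonally_complete S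
  for S :: "('a, 'm) zsemigroup_scheme" (structure) +
  fixes I :: "'i set" and F :: "'i \<Rightarrow> ('x, 'a) etale" and Y :: "('y, 'a) etale"
    and \<pi> :: "'i \<Rightarrow> 'y \<Rightarrow> 'x"
  assumes finite_index: "finite I"
    and summand: "i \<in> I \<Longrightarrow> oc_module S (F i)"
    and proj_closed: "y \<in> carrier Y \<Longrightarrow> i \<in> I \<Longrightarrow> \<pi> i y \<in> carrier (F i)"
    and proj_orth: "y \<in> carrier Y \<Longrightarrow> i \<in> I \<Longrightarrow> j \<in> I \<Longrightarrow> i \<noteq> j \<Longrightarrow>
      pmap (F i) (\<pi> i y) \<cdot> pmap (F j) (\<pi> j y) = \<^bold>0"
    and family: "\<lbrakk>\<And>i. i \<in> I \<Longrightarrow> g i \<in> carrier (F i);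
      \<And>i j. i \<in> I \<Longrightarrow> j \<in> I \<Longrightarrow> i \<noteq> j \<Longrightarrow> pmap (F i) (g i) \<cdot> pmap (F j) (g j) = \<^bold>0\<rbrakk> \<Longrightarrow>
      \<exists>y\<in>carrier Y. \<forall>i\<in>I. \<pi> i y = g i"
    and proj_ext: "\<lbrakk>y \<in> carrier Y; z \<in> carrier Y; \<And>i. i \<in> I \<Longrightarrow> \<pi> i y = \<pi> i z\<rbrakk> \<Longrightarrow> y = z"
    and sum_act_closed: "y \<in> carrier Y \<Longrightarrow> s \<in> carrier S \<Longrightarrow> act Y y s \<in> carrier Y"
    and proj_act: "y \<in> carrier Y \<Longrightarrow> s \<in> carrier S \<Longrightarrow> i \<in> I \<Longrightarrow> \<pi> i (act Y y s) = act (F i) (\<pi> i y) s"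
    and sum_pmap: "y \<in> carrier Y \<Longrightarrow> pmap Y y = \<Squnion>\<^bsub>sord S\<^esub> ((\<lambda>i. pmap (F i) (\<pi> i y)) ` I)"
    and sum_pt: "pt Y \<in> carrier Y" "i \<in> I \<Longrightarrow> \<pi> i (pt Y) = pt (F i)"
begin

abbreviation q where "q i y \<equiv> pmap (F i) (\<pi> i y)"

lemma summand_etale: "i \<in> I \<Longrightarrow> pointed_etale S (F i)"
  using summand oc_module_def etale_module_def by blast

lemma q_idem: "y \<in> carrier Y \<Longrightarrow> i \<in> I \<Longrightarrow> q i y \<in> idems S"
  using pointed_etale.pmap_idem[OF summand_etale] proj_closed by blast

lemma q_orth_set:
  assumes "y \<in> carrier Y"
  shows "orth_set ((\<lambda>i. q i y) ` I)"
proof (rule orth_set_idemI)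
  fix e f assume "e \<in> (\<lambda>i. q i y) ` I" "f \<in> (\<lambda>i. q i y) ` I" "e \<noteq> f"
  then obtain i j where "i \<in> I" "j \<in> I" "e = q i y" "f = q j y" "i \<noteq> j" by blast
  then show "e \<cdot> f = \<^bold>0" using proj_orth[OF assms] by blast
qed (use finite_index q_idem[OF assms] in auto)

lemma q_lub: "y \<in> carrier Y \<Longrightarrow> lub ((\<lambda>i. q i y) ` I) (pmap Y y)"
  using lub_exists[OF q_orth_set] sup_eq sum_pmap by metis

lemma sum_pmap_idem: "y \<in> carrier Y \<Longrightarrow> pmap Y y \<in> idems S"
  using lub_idem[OF q_orth_set q_lub] q_idem by blast

lemma q_le:
  assumes "y \<in> carrier Y" "i \<in> I"
  shows "pmap Y y \<cdot> q i y = q i y" "q i y \<cdot> pmap Y y = q i y"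
proof -
  have "q i y \<preceq> pmap Y y" by (rule lub_upper[OF q_lub]) (use assms q_idem in auto)
  then show 1: "pmap Y y \<cdot> q i y = q i y" using idem_le_iff q_idem sum_pmap_idem assms by blast
  show "q i y \<cdot> pmap Y y = q i y"
    using 1 idem_commute[OF q_idem sum_pmap_idem] assms by simp
qed

lemma proj_act_pmap:
  assumes "y \<in> carrier Y" "i \<in> I"
  shows "act (F i) (\<pi> i y) (pmap Y y) = \<pi> i y"
proof -
  interpret Fi: pointed_etale S "F i" by (rule summand_etale[OF assms(2)])
  have "act (F i) (\<pi> i y) (pmap Y y) = act (F i) (\<pi> i y) (q i y \<cdot> pmap Y y)"
    using Fi.act_pmap_mult[OF proj_closed[OF assms] idem_closed[OF sum_pmap_idem[OF assms(1)]]] by simp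
  then show ?thesis unfolding q_le(2)[OF assms] using Fi.act_pmap[OF proj_closed[OF assms]] by simp
qed

lemma sum_act_pmap: "y \<in> carrier Y \<Longrightarrow> act Y y (pmap Y y) = y"
  using sum_pmap_idem proj_act proj_act_pmap
  by (intro proj_ext sum_act_closed) auto

lemma sum_pointed_etale: "pointed_etale S Y"
proof unfold_locales
  show "act Y y s \<in> carrier Y" if "y \<in> carrier Y" "s \<in> carrier S" for y s
    by (rule sum_act_closed[OF that])
  show "act Y (act Y y s) t = act Y y (s \<cdot> t)" if y: "y \<in> carrier Y" and s: "s \<in> carrier S" and t: "t \<in> carrier S" for y s t
  proof (rule proj_ext)
    fix i assume i: "i \<in> I"
    interpret Fi: pointed_etale S "F i" by (rule summand_etale[OF i])
    show "\<pi> i (act Y (act Y y s) t) = \<pi> i (act Y y (s \<cdot> t))"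
      using proj_act[OF sum_act_closed[OF y s] t i] proj_act[OF y s i] proj_act[OF y mult_closed[OF s t] i]
        Fi.act_assoc[OF proj_closed[OF y i] s t] by simp
  qed (use y s t sum_act_closed in auto)
  show "{act Y y s | y s. y \<in> carrier Y \<and> s \<in> carrier S} = carrier Y"
  proof (intro equalityI subsetI)
    fix y assume y: "y \<in> carrier Y"
    then have "y = act Y y (pmap Y y)" "pmap Y y \<in> carrier S" using sum_act_pmap sum_pmap_idem by auto
    then show "y \<in> {act Y y s | y s. y \<in> carrier Y \<and> s \<in> carrier S}" using y by blast
  qed (use sum_act_closed in blast)
  show "pmap Y y \<in> idems S" if "y \<in> carrier Y" for y by (rule sum_pmap_idem[OF that])
  show "act Y y (pmap Y y) = y" if "y \<in> carrier Y" for y by (rule sum_act_pmap[OF that])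
  show "pmap Y (act Y y s) = s\<^sup>\<star> \<cdot> pmap Y y \<cdot> s" if y: "y \<in> carrier Y" and s: "s \<in> carrier S" for y s
  proof -
    have "lub ((\<lambda>h. h \<cdot> s) ` (\<cdot>) (s\<^sup>\<star>) ` (\<lambda>i. q i y) ` I) (s\<^sup>\<star> \<cdot> pmap Y y \<cdot> s)"
      using s by (intro lub_mult_right orth_set_mult_left lub_mult_left q_orth_set[OF y] q_lub[OF y]) auto
    moreover have "(\<lambda>h. h \<cdot> s) ` (\<cdot>) (s\<^sup>\<star>) ` (\<lambda>i. q i y) ` I = (\<lambda>i. q i (act Y y s)) ` I"
      unfolding image_image
    proof (rule image_cong[OF HOL.refl])
      fix i assume i: "i \<in> I"
      show "s\<^sup>\<star> \<cdot> q i y \<cdot> s = q i (act Y y s)"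
        using pointed_etale.pmap_act[OF summand_etale[OF i] proj_closed[OF y i] s] proj_act[OF y s i]
        by simp
    qed
    ultimately show ?thesis using q_lub[OF sum_act_closed[OF y s]] lub_unique by simp
  qed
  show "pt Y \<in> carrier Y" by (rule sum_pt(1))
  have z: "q i (pt Y) = \<^bold>0" if "i \<in> I" for i
    using sum_pt(2)[OF that] pointed_etale.pmap_pt[OF summand_etale[OF that]] by simp
  have "lub ((\<lambda>i. q i (pt Y)) ` I) \<^bold>0" by (rule lub_zeros) (use z in auto)
  then show "pmap Y (pt Y) = \<^bold>0" using q_lub[OF sum_pt(1)] lub_unique by blast
  show "y = pt Y" if y: "y \<in> carrier Y" and "pmap Y y = \<^bold>0" for y
  proof (rule proj_ext[OF y sum_pt(1)])
    fix i assume i: "i \<in> I"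
    have "q i y = \<^bold>0" using q_le(1)[OF y i] \<open>pmap Y y = \<^bold>0\<close> q_idem[OF y i] by simp
    then show "\<pi> i y = \<pi> i (pt Y)"
      using pointed_etale.pmap_eq_zero[OF summand_etale[OF i] proj_closed[OF y i]] sum_pt(2)[OF i] by simp
  qed
  show "act Y (pt Y) s = pt Y" if s: "s \<in> carrier S" for s
  proof (rule proj_ext[OF sum_act_closed[OF sum_pt(1) s] sum_pt(1)])
    fix i assume i: "i \<in> I"
    show "\<pi> i (act Y (pt Y) s) = \<pi> i (pt Y)"
      using proj_act[OF sum_pt(1) s i] sum_pt(2)[OF i] pointed_etale.act_pt[OF summand_etale[OF i] s] by simp
  qed
  show "act Y y \<^bold>0 = pt Y" if y: "y \<in> carrier Y" for y
  proof (rule proj_ext[OF sum_act_closed[OF y zero_closed] sum_pt(1)])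
    fix i assume i: "i \<in> I"
    show "\<pi> i (act Y y \<^bold>0) = \<pi> i (pt Y)"
      using proj_act[OF y zero_closed i] sum_pt(2)[OF i]
        pointed_etale.act_zero[OF summand_etale[OF i] proj_closed[OF y i]] by simp
  qed
qed

lemma sum_orth_etale: "orth_etale S Y"
proof -
  interpret Y: pointed_etale S Y by (rule sum_pointed_etale)
  show ?thesis
  proof unfold_locales
    fix E g u v assume E: "orth_set E" "E \<subseteq> idems S" "lub E g" and u: "u \<in> carrier Y" and v: "v \<in> carrier Y"
      and uv: "\<And>f. f \<in> E \<Longrightarrow> act Y u f = act Y v f"
    have g: "g \<in> carrier S" by (rule lub_closed[OF E(3)])
    show "act Y u g = act Y v g"
    proof (rule proj_ext[OF sum_act_closed[OF u g] sum_act_closed[OF v g]])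
      fix i assume i: "i \<in> I"
      interpret Fi: oc_module S "F i" by (rule summand[OF i])
      have "act (F i) (\<pi> i u) g = act (F i) (\<pi> i v) g"
      proof (rule Fi.act_lub_cong[OF E proj_closed[OF u i] proj_closed[OF v i]])
        fix f assume f: "f \<in> E"
        then have fc: "f \<in> carrier S" using E(2) by auto
        show "act (F i) (\<pi> i u) f = act (F i) (\<pi> i v) f"
          using uv[OF f] proj_act[OF u fc i] proj_act[OF v fc i] by simp
      qed
      then show "\<pi> i (act Y u g) = \<pi> i (act Y v g)"
        using proj_act[OF u g i] proj_act[OF v g i] by simp
    qed
  qed
qed

end

sublocale orthogonal_sum \<subseteq> Y: orth_etale S Y
  by (rule sum_orth_etale)

context orthogonal_sum
begin

lemma cross_zero:
  assumes x: "x \<in> carrier Y" and y: "y \<in> carrier Y" and xy: "pmap Y x \<cdot> pmap Y y = \<^bold>0"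
    and i: "i \<in> I" and j: "j \<in> I"
  shows "q i x \<cdot> q j y = \<^bold>0" "q i x \<cdot> pmap Y y = \<^bold>0"
proof -
  note c = q_idem[OF x i] q_idem[OF y j] sum_pmap_idem[OF x] sum_pmap_idem[OF y]
  have "q i x \<cdot> pmap Y y = q i x \<cdot> pmap Y x \<cdot> pmap Y y" using q_le(2)[OF x i] by simp
  then show 1: "q i x \<cdot> pmap Y y = \<^bold>0" using c xy by (simp add: mult_assoc)
  have "q i x \<cdot> q j y = q i x \<cdot> (pmap Y y \<cdot> q j y)" using q_le(1)[OF y j] by simp
  also have "\<dots> = q i x \<cdot> pmap Y y \<cdot> q j y" using c by (simp add: mult_assoc)
  finally show "q i x \<cdot> q j y = \<^bold>0" using 1 c by simp
qed

text \<open>The join is formed in each summand. The components of the result are orthogonal because all four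
  kinds of products of components of \<open>x\<close> and \<open>y\<close> vanish; restricting it to \<open>p x\<close> removes the
  components of \<open>y\<close>.\<close>

lemma sum_join:
  assumes x: "x \<in> carrier Y" and y: "y \<in> carrier Y" and xy: "eorth S Y x y"
  shows "\<exists>z. Y.strong_join {x, y} z"
proof -
  have o: "pmap Y x \<cdot> pmap Y y = \<^bold>0" using xy by (simp add: eorth_def)
  have o': "pmap Y y \<cdot> pmap Y x = \<^bold>0"
    using o idem_commute[OF sum_pmap_idem[OF y] sum_pmap_idem[OF x]] by simp
  have "\<exists>w. pointed_etale.strong_join S (F i) {\<pi> i x, \<pi> i y} w" if i: "i \<in> I" for i
  proof -
    interpret Fi: oc_module S "F i" by (rule summand[OF i])
    show ?thesis
      using Fi.strong_join_pair_exists[OF proj_closed[OF x i] proj_closed[OF y i]]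
        cross_zero(1)[OF x y o i i] by (auto simp: eorth_def)
  qed
  then obtain w where w: "\<And>i. i \<in> I \<Longrightarrow> pointed_etale.strong_join S (F i) {\<pi> i x, \<pi> i y} (w i)"
    by metis
  have wc: "w i \<in> carrier (F i)" if "i \<in> I" for i
    using pointed_etale.strong_joinD(3)[OF summand_etale[OF that] w[OF that]] .
  have wl: "lub {q i x, q i y} (pmap (F i) (w i))" if "i \<in> I" for i
    using pointed_etale.strong_joinD(5)[OF summand_etale[OF that] w[OF that]] by simp
  have wi: "pmap (F i) (w i) \<in> idems S" if "i \<in> I" for i
    using pointed_etale.pmap_idem[OF summand_etale[OF that] wc[OF that]] .
  have wo: "orth_set {q i x, q i y}" if "i \<in> I" for i
    using cross_zero(1)[OF x y o that that] cross_zero(1)[OF y x o' that that] q_idem[OF x that] q_idem[OF y that]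
    by (intro orth_set_idemI) auto
  have ww: "pmap (F i) (w i) \<cdot> pmap (F j) (w j) = \<^bold>0" if ij: "i \<in> I" "j \<in> I" "i \<noteq> j" for i j
  proof (rule lub_mult_left_zero[OF wo[OF ij(2)] wl[OF ij(2)]])
    fix b assume "b \<in> {q j x, q j y}"
    then have b: "b \<in> carrier S" "q i x \<cdot> b = \<^bold>0" "q i y \<cdot> b = \<^bold>0"
      using cross_zero(1)[OF x y o ij(1,2)] cross_zero(1)[OF y x o' ij(1,2)] proj_orth[OF x ij] proj_orth[OF y ij]
        q_idem[OF x ij(2)] q_idem[OF y ij(2)] by auto
    show "pmap (F i) (w i) \<cdot> b = \<^bold>0"
      by (rule lub_mult_right_zero[OF wo[OF ij(1)] wl[OF ij(1)] b(1)]) (use b in auto)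
  qed (use wi ij in auto)
  obtain z where z: "z \<in> carrier Y" "\<And>i. i \<in> I \<Longrightarrow> \<pi> i z = w i"
    using family[of w, OF wc ww] by blast
  have le: "u = act Y z (pmap Y u)"
    if u: "u \<in> carrier Y" and v: "v \<in> carrier Y" and uv: "pmap Y u \<cdot> pmap Y v = \<^bold>0" "{u, v} = {x, y}" for u v
  proof (rule proj_ext[OF u])
    have uc: "pmap Y u \<in> carrier S" using sum_pmap_idem[OF u] by auto
    have vu: "pmap Y v \<cdot> pmap Y u = \<^bold>0"
      using uv(1) idem_commute[OF sum_pmap_idem[OF v] sum_pmap_idem[OF u]] by simp
    show "act Y z (pmap Y u) \<in> carrier Y" by (rule sum_act_closed[OF z(1) uc])
    fix i assume i: "i \<in> I"
    interpret Fi: oc_module S "F i" by (rule summand[OF i])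
    have "act (F i) (\<pi> i v) (pmap Y u) = act (F i) (\<pi> i v) (q i v \<cdot> pmap Y u)"
      using Fi.act_pmap_mult[OF proj_closed[OF v i] uc] by simp
    then have "act (F i) (\<pi> i v) (pmap Y u) = pt (F i)"
      unfolding cross_zero(2)[OF v u vu i i] using proj_closed[OF v i] by simp
    moreover have "{\<pi> i x, \<pi> i y} = {\<pi> i u, \<pi> i v}"
    proof -
      have "\<pi> i ` {x, y} = \<pi> i ` {u, v}" using uv(2) by simp
      then show ?thesis by simp
    qed
    ultimately have "Fi.strong_join {\<pi> i u, pt (F i)} (act (F i) (w i) (pmap Y u))"
      using Fi.strong_join_act[OF w[OF i] uc] proj_act_pmap[OF u i] by simp
    moreover have "Fi.strong_join {\<pi> i u, pt (F i)} (\<pi> i u)"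
      by (rule Fi.strong_join_cong_zero[OF Fi.strong_join_singleton[OF proj_closed[OF u i]]]) auto
    ultimately show "\<pi> i u = \<pi> i (act Y z (pmap Y u))"
      using Fi.strong_join_unique proj_act[OF z(1) uc i] z(2)[OF i] by simp
  qed
  have "lub {pmap Y x, pmap Y y} (pmap Y z)"
  proof -
    have "lub (\<Union>i\<in>I. {q i x, q i y}) (pmap Y z) \<longleftrightarrow> lub ((\<lambda>i. q i z) ` I) (pmap Y z)"
      by (rule lub_UN) (use wl z(2) q_idem[OF x] q_idem[OF y] in auto)
    then have "lub (\<Union>i\<in>I. {q i x, q i y}) (pmap Y z)" using q_lub[OF z(1)] by simp
    moreover have "(\<Union>i\<in>I. {q i x, q i y}) = (\<Union>v\<in>{x, y}. (\<lambda>i. q i v) ` I)" by auto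
    moreover have "lub (\<Union>v\<in>{x, y}. (\<lambda>i. q i v) ` I) (pmap Y z) \<longleftrightarrow> lub (pmap Y ` {x, y}) (pmap Y z)"
      by (rule lub_UN) (use q_lub q_idem x y in auto)
    ultimately show ?thesis by simp
  qed
  moreover have "x = act Y z (pmap Y x)" by (rule le[OF x y o]) simp
  moreover have "y = act Y z (pmap Y y)" by (rule le[OF y x o']) auto
  ultimately have "Y.strong_join {x, y} z"
    unfolding Y.strong_join_def
    using x y z(1) xy Y.eorth_sym[OF x y xy] by (auto simp: pairwise_def)
  then show ?thesis by blast
qed

theorem sum_module: "oc_module S Y"
proof -
  interpret M: etale_module S Y by (rule Y.etale_moduleI) (rule sum_join)
  show ?thesis by unfold_locales
qed

text \<open>If the bases of the summands are orthogonal to each other at each index, the families that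
  they form at each index are a basis of the sum: an element of the sum splits, through its
  components, into multiples of members of a single summand.\<close>

theorem sum_basis:
  assumes b: "\<And>i. i \<in> I \<Longrightarrow> pointed_etale.is_basis S (F i) (b i)"
    and borth: "\<And>i j k. i \<in> I \<Longrightarrow> j \<in> I \<Longrightarrow> i \<noteq> j \<Longrightarrow> pmap (F i) (b i k) \<cdot> pmap (F j) (b j k) = \<^bold>0"
  shows "\<exists>n. Y.is_basis n \<and> (\<forall>k. \<forall>i\<in>I. \<pi> i (n k) = b i k)"
proof -
  have bD: "b i k \<in> carrier (F i)" "finite {k. b i k \<noteq> pt (F i)}"
    "\<lbrakk>act (F i) (b i k) s = act (F i) (b i l) t; s \<in> carrier S; t \<in> carrier S\<rbrakk> \<Longrightarrow>
      pmap (F i) (b i k) \<cdot> s = pmap (F i) (b i l) \<cdot> t"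
    "\<lbrakk>act (F i) (b i k) s = act (F i) (b i l) t; k \<noteq> l; s \<in> carrier S; t \<in> carrier S\<rbrakk> \<Longrightarrow>
      pmap (F i) (b i k) \<cdot> s = \<^bold>0"
    "x \<in> carrier (F i) \<Longrightarrow> \<exists>A. pointed_etale.strong_join S (F i) A x \<and>
      A \<subseteq> {act (F i) (b i k) s | k s. s \<in> carrier S}"
    if i: "i \<in> I" for i k s l t x
    by (fact pointed_etale.is_basisD[OF summand_etale[OF i] b[OF i]])+
  have "\<exists>y\<in>carrier Y. \<forall>i\<in>I. \<pi> i y = b i k" for k
    by (rule family) (use bD(1) borth in auto)
  then obtain n where n: "\<And>k. n k \<in> carrier Y" "\<And>i k. i \<in> I \<Longrightarrow> \<pi> i (n k) = b i k" by metis
  have na: "\<pi> i (act Y (n k) s) = act (F i) (b i k) s" if "i \<in> I" "s \<in> carrier S" for i k s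
    using proj_act[OF n(1) that(2,1)] n(2)[OF that(1)] by simp
  have nl: "lub ((\<lambda>i. pmap (F i) (b i k) \<cdot> s) ` I) (pmap Y (n k) \<cdot> s)" if s: "s \<in> carrier S" for k s
  proof -
    have "lub ((\<lambda>h. h \<cdot> s) ` (\<lambda>i. q i (n k)) ` I) (pmap Y (n k) \<cdot> s)"
      by (rule lub_mult_right[OF q_orth_set[OF n(1)] q_lub[OF n(1)] s])
    moreover have "(\<lambda>h. h \<cdot> s) ` (\<lambda>i. q i (n k)) ` I = (\<lambda>i. pmap (F i) (b i k) \<cdot> s) ` I"
      unfolding image_image using n(2) by (intro image_cong) auto
    ultimately show ?thesis by simp
  qed
  have "Y.is_basis n"
    unfolding Y.is_basis_def
  proof (intro conjI allI ballI impI)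
    show "range n \<subseteq> carrier Y" using n(1) by blast
    have "n k = pt Y" if "\<forall>i\<in>I. b i k = pt (F i)" for k
      by (rule proj_ext[OF n(1) sum_pt(1)]) (use that n(2) sum_pt(2) in auto)
    then have "{k. n k \<noteq> pt Y} \<subseteq> (\<Union>i\<in>I. {k. b i k \<noteq> pt (F i)})" by blast
    then show "finite {k. n k \<noteq> pt Y}"
      by (rule finite_subset) (use finite_index bD(2) in blast)
  next
    fix k l s t assume s: "s \<in> carrier S" and t: "t \<in> carrier S" and eq: "act Y (n k) s = act Y (n l) t"
    have eqi: "act (F i) (b i k) s = act (F i) (b i l) t" if "i \<in> I" for i
      using eq na[OF that s, of k] na[OF that t, of l] by simp
    have "(\<lambda>i. pmap (F i) (b i k) \<cdot> s) ` I = (\<lambda>i. pmap (F i) (b i l) \<cdot> t) ` I"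
      using bD(3)[OF _ eqi s t] by (intro image_cong) auto
    then show "pmap Y (n k) \<cdot> s = pmap Y (n l) \<cdot> t"
      using nl[OF s, of k] nl[OF t, of l] lub_unique by simp
    show "pmap Y (n k) \<cdot> s = \<^bold>0" if kl: "k \<noteq> l"
    proof -
      have "lub ((\<lambda>i. pmap (F i) (b i k) \<cdot> s) ` I) \<^bold>0"
        by (rule lub_zeros) (use bD(4)[OF _ eqi kl s t] in auto)
      then show ?thesis using nl[OF s, of k] lub_unique by blast
    qed
  next
    fix y assume y: "y \<in> carrier Y"
    have "\<exists>A. pointed_etale.strong_join S (F i) A (\<pi> i y) \<and>
      A \<subseteq> {act (F i) (b i k) s | k s. s \<in> carrier S}" if "i \<in> I" for i
      by (rule bD(5)[OF that proj_closed[OF y that]])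
    then have "\<exists>A. \<forall>i\<in>I. pointed_etale.strong_join S (F i) (A i) (\<pi> i y) \<and>
      A i \<subseteq> {act (F i) (b i k) s | k s. s \<in> carrier S}"
      by (intro bchoice ballI)
    then obtain A where A: "\<And>i. i \<in> I \<Longrightarrow> pointed_etale.strong_join S (F i) (A i) (\<pi> i y)"
      "\<And>i. i \<in> I \<Longrightarrow> A i \<subseteq> {act (F i) (b i k) s | k s. s \<in> carrier S}" by blast
    have D: "finite (A i)" "A i \<subseteq> carrier (F i)" "a \<in> A i \<Longrightarrow> a = act (F i) (\<pi> i y) (pmap (F i) a)"
      "lub (pmap (F i) ` A i) (q i y)"
      "a \<in> A i \<Longrightarrow> c \<in> A i \<Longrightarrow> a \<noteq> c \<Longrightarrow> pmap (F i) a \<cdot> pmap (F i) c = \<^bold>0"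
      "pmap (F i) ` A i \<subseteq> idems S"
      if i: "i \<in> I" for i a c
      using pointed_etale.strong_joinD[OF summand_etale[OF i] A(1)[OF i]]
        pointed_etale.strong_join_pmap(2)[OF summand_etale[OF i] A(1)[OF i]] by blast+
    have Dq: "q i y \<cdot> pmap (F i) a = pmap (F i) a" if i: "i \<in> I" and a: "a \<in> A i" for i a
      by (rule pointed_etale.pmap_le_if_upper[OF summand_etale[OF i] proj_closed[OF y i] _ D(3)[OF i a]])
         (use D(2)[OF i] a in blast)
    define T where "T = (\<Union>i\<in>I. pmap (F i) ` A i)"
    have Ti: "T \<subseteq> idems S" unfolding T_def using D(6) by blast
    have across: "q j y \<cdot> pmap (F i) a = \<^bold>0" if "i \<in> I" "j \<in> I" "i \<noteq> j" "a \<in> A i" for i j a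
    proof -
      have ai: "pmap (F i) a \<in> idems S" using D(6)[OF that(1)] that(4) by blast
      have "q j y \<cdot> pmap (F i) a = q j y \<cdot> (q i y \<cdot> pmap (F i) a)" using Dq[OF that(1,4)] by simp
      also have "\<dots> = q j y \<cdot> q i y \<cdot> pmap (F i) a"
        using ai q_idem[OF y] that by (simp add: mult_assoc)
      also have "\<dots> = \<^bold>0" using proj_orth[OF y that(2,1)] that(3) ai by auto
      finally show ?thesis .
    qed
    have To: "orth_set T"
    proof (rule orth_set_idemI[OF _ Ti])
      show "finite T" unfolding T_def using finite_index D(1) by blast
      fix e f assume "e \<in> T" "f \<in> T" "e \<noteq> f"
      then obtain i j a c where ij: "i \<in> I" "j \<in> I" "a \<in> A i" "c \<in> A j"
        and e: "e = pmap (F i) a" and f: "f = pmap (F j) c" unfolding T_def by blast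
      show "e \<cdot> f = \<^bold>0"
      proof (cases "i = j")
        case True
        then show ?thesis using D(5)[OF ij(1,3)] ij(4) e f \<open>e \<noteq> f\<close> by auto
      next
        case False
        have ei: "e \<in> idems S" "f \<in> idems S" using D(6)[OF ij(1)] D(6)[OF ij(2)] ij e f by auto
        have "e \<cdot> f = f \<cdot> e" by (rule idem_commute[OF ei])
        also have "\<dots> = f \<cdot> (q j y \<cdot> e)"
          using Dq[OF ij(2,4)] f ei q_idem[OF y ij(2)] mult_assoc[of f "q j y" e] idem_commute[of f "q j y"] by simp
        also have "\<dots> = \<^bold>0" using across[OF ij(1,2) False ij(3)] e ei by simp
        finally show ?thesis .
      qed
    qed
    have Tl: "lub T (pmap Y y)"
    proof -
      have "lub T (pmap Y y) \<longleftrightarrow> lub ((\<lambda>i. q i y) ` I) (pmap Y y)"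
        unfolding T_def by (rule lub_UN) (use D(4,6) in blast)+
      then show ?thesis using q_lub[OF y] by simp
    qed
    have "Y.strong_join (act Y y ` T) y"
      using Y.strong_join_act_lub[OF To Tl y] sum_act_pmap[OF y] by simp
    moreover have "act Y y ` T \<subseteq> {act Y (n k) s | k s. s \<in> carrier S}"
    proof
      fix w assume "w \<in> act Y y ` T"
      then obtain i a where i: "i \<in> I" and a: "a \<in> A i" and w: "w = act Y y (pmap (F i) a)"
        unfolding T_def by blast
      interpret Fi: oc_module S "F i" by (rule summand[OF i])
      obtain k s where s: "s \<in> carrier S" and as: "a = act (F i) (b i k) s"
        using subsetD[OF A(2)[OF i] a] by blast
      have pa: "pmap (F i) a \<in> carrier S" using D(6)[OF i] a by auto
      let ?s = "pmap (F i) (b i k) \<cdot> s"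
      have pb: "pmap (F i) (b i k) \<in> idems S" using Fi.pmap_idem[OF bD(1)[OF i]] .
      have sc: "?s \<in> carrier S" using pb s by auto
      have "w = act Y (n k) ?s"
        unfolding w
      proof (rule proj_ext[OF sum_act_closed[OF y pa] sum_act_closed[OF n(1) sc]])
        fix j assume j: "j \<in> I"
        interpret Fj: oc_module S "F j" by (rule summand[OF j])
        have L: "\<pi> j (act Y y (pmap (F i) a)) = act (F j) (\<pi> j y) (pmap (F i) a)"
          by (rule proj_act[OF y pa j])
        have R: "\<pi> j (act Y (n k) ?s) = act (F j) (b j k) ?s" by (rule na[OF j sc])
        show "\<pi> j (act Y y (pmap (F i) a)) = \<pi> j (act Y (n k) ?s)"
        proof (cases "j = i")
          case True
          have "act (F i) (b i k) ?s = a" using Fi.act_pmap_mult[OF bD(1)[OF i] s] as by simp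
          moreover have "act (F i) (\<pi> i y) (pmap (F i) a) = a" using D(3)[OF i a] by simp
          ultimately show ?thesis unfolding L R unfolding True by simp
        next
          case False
          have "act (F j) (\<pi> j y) (pmap (F i) a) = act (F j) (\<pi> j y) (q j y \<cdot> pmap (F i) a)"
            using Fj.act_pmap_mult[OF proj_closed[OF y j] pa] by simp
          also have "\<dots> = pt (F j)"
            using across[OF i j _ a] False Fj.act_zero[OF proj_closed[OF y j]] by simp
          finally have 1: "act (F j) (\<pi> j y) (pmap (F i) a) = pt (F j)" .
          have bj: "b j k \<in> carrier (F j)" by (rule bD(1)[OF j])
          have "act (F j) (b j k) ?s = act (F j) (b j k) (pmap (F j) (b j k) \<cdot> ?s)"
            using Fj.act_pmap_mult[OF bj sc] by simp
          also have "pmap (F j) (b j k) \<cdot> ?s = pmap (F j) (b j k) \<cdot> pmap (F i) (b i k) \<cdot> s"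
            using Fj.pmap_idem[OF bj] pb s by (simp add: mult_assoc)
          also have "\<dots> = \<^bold>0" using borth[OF j i False] s by simp
          also have "act (F j) (b j k) \<^bold>0 = pt (F j)" by (rule Fj.act_zero[OF bj])
          finally show ?thesis unfolding L R 1 by simp
        qed
      qed
      then show "w \<in> {act Y (n k) s | k s. s \<in> carrier S}" using sc by blast
    qed
    ultimately show "\<exists>A. Y.strong_join A y \<and> A \<subseteq> {act Y (n k) s | k s. s \<in> carrier S}" by blast
  qed
  then show ?thesis using n(2) by blast
qed

end

lemma direct_sum_orthogonal_sum:
  assumes "oc_module S P" "oc_module S Q"
  shows "orthogonal_sum S UNIV (\<lambda>b. if b then P else Q) (direct_sum S P Q) (\<lambda>b. if b then fst else snd)"
proof -
  interpret P: oc_module S P by fact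
  interpret Q: oc_module S Q by fact
  have act: "P.pp (act P x s) \<cdot>\<^bsub>S\<^esub> Q.pp (act Q y s) = \<^bold>0\<^bsub>S\<^esub>"
    if "x \<in> carrier P" "y \<in> carrier Q" "P.pp x \<cdot>\<^bsub>S\<^esub> Q.pp y = \<^bold>0\<^bsub>S\<^esub>" "s \<in> carrier S" for x y s
    using P.src_orth_act[OF P.pmap_idem[OF that(1)] Q.pmap_idem[OF that(2)] that(3,4)] that(1,2,4)
    by (simp add: P.pmap_act_src Q.pmap_act_src)
  have com: "Q.pp y \<cdot>\<^bsub>S\<^esub> P.pp x = \<^bold>0\<^bsub>S\<^esub>"
    if "x \<in> carrier P" "y \<in> carrier Q" "P.pp x \<cdot>\<^bsub>S\<^esub> Q.pp y = \<^bold>0\<^bsub>S\<^esub>" for x y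
    using that P.idem_commute[of "Q.pp y" "P.pp x"] by simp
  show ?thesis
  proof (rule orthogonal_sum.intro[OF P.orthogonally_complete_axioms orthogonal_sum_axioms.intro], goal_cases)
    case (5 g)
    have "g True \<in> carrier P" "g False \<in> carrier Q" using 5(1)[of True] 5(1)[of False] by auto
    moreover have "P.pp (g True) \<cdot>\<^bsub>S\<^esub> Q.pp (g False) = \<^bold>0\<^bsub>S\<^esub>" using 5(2)[of True False] by simp
    ultimately show ?case
      by (intro bexI[of _ "(g True, g False)"]) (auto simp: direct_sum_def)
  next
    case (6 y z)
    then show ?case using 6(3)[of True] 6(3)[of False] by (simp add: prod_eq_iff)
  next
    case (9 y)
    have "(\<lambda>b. pmap (if b then P else Q) ((if b then fst else snd) y)) ` UNIV = {P.pp (fst y), Q.pp (snd y)}"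
      by (auto simp: UNIV_bool)
    then show ?case by (auto simp: direct_sum_def join_def split: prod.splits)
  qed (use assms act com in \<open>auto simp: direct_sum_def split: prod.splits if_splits\<close>)
qed

lemma direct_sum_list_orthogonal_sum:
  assumes "orthogonally_complete S" "\<And>X. X \<in> set Xs \<Longrightarrow> oc_module S X"
  shows "orthogonal_sum S {..<length Xs} ((!) Xs) (direct_sum_list S Xs) (\<lambda>i xs. xs ! i)"
proof -
  interpret orthogonally_complete S by fact
  have m: "oc_module S (Xs ! i)" if "i < length Xs" for i using assms(2) that by simp
  have e: "pointed_etale S (Xs ! i)" if "i < length Xs" for i
    using m[OF that] oc_module_def etale_module_def by blast
  show ?thesis
  proof (rule orthogonal_sum.intro[OF orthogonally_complete_axioms orthogonal_sum_axioms.intro], goal_cases)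
    case (5 g)
    then show ?case
      by (intro bexI[of _ "map g [0..<length Xs]"]) (auto simp: direct_sum_list_def)
  next
    case (6 y z)
    then show ?case by (intro nth_equalityI) (auto simp: direct_sum_list_def)
  next
    case (7 y s)
    have c: "length y = length Xs" "\<And>i. i < length Xs \<Longrightarrow> y ! i \<in> carrier (Xs ! i)"
      "\<And>i j. i < length Xs \<Longrightarrow> j < length Xs \<Longrightarrow> i \<noteq> j \<Longrightarrow>
        pmap (Xs ! i) (y ! i) \<cdot>\<^bsub>S\<^esub> pmap (Xs ! j) (y ! j) = \<^bold>0\<^bsub>S\<^esub>"
      using 7(1) by (auto simp: direct_sum_list_def)
    have "pmap (Xs ! i) (act (Xs ! i) (y ! i) s) \<cdot>\<^bsub>S\<^esub> pmap (Xs ! j) (act (Xs ! j) (y ! j) s) = \<^bold>0\<^bsub>S\<^esub>"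
      if ij: "i < length Xs" "j < length Xs" "i \<noteq> j" for i j
      using pointed_etale.pmap_act_src[OF e[OF ij(1)] c(2)[OF ij(1)] 7(2)]
        pointed_etale.pmap_act_src[OF e[OF ij(2)] c(2)[OF ij(2)] 7(2)]
        src_orth_act[OF pointed_etale.pmap_idem[OF e[OF ij(1)] c(2)[OF ij(1)]]
          pointed_etale.pmap_idem[OF e[OF ij(2)] c(2)[OF ij(2)]] c(3)[OF ij] 7(2)]
      by simp
    moreover have "act (Xs ! i) (y ! i) s \<in> carrier (Xs ! i)" if "i < length Xs" for i
      by (rule pointed_etale.act_closed[OF e[OF that] c(2)[OF that] 7(2)])
    ultimately show ?case using c(1) by (simp add: direct_sum_list_def)
  next
    case (9 y)
    have "{pmap (Xs ! i) (y ! i) | i. i < length Xs} = (\<lambda>i. pmap (Xs ! i) (y ! i)) ` {..<length Xs}"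
      by auto
    then show ?case by (simp add: direct_sum_list_def)
  next
    case 10
    have "pt (Xs ! i) \<in> carrier (Xs ! i)" "pmap (Xs ! i) (pt (Xs ! i)) = \<^bold>0\<^bsub>S\<^esub>" if "i < length Xs" for i
      using pointed_etale.pt_closed[OF e[OF that]] pointed_etale.pmap_pt[OF e[OF that]] by auto
    moreover have "pmap (Xs ! j) (pt (Xs ! j)) \<in> carrier S" if "j < length Xs" for j
      using pointed_etale.pmap_pt[OF e[OF that]] by simp
    ultimately show ?case by (simp add: direct_sum_list_def)
  qed (use m in \<open>auto simp: direct_sum_list_def\<close>)
qed

section \<open>Idempotent matrices of projective modules\<close>

context orth_etale
begin

lemma act_eq_pt:
  assumes "x \<in> carrier X" "s \<in> carrier S" "x \<triangleleft> s = pt X"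
  shows "pp x \<cdot> s = \<^bold>0"
proof -
  have "src (pp x \<cdot> s) = \<^bold>0" using pmap_act_src[OF assms(1,2)] assms(3) by simp
  from src_eq_zero[OF _ this] show ?thesis using assms(1,2) by simp
qed

lemma basis_reindex:
  assumes m: "is_basis m" and \<rho>: "inj \<rho>"
  shows "is_basis (\<lambda>k. if k \<in> range \<rho> then m (inv_into UNIV \<rho> k) else pt X)" (is "is_basis ?n")
  unfolding is_basis_def
proof (intro conjI allI ballI impI)
  note M = is_basisD[OF m]
  show "range ?n \<subseteq> carrier X" using M(1) by auto
  have n: "?n (\<rho> i) = m i" for i using \<rho> by simp
  have "{k. ?n k \<noteq> pt X} \<subseteq> \<rho> ` {i. m i \<noteq> pt X}" using n by auto
  then show "finite {k. ?n k \<noteq> pt X}" by (rule finite_subset) (use M(2) in blast)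
  fix k l s t assume s: "s \<in> carrier S" and t: "t \<in> carrier S" and eq: "?n k \<triangleleft> s = ?n l \<triangleleft> t"
  have nc: "?n k \<in> carrier X" for k using M(1) by auto
  have "pp (?n k) \<cdot> s = pp (?n l) \<cdot> t \<and> (k \<noteq> l \<longrightarrow> pp (?n k) \<cdot> s = \<^bold>0)"
  proof (cases "k \<in> range \<rho> \<and> l \<in> range \<rho>")
    case True
    then obtain i j where ij: "k = \<rho> i" "l = \<rho> j" by blast
    have eq': "m i \<triangleleft> s = m j \<triangleleft> t" using eq unfolding ij n .
    have "k \<noteq> l \<longleftrightarrow> i \<noteq> j" using ij \<rho> by (auto dest: injD)
    then show ?thesis unfolding ij n using M(3)[OF eq' s t] M(4)[OF eq' _ s t] ij by blast
  next
    case False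
    then have "?n k = pt X \<or> ?n l = pt X" by auto
    then have "?n k \<triangleleft> s = pt X" "?n l \<triangleleft> t = pt X" using eq s t by auto
    then have "pp (?n k) \<cdot> s = \<^bold>0" "pp (?n l) \<cdot> t = \<^bold>0"
      using act_eq_pt[OF nc s, of k] act_eq_pt[OF nc t, of l] by simp_all
    then show ?thesis by simp
  qed
  then show "pp (?n k) \<cdot> s = pp (?n l) \<cdot> t" "k \<noteq> l \<Longrightarrow> pp (?n k) \<cdot> s = \<^bold>0" by blast+
next
  fix x assume "x \<in> carrier X"
  then obtain A where A: "strong_join A x" "A \<subseteq> {m i \<triangleleft> s | i s. s \<in> carrier S}"
    using is_basisD(5)[OF m] by blast
  have n: "?n (\<rho> i) = m i" for i using \<rho> by simp
  have "{m i \<triangleleft> s | i s. s \<in> carrier S} \<subseteq> {?n k \<triangleleft> s | k s. s \<in> carrier S}"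
  proof
    fix a assume "a \<in> {m i \<triangleleft> s | i s. s \<in> carrier S}"
    then obtain i s where "s \<in> carrier S" "a = ?n (\<rho> i) \<triangleleft> s" unfolding n by blast
    then show "a \<in> {?n k \<triangleleft> s | k s. s \<in> carrier S}" by blast
  qed
  then show "\<exists>A. strong_join A x \<and> A \<subseteq> {?n k \<triangleleft> s | k s. s \<in> carrier S}"
    using A by (meson order_trans)
qed

lemma basis_idem_seq:
  assumes "is_basis m"
  shows "idem_seq (\<lambda>i. pp (m i))"
proof (rule idem_seqI)
  show "pp (m i) \<in> idems S" for i using is_basisD(1)[OF assms] by blast
  have "{i. pp (m i) \<noteq> \<^bold>0} \<subseteq> {i. m i \<noteq> pt X}" by auto
  then show "finite {i. pp (m i) \<noteq> \<^bold>0}" by (rule finite_subset) (rule is_basisD(2)[OF assms])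
qed

end

context orthogonally_complete
begin

text \<open>The isomorphism invariant of a module: the idempotent matrices of all its bases.\<close>

definition basis_idems :: "('x, 'a) etale \<Rightarrow> (nat \<Rightarrow> nat \<Rightarrow> 'a) set"
  where "basis_idems P = {diag (\<lambda>i. pmap P (m i)) | m. pointed_etale.is_basis S P m}"

text \<open>The two inclusions are the two directions of change of basis.\<close>

lemma basis_idems_D_class:
  assumes P: "oc_module S P" and E: "E \<in> basis_idems P"
  shows "E \<in> idems (Momega S)" "basis_idems P = D_rel (Momega S) `` {E}"
proof -
  interpret P: oc_module S P by fact
  obtain m where m: "P.is_basis m" "E = diag (\<lambda>i. P.pp (m i))"
    using E unfolding basis_idems_def by blast
  note em = P.basis_idem_seq[OF m(1)]
  show "E \<in> idems (Momega S)" unfolding m(2) by (rule diag_idem[OF em])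
  show "basis_idems P = D_rel (Momega S) `` {E}"
  proof (intro equalityI subsetI)
    fix F' assume "F' \<in> basis_idems P"
    then obtain n where n: "P.is_basis n" "F' = diag (\<lambda>i. P.pp (n i))"
      unfolding basis_idems_def by blast
    have "(E, F') \<in> D_rel (Momega S)"
      unfolding m(2) n(2) D_rel_Momega_iff[OF P.basis_idem_seq[OF n(1)] em]
      by (rule P.bases_intertwine[OF n(1) m(1)])
    then show "F' \<in> D_rel (Momega S) `` {E}" by blast
  next
    fix F' assume "F' \<in> D_rel (Momega S) `` {E}"
    then have EF: "(E, F') \<in> D_rel (Momega S)" by blast
    then have "F' \<in> idems (Momega S)" unfolding D_rel_def by blast
    then obtain f where f: "idem_seq f" "F' = diag f" unfolding idems_Momega by blast
    obtain a where "intertwines f (\<lambda>i. P.pp (m i)) a"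
      using EF unfolding m(2) f(2) D_rel_Momega_iff[OF f(1) em] by blast
    from P.basis_from_intertwining[OF m(1) intertwines_sinv[OF this]]
    obtain n where "P.is_basis n" "\<forall>j. P.pp (n j) = f j" by blast
    then show "F' \<in> basis_idems P" unfolding f(2) basis_idems_def by (intro CollectI exI[of _ n]) simp
  qed
qed

lemma module_iso_basis_idems_subset:
  assumes P: "oc_module S P" and Q: "oc_module S Q" and iso: "module_iso S P Q"
  shows "basis_idems P \<subseteq> basis_idems Q"
proof
  interpret P: oc_module S P by fact
  interpret Q: oc_module S Q by fact
  fix E assume "E \<in> basis_idems P"
  then obtain m where m: "P.is_basis m" "E = diag (\<lambda>i. P.pp (m i))" unfolding basis_idems_def by blast
  obtain n where n: "Q.is_basis n" "\<forall>i. Q.pp (n i) = P.pp (m i)"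
    using module_iso_basis[OF P.pointed_etale_axioms Q.pointed_etale_axioms iso m(1)] by blast
  then show "E \<in> basis_idems Q" unfolding basis_idems_def m(2) by (intro CollectI exI[of _ n]) simp
qed

lemma module_iso_basis_idems:
  assumes "oc_module S P" "oc_module S Q" "module_iso S P Q"
  shows "basis_idems P = basis_idems Q"
  using module_iso_basis_idems_subset[OF assms]
    module_iso_basis_idems_subset[OF assms(2,1) module_iso_sym[OF assms(3)]] by (rule equalityI)

lemma common_basis_idem_iso:
  assumes P: "oc_module S P" and Q: "oc_module S Q" and E: "E \<in> basis_idems P" "E \<in> basis_idems Q"
  shows "module_iso S P Q"
proof -
  interpret P: oc_module S P by fact
  interpret Q: oc_module S Q by fact
  obtain m where m: "P.is_basis m" "E = diag (\<lambda>i. P.pp (m i))" using E(1) unfolding basis_idems_def by blast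
  obtain n where n: "Q.is_basis n" "E = diag (\<lambda>i. Q.pp (n i))" using E(2) unfolding basis_idems_def by blast
  have "(\<lambda>i. Q.pp (n i)) = (\<lambda>i. P.pp (m i))" by (rule diag_inject) (use m(2) n(2) in simp)
  then have "Q.pp (n i) = P.pp (m i)" for i by (rule fun_cong)
  then interpret basis_pair S P Q m n by unfold_locales (use m n in auto)
  show ?thesis by (rule iso_if_same_basis_idempotents)
qed

lemma direct_sum_module:
  fixes P Q :: "('x, 'a) etale"
  shows "oc_module S P \<Longrightarrow> oc_module S Q \<Longrightarrow> oc_module S (direct_sum S P Q)"
  by (rule orthogonal_sum.sum_module[OF direct_sum_orthogonal_sum])

text \<open>Orthogonality of the two matrices means that \<open>m k\<close> and \<open>n k\<close> are orthogonal for every \<open>k\<close>, so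
  that \<open>(m k, n k)\<close> is an element of the sum.\<close>

lemma basis_idems_direct_sum:
  fixes P Q :: "('x, 'a) etale"
  assumes P: "oc_module S P" and Q: "oc_module S Q"
    and E: "E \<in> basis_idems P" and F: "F \<in> basis_idems Q" and EF: "sorth (Momega S) E F"
  shows "E \<squnion>\<^bsub>sord (Momega S)\<^esub> F \<in> basis_idems (direct_sum S P Q)"
proof -
  interpret P: oc_module S P by fact
  interpret Q: oc_module S Q by fact
  interpret PQ: orthogonal_sum S UNIV "\<lambda>b. if b then P else Q" "direct_sum S P Q" "\<lambda>b. if b then fst else snd"
    by (rule direct_sum_orthogonal_sum[OF P Q])
  obtain m where m: "P.is_basis m" "E = diag (\<lambda>i. P.pp (m i))" using E unfolding basis_idems_def by blast
  obtain n where n: "Q.is_basis n" "F = diag (\<lambda>i. Q.pp (n i))" using F unfolding basis_idems_def by blast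
  note em = P.basis_idem_seq[OF m(1)] and fn = Q.basis_idem_seq[OF n(1)]
  have o: "P.pp (m i) \<cdot> Q.pp (n i) = \<^bold>0" for i
    using EF unfolding m(2) n(2) sorth_diag_iff[OF em fn] by blast
  have o': "Q.pp (n i) \<cdot> P.pp (m i) = \<^bold>0" for i
    using o[of i] idem_commute[OF idem_seqD(1)[OF fn] idem_seqD(1)[OF em], of i i] by simp
  have "\<exists>l. PQ.Y.is_basis l \<and>
    (\<forall>k. \<forall>b\<in>UNIV. (if b then fst else snd) (l k) = (if b then m else n) k)"
    by (rule PQ.sum_basis) (use m(1) n(1) o o' in auto)
  then obtain l where l: "PQ.Y.is_basis l"
    and lk: "\<And>k b. (if b then fst else snd) (l k) = (if b then m else n) k" by blast
  have lmn: "fst (l k) = m k" "snd (l k) = n k" for k using lk[of True k] lk[of False k] by auto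
  have g: "idem_seq (\<lambda>k. pmap (direct_sum S P Q) (l k))" by (rule PQ.Y.basis_idem_seq[OF l])
  have "pmap (direct_sum S P Q) (l k) = P.pp (m k) \<squnion>\<^bsub>sord S\<^esub> Q.pp (n k)" for k
    using lmn[of k] by (cases "l k") (simp add: direct_sum_def)
  then have "lub {P.pp (m k), Q.pp (n k)} (pmap (direct_sum S P Q) (l k))" for k
    using P.sup_idem_pair[OF idem_seqD(1)[OF em] idem_seqD(1)[OF fn] o] by simp
  from join_diag[OF em fn g o this]
  show ?thesis unfolding m(2) n(2) basis_idems_def using l by blast
qed

text \<open>One basis is spread over the even numbers, the other one over the odd numbers.\<close>

lemma orthogonal_basis_idems:
  assumes P: "oc_module S P" "basis_idems P \<noteq> {}" and Q: "oc_module S Q" "basis_idems Q \<noteq> {}"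
  obtains E F where "E \<in> basis_idems P" "F \<in> basis_idems Q" "sorth (Momega S) E F"
proof -
  interpret P: oc_module S P by fact
  interpret Q: oc_module S Q by fact
  obtain m where m: "P.is_basis m" using P(2) unfolding basis_idems_def by blast
  obtain n where n: "Q.is_basis n" using Q(2) unfolding basis_idems_def by blast
  have inj: "inj (\<lambda>i::nat. 2 * i)" "inj (\<lambda>i::nat. 2 * i + 1)" by (auto simp: inj_def)
  define m' where "m' k = (if k \<in> range (\<lambda>i. 2 * i) then m (inv_into UNIV (\<lambda>i. 2 * i) k) else pt P)" for k
  define n' where "n' k = (if k \<in> range (\<lambda>i. 2 * i + 1) then n (inv_into UNIV (\<lambda>i. 2 * i + 1) k) else pt Q)" for k
  have m': "P.is_basis m'" unfolding m'_def by (rule P.basis_reindex[OF m inj(1)])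
  have n': "Q.is_basis n'" unfolding n'_def by (rule Q.basis_reindex[OF n inj(2)])
  have "P.pp (m' k) \<cdot> Q.pp (n' k) = \<^bold>0" for k
  proof (cases "even k")
    case True
    then have "n' k = pt Q" by (auto simp: n'_def)
    then show ?thesis using idem_seqD(1)[OF P.basis_idem_seq[OF m'], of k] by simp
  next
    case False
    then have "m' k = pt P" by (auto simp: m'_def)
    then show ?thesis using idem_seqD(1)[OF Q.basis_idem_seq[OF n'], of k] by simp
  qed
  then have "sorth (Momega S) (diag (\<lambda>k. P.pp (m' k))) (diag (\<lambda>k. Q.pp (n' k)))"
    unfolding sorth_diag_iff[OF P.basis_idem_seq[OF m'] Q.basis_idem_seq[OF n']] by blast
  then show ?thesis using that m' n' unfolding basis_idems_def by blast
qed

text \<open>The basis element of the \<open>i\<close>-th summand is placed at index \<open>i\<close>, so that the bases of different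
  summands never meet.\<close>

lemma free_module_sum:
  assumes es: "set es \<subseteq> idems S"
  shows "oc_module S (direct_sum_list S (map (\<lambda>e. sharp S (right_ideal S e)) es))" (is "oc_module S ?Y")
    and "diag (\<lambda>k. if k < length es then es ! k else \<^bold>0)
      \<in> basis_idems (direct_sum_list S (map (\<lambda>e. sharp S (right_ideal S e)) es))"
proof -
  let ?Xs = "map (\<lambda>e. sharp S (right_ideal S e)) es"
  have mod: "oc_module S X" if "X \<in> set ?Xs" for X
    using that es sharp_right_ideal_module by auto
  interpret L: orthogonal_sum S "{..<length ?Xs}" "(!) ?Xs" ?Y "\<lambda>i xs. xs ! i"
    by (rule direct_sum_list_orthogonal_sum[OF orthogonally_complete_axioms mod])
  show "oc_module S ?Y" by (rule L.sum_module)
  define c where "c i = sharp_class S (right_ideal S (es ! i)) [es ! i]" for i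
  define b where "b i k = (if k = i then c i else pt (?Xs ! i))" for i k
  have ei: "es ! i \<in> idems S" if "i < length es" for i using that es by auto
  have bb: "pointed_etale.is_basis S (?Xs ! i) (b i)" if "i < length es" for i
  proof -
    have Xi: "?Xs ! i = sharp S (right_ideal S (es ! i))" using that by simp
    show ?thesis
      unfolding b_def[abs_def] c_def Xi by (rule sharp_right_ideal_basis(1)[OF ei[OF that]])
  qed
  have pc: "pmap (?Xs ! i) (c i) = es ! i" if "i < length es" for i
    using sharp_right_ideal_basis(2)[OF ei[OF that]] that by (simp add: c_def)
  have pz: "pmap (?Xs ! i) (pt (?Xs ! i)) = \<^bold>0" if "i < length es" for i
    using pointed_etale.pmap_pt[OF L.summand_etale] that by simp
  have pb: "pmap (?Xs ! i) (b i k) = (if k = i then es ! i else \<^bold>0)" if "i < length es" for i k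
    using pc[OF that] pz[OF that] by (simp add: b_def)
  have "\<exists>l. L.Y.is_basis l \<and> (\<forall>k. \<forall>i\<in>{..<length ?Xs}. l k ! i = b i k)"
  proof (rule L.sum_basis)
    show "pointed_etale.is_basis S (?Xs ! i) (b i)" if "i \<in> {..<length ?Xs}" for i using bb that by simp
    fix i j k assume "i \<in> {..<length ?Xs}" "j \<in> {..<length ?Xs}" and ij: "i \<noteq> j"
    then have "i < length es" "j < length es" by simp_all
    then show "pmap (?Xs ! i) (b i k) \<cdot> pmap (?Xs ! j) (b j k) = \<^bold>0"
      using pb ei ij by (simp del: nth_map)
  qed
  then obtain l where l: "L.Y.is_basis l" "\<And>k i. i < length es \<Longrightarrow> l k ! i = b i k" by auto
  have lc: "l k \<in> carrier ?Y" for k by (rule L.Y.is_basisD(1)[OF l(1)])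
  have "pmap ?Y (l k) = (if k < length es then es ! k else \<^bold>0)" for k
  proof -
    have q: "lub ((\<lambda>i. pmap (?Xs ! i) (l k ! i)) ` {..<length ?Xs}) (pmap ?Y (l k))" by (rule L.q_lub[OF lc])
    have "(\<lambda>i. pmap (?Xs ! i) (l k ! i)) ` {..<length ?Xs} = (\<lambda>i. if k = i then es ! i else \<^bold>0) ` {..<length es}"
      using l(2) pb by (intro image_cong) auto
    moreover have "lub ((\<lambda>i. if k = i then es ! i else \<^bold>0) ` {..<length es}) (if k < length es then es ! k else \<^bold>0)"
    proof (cases "k < length es")
      case True
      have "es ! k \<in> (\<lambda>i. if k = i then es ! i else \<^bold>0) ` {..<length es}"
        using True by (intro image_eqI[of _ _ k]) auto
      then have "lub ((\<lambda>i. if k = i then es ! i else \<^bold>0) ` {..<length es}) (es ! k)"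
        using ei[OF True] by (intro lub_singleton) auto
      then show ?thesis using True by simp
    next
      case False
      then have "(\<lambda>i. if k = i then es ! i else \<^bold>0) ` {..<length es} \<subseteq> {\<^bold>0}" by auto
      then show ?thesis using lub_zeros False by simp
    qed
    ultimately show ?thesis using q lub_unique by simp
  qed
  then show "diag (\<lambda>k. if k < length es then es ! k else \<^bold>0) \<in> basis_idems ?Y"
    unfolding basis_idems_def using l(1) by (intro CollectI exI[of _ l]) simp
qed

lemma Proj_module:
  assumes "P \<in> Proj S"
  shows "oc_module S P" "basis_idems P \<noteq> {}"
proof -
  obtain es where es: "set es \<subseteq> idems S" and m: "etale_module S P"
    and iso: "module_iso S P (direct_sum_list S (map (\<lambda>e. sharp S (right_ideal S e)) es))"
    using assms unfolding Proj_def by blast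
  interpret P: etale_module S P by (rule m)
  show o: "oc_module S P" by unfold_locales
  show "basis_idems P \<noteq> {}"
    using module_iso_basis_idems[OF o free_module_sum(1)[OF es] iso] free_module_sum(2)[OF es] by blast
qed

text \<open>The list of diagonal entries extends one step past the support, which makes it non-empty also
  for the zero matrix.\<close>

lemma idem_realised:
  assumes "E \<in> idems (Momega S)"
  obtains P where "P \<in> Proj S" "E \<in> basis_idems P"
proof -
  obtain d where d: "idem_seq d" "E = diag d" using assms unfolding idems_Momega by blast
  obtain N where N: "\<And>k. d k \<noteq> \<^bold>0 \<Longrightarrow> k < N"
    using idem_seqD(2)[OF d(1)] finite_nat_set_iff_bounded by auto
  let ?es = "map d [0..<Suc N]"
  let ?P = "direct_sum_list S (map (\<lambda>e. sharp S (right_ideal S e)) ?es)"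
  have es: "set ?es \<subseteq> idems S" using idem_seqD(1)[OF d(1)] by auto
  note o = free_module_sum(1)[OF es]
  have "(\<lambda>k. if k < length ?es then ?es ! k else \<^bold>0) = d"
  proof
    fix k
    have "d k = \<^bold>0" if "\<not> k < Suc N" using N[of k] that by (cases "d k = \<^bold>0") auto
    then show "(if k < length ?es then ?es ! k else \<^bold>0) = d k"
      by (cases "k < Suc N") (auto simp del: upt_Suc)
  qed
  then have "E \<in> basis_idems ?P" using free_module_sum(2)[OF es] d(2) by simp
  moreover have "?P \<in> Proj S"
  proof -
    have "etale_module S ?P" using o unfolding oc_module_def by blast
    moreover have "module_iso S ?P ?P"
      by (rule module_isoI[OF o o, of "\<lambda>x. x" "\<lambda>x. x"]) auto
    moreover have "?es \<noteq> []" by simp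
    ultimately show ?thesis unfolding Proj_def using es by blast
  qed
  ultimately show ?thesis using that by blast
qed

lemma iso_rel_class:
  assumes "P \<in> Proj S"
  shows "iso_rel S `` {P} = {Q \<in> Proj S. basis_idems Q = basis_idems P}"
proof -
  have "module_iso S P Q \<longleftrightarrow> basis_idems Q = basis_idems P" if "Q \<in> Proj S" for Q
    using module_iso_basis_idems[of P Q] common_basis_idem_iso[of P Q] Proj_module[OF assms] Proj_module[OF that]
    by blast
  then show ?thesis using assms unfolding iso_rel_def by blast
qed

definition class_idems :: "'a proj_module set \<Rightarrow> (nat \<Rightarrow> nat \<Rightarrow> 'a) set"
  where "class_idems C = (\<Union>P\<in>C. basis_idems P)"

lemma class_idems_class: "P \<in> Proj S \<Longrightarrow> class_idems (iso_rel S `` {P}) = basis_idems P"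
  unfolding class_idems_def iso_rel_class by blast

lemma carrier_proj_monoid: "carrier (proj_monoid S) = (\<lambda>P. iso_rel S `` {P}) ` Proj S"
  by (auto simp: proj_monoid_def quotient_def)

lemma bij_class_idems: "bij_betw class_idems (carrier (proj_monoid S)) (carrier (idem_monoid (Momega S)))"
  unfolding bij_betw_def
proof
  show "inj_on class_idems (carrier (proj_monoid S))"
  proof (rule inj_onI)
    fix C D assume CD: "C \<in> carrier (proj_monoid S)" "D \<in> carrier (proj_monoid S)"
      "class_idems C = class_idems D"
    obtain P Q where P: "P \<in> Proj S" "C = iso_rel S `` {P}" and Q: "Q \<in> Proj S" "D = iso_rel S `` {Q}"
      using CD(1,2) unfolding carrier_proj_monoid by blast
    have "basis_idems P = basis_idems Q"
      using CD(3) unfolding P(2) Q(2) class_idems_class[OF P(1)] class_idems_class[OF Q(1)] .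
    then show "C = D" unfolding P(2) Q(2) iso_rel_class[OF P(1)] iso_rel_class[OF Q(1)] by simp
  qed
  have "class_idems ` carrier (proj_monoid S) = basis_idems ` Proj S"
    unfolding carrier_proj_monoid image_image by (intro image_cong) (auto simp: class_idems_class)
  also have "\<dots> = (\<lambda>E. D_rel (Momega S) `` {E}) ` idems (Momega S)"
  proof (intro equalityI subsetI)
    fix C assume "C \<in> basis_idems ` Proj S"
    then obtain P where P: "P \<in> Proj S" "C = basis_idems P" by blast
    obtain E where "E \<in> basis_idems P" using Proj_module(2)[OF P(1)] by blast
    then show "C \<in> (\<lambda>E. D_rel (Momega S) `` {E}) ` idems (Momega S)"
      using basis_idems_D_class[OF Proj_module(1)[OF P(1)]] P(2) by blast
  next
    fix C assume "C \<in> (\<lambda>E. D_rel (Momega S) `` {E}) ` idems (Momega S)"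
    then obtain E where E: "E \<in> idems (Momega S)" "C = D_rel (Momega S) `` {E}" by blast
    obtain P where P: "P \<in> Proj S" "E \<in> basis_idems P" by (rule idem_realised[OF E(1)])
    then show "C \<in> basis_idems ` Proj S"
      using basis_idems_D_class(2)[OF Proj_module(1)[OF P(1)] P(2)] E(2) by blast
  qed
  also have "\<dots> = carrier (idem_monoid (Momega S))"
    by (auto simp: idem_monoid_def quotient_def)
  finally show "class_idems ` carrier (proj_monoid S) = carrier (idem_monoid (Momega S))" .
qed

text \<open>For any choice of orthogonal matrices in the two classes, their join is a matrix of the direct
  sum. Hence all the \<open>\<D>\<close>-classes that are united in the product on the right are the same one, and
  it is realised by a projective module \<open>R\<close>.\<close>

lemma class_idems_mult:
  assumes P: "P \<in> Proj S" and Q: "Q \<in> Proj S"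
  obtains R where "R \<in> Proj S"
    "iso_rel S `` {P} \<otimes>\<^bsub>proj_monoid S\<^esub> iso_rel S `` {Q} = iso_rel S `` {R}"
    "basis_idems P \<otimes>\<^bsub>idem_monoid (Momega S)\<^esub> basis_idems Q = basis_idems R"
proof -
  note p = Proj_module[OF P] and q = Proj_module[OF Q]
  obtain E F where EF: "E \<in> basis_idems P" "F \<in> basis_idems Q" "sorth (Momega S) E F"
    by (rule orthogonal_basis_idems[OF p q])
  let ?G = "E \<squnion>\<^bsub>sord (Momega S)\<^esub> F"
  note pq = direct_sum_module[OF p(1) q(1)]
  have G: "?G \<in> basis_idems (direct_sum S P Q)" by (rule basis_idems_direct_sum[OF p(1) q(1) EF])
  have Gi: "?G \<in> idems (Momega S)" by (rule basis_idems_D_class(1)[OF pq G])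
  obtain R where R: "R \<in> Proj S" "?G \<in> basis_idems R" by (rule idem_realised[OF Gi])
  note r = Proj_module[OF R(1)]
  have sum_idems: "basis_idems (direct_sum S P' Q') = basis_idems R"
    if "P' \<in> iso_rel S `` {P}" "Q' \<in> iso_rel S `` {Q}" for P' Q'
  proof -
    have P': "P' \<in> Proj S" "basis_idems P' = basis_idems P" and Q': "Q' \<in> Proj S" "basis_idems Q' = basis_idems Q"
      using that unfolding iso_rel_class[OF P] iso_rel_class[OF Q] by auto
    note m = Proj_module(1)[OF P'(1)] Proj_module(1)[OF Q'(1)]
    have "?G \<in> basis_idems (direct_sum S P' Q')"
      by (rule basis_idems_direct_sum[OF m]) (use EF P' Q' in auto)
    then show ?thesis
      using basis_idems_D_class(2)[OF direct_sum_module[OF m]] basis_idems_D_class(2)[OF r(1) R(2)] by blast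
  qed
  have mem: "P \<in> iso_rel S `` {P}" "Q \<in> iso_rel S `` {Q}"
    unfolding iso_rel_class[OF P] iso_rel_class[OF Q] using P Q by auto
  have iso: "module_iso S R' (direct_sum S P' Q') \<longleftrightarrow> basis_idems R' = basis_idems R"
    if R': "R' \<in> Proj S" and PQ: "P' \<in> iso_rel S `` {P}" "Q' \<in> iso_rel S `` {Q}" for R' P' Q'
  proof -
    have "P' \<in> Proj S" "Q' \<in> Proj S"
      using PQ unfolding iso_rel_class[OF P] iso_rel_class[OF Q] by auto
    then have m: "oc_module S (direct_sum S P' Q')" by (intro direct_sum_module Proj_module)
    show ?thesis
      using module_iso_basis_idems[OF Proj_module(1)[OF R'] m] common_basis_idem_iso[OF Proj_module(1)[OF R'] m]
        Proj_module(2)[OF R'] sum_idems[OF PQ] by blast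
  qed
  have "iso_rel S `` {P} \<otimes>\<^bsub>proj_monoid S\<^esub> iso_rel S `` {Q} =
      {R' \<in> Proj S. \<exists>P'\<in>iso_rel S `` {P}. \<exists>Q'\<in>iso_rel S `` {Q}. module_iso S R' (direct_sum S P' Q')}"
    by (simp add: proj_monoid_def)
  also have "\<dots> = iso_rel S `` {R}"
    unfolding iso_rel_class[OF R(1)] using iso mem by blast
  finally have 1: "iso_rel S `` {P} \<otimes>\<^bsub>proj_monoid S\<^esub> iso_rel S `` {Q} = iso_rel S `` {R}" .
  have D: "D_rel (Momega S) `` {E' \<squnion>\<^bsub>sord (Momega S)\<^esub> F'} = basis_idems R"
    if "E' \<in> basis_idems P" "F' \<in> basis_idems Q" "sorth (Momega S) E' F'" for E' F'
    using basis_idems_D_class(2)[OF pq basis_idems_direct_sum[OF p(1) q(1) that]] sum_idems[OF mem] by simp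
  have "basis_idems P \<otimes>\<^bsub>idem_monoid (Momega S)\<^esub> basis_idems Q =
      \<Union>{D_rel (Momega S) `` {e \<squnion>\<^bsub>sord (Momega S)\<^esub> f} | e f.
        e \<in> basis_idems P \<and> f \<in> basis_idems Q \<and> sorth (Momega S) e f}"
    by (simp add: idem_monoid_def)
  also have "{D_rel (Momega S) `` {e \<squnion>\<^bsub>sord (Momega S)\<^esub> f} | e f.
        e \<in> basis_idems P \<and> f \<in> basis_idems Q \<and> sorth (Momega S) e f} = {basis_idems R}"
  proof (intro equalityI subsetI)
    fix C assume "C \<in> {basis_idems R}"
    then have "C = D_rel (Momega S) `` {?G}" using D[OF EF] by simp
    then show "C \<in> {D_rel (Momega S) `` {e \<squnion>\<^bsub>sord (Momega S)\<^esub> f} | e f.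
        e \<in> basis_idems P \<and> f \<in> basis_idems Q \<and> sorth (Momega S) e f}" using EF by blast
  next
    fix C assume "C \<in> {D_rel (Momega S) `` {e \<squnion>\<^bsub>sord (Momega S)\<^esub> f} | e f.
        e \<in> basis_idems P \<and> f \<in> basis_idems Q \<and> sorth (Momega S) e f}"
    then obtain e f where "C = D_rel (Momega S) `` {e \<squnion>\<^bsub>sord (Momega S)\<^esub> f}"
      and "e \<in> basis_idems P" "f \<in> basis_idems Q" "sorth (Momega S) e f" by blast
    then show "C \<in> {basis_idems R}" using D by simp
  qed
  finally have 2: "basis_idems P \<otimes>\<^bsub>idem_monoid (Momega S)\<^esub> basis_idems Q = basis_idems R" by simp
  show ?thesis by (rule that[OF R(1) 1 2])
qed

end

section \<open>Grothendieck groups\<close>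

text \<open>The relation and the product of the Grothendieck group are defined from the operation of the
  monoid alone, so the bijection of pairs induced by \<open>h\<close> carries one group to the other by taking
  images of classes.\<close>

lemma grothendieck_group_iso:
  assumes bij: "bij_betw h (carrier M) (carrier N)"
    and closed: "\<And>x y. x \<in> carrier M \<Longrightarrow> y \<in> carrier M \<Longrightarrow> x \<otimes>\<^bsub>M\<^esub> y \<in> carrier M"
    and hom: "\<And>x y. x \<in> carrier M \<Longrightarrow> y \<in> carrier M \<Longrightarrow> h (x \<otimes>\<^bsub>M\<^esub> y) = h x \<otimes>\<^bsub>N\<^esub> h y"
  shows "grothendieck_group M \<cong> grothendieck_group N"
proof -
  let ?C = "carrier M \<times> carrier M" and ?D = "carrier N \<times> carrier N"
  define hh where "hh = map_prod h h"
  define H where "H U = hh ` U" for U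
  have hinj: "inj_on h (carrier M)" and him: "h ` carrier M = carrier N"
    using bij by (auto simp: bij_betw_def)
  have hD: "x \<in> carrier M \<Longrightarrow> h x \<in> carrier N" for x using him by blast
  have hhinj: "inj_on hh ?C" using hinj by (auto simp: hh_def inj_on_def)
  have hhim: "hh ` ?C = ?D" unfolding hh_def by (force simp: him[symmetric])
  have relM: "groth_rel M `` {p} \<subseteq> ?C" for p by (auto simp: groth_rel_def)
  have rel: "(hh p, hh r) \<in> groth_rel N \<longleftrightarrow> (p, r) \<in> groth_rel M" if "p \<in> ?C" "r \<in> ?C" for p r
  proof -
    obtain a b c d where pr: "p = (a, b)" "r = (c, d)" by (metis surj_pair)
    have m: "a \<in> carrier M" "b \<in> carrier M" "c \<in> carrier M" "d \<in> carrier M" using that pr by auto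
    have eq: "h a \<otimes>\<^bsub>N\<^esub> h d \<otimes>\<^bsub>N\<^esub> h k = h c \<otimes>\<^bsub>N\<^esub> h b \<otimes>\<^bsub>N\<^esub> h k \<longleftrightarrow>
      a \<otimes>\<^bsub>M\<^esub> d \<otimes>\<^bsub>M\<^esub> k = c \<otimes>\<^bsub>M\<^esub> b \<otimes>\<^bsub>M\<^esub> k" if k: "k \<in> carrier M" for k
    proof -
      have "h a \<otimes>\<^bsub>N\<^esub> h d \<otimes>\<^bsub>N\<^esub> h k = h (a \<otimes>\<^bsub>M\<^esub> d \<otimes>\<^bsub>M\<^esub> k)"
        "h c \<otimes>\<^bsub>N\<^esub> h b \<otimes>\<^bsub>N\<^esub> h k = h (c \<otimes>\<^bsub>M\<^esub> b \<otimes>\<^bsub>M\<^esub> k)"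
        using m k closed hom by simp_all
      then show ?thesis using inj_on_eq_iff[OF hinj] m k closed by simp
    qed
    have "(\<exists>k\<in>carrier N. h a \<otimes>\<^bsub>N\<^esub> h d \<otimes>\<^bsub>N\<^esub> k = h c \<otimes>\<^bsub>N\<^esub> h b \<otimes>\<^bsub>N\<^esub> k) \<longleftrightarrow>
      (\<exists>k\<in>carrier M. a \<otimes>\<^bsub>M\<^esub> d \<otimes>\<^bsub>M\<^esub> k = c \<otimes>\<^bsub>M\<^esub> b \<otimes>\<^bsub>M\<^esub> k)"
      unfolding him[symmetric] using eq by auto
    then show ?thesis unfolding pr hh_def groth_rel_def using m hD by simp
  qed
  have img: "groth_rel N `` {hh p} = H (groth_rel M `` {p})" if p: "p \<in> ?C" for p
  proof (intro equalityI subsetI)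
    fix w assume w: "w \<in> groth_rel N `` {hh p}"
    then have "w \<in> ?D" by (auto simp: groth_rel_def)
    then obtain r where r: "r \<in> ?C" "w = hh r" unfolding hhim[symmetric] by blast
    then have "(p, r) \<in> groth_rel M" using w rel[OF p r(1)] by blast
    then show "w \<in> H (groth_rel M `` {p})" unfolding H_def using r by blast
  next
    fix w assume "w \<in> H (groth_rel M `` {p})"
    then obtain r where r: "(p, r) \<in> groth_rel M" "w = hh r" unfolding H_def by blast
    then have "r \<in> ?C" using relM by blast
    then show "w \<in> groth_rel N `` {hh p}" using rel[OF p] r by blast
  qed
  have carM: "carrier (grothendieck_group M) = (\<lambda>p. groth_rel M `` {p}) ` ?C"
    and carN: "carrier (grothendieck_group N) = (\<lambda>p. groth_rel N `` {p}) ` ?D"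
    by (auto simp: grothendieck_group_def quotient_def)
  have sub: "U \<subseteq> ?C" if "U \<in> carrier (grothendieck_group M)" for U
    using that relM unfolding carM by blast
  have surj: "H ` carrier (grothendieck_group M) = carrier (grothendieck_group N)"
    unfolding carM carN hhim[symmetric] image_image by (intro image_cong) (auto simp: img)
  have "inj_on H (carrier (grothendieck_group M))"
    unfolding H_def using sub inj_on_image_eq_iff[OF hhinj] by (auto intro!: inj_onI)
  moreover have "H (U \<otimes>\<^bsub>grothendieck_group M\<^esub> V) = H U \<otimes>\<^bsub>grothendieck_group N\<^esub> H V"
    if U: "U \<subseteq> ?C" and V: "V \<subseteq> ?C" for U V
  proof -
    have step: "H (groth_rel M `` {(a \<otimes>\<^bsub>M\<^esub> c, b \<otimes>\<^bsub>M\<^esub> d)}) =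
        groth_rel N `` {(h a \<otimes>\<^bsub>N\<^esub> h c, h b \<otimes>\<^bsub>N\<^esub> h d)}"
      if "(a, b) \<in> U" "(c, d) \<in> V" for a b c d
    proof -
      have m: "a \<in> carrier M" "b \<in> carrier M" "c \<in> carrier M" "d \<in> carrier M" using that U V by auto
      have "(a \<otimes>\<^bsub>M\<^esub> c, b \<otimes>\<^bsub>M\<^esub> d) \<in> ?C" using m closed by simp
      from img[OF this] show ?thesis using m hom by (simp add: hh_def)
    qed
    have "H (U \<otimes>\<^bsub>grothendieck_group M\<^esub> V) =
        (\<Union>(a, b)\<in>U. \<Union>(c, d)\<in>V. H (groth_rel M `` {(a \<otimes>\<^bsub>M\<^esub> c, b \<otimes>\<^bsub>M\<^esub> d)}))"
      by (simp add: grothendieck_group_def H_def image_UN split_def)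
    also have "\<dots> = (\<Union>(a, b)\<in>U. \<Union>(c, d)\<in>V. groth_rel N `` {(h a \<otimes>\<^bsub>N\<^esub> h c, h b \<otimes>\<^bsub>N\<^esub> h d)})"
      using step by (intro SUP_cong HOL.refl) auto
    also have "\<dots> = H U \<otimes>\<^bsub>grothendieck_group N\<^esub> H V"
      by (simp add: grothendieck_group_def H_def hh_def split_def)
    finally show ?thesis .
  qed
  ultimately have "H \<in> iso (grothendieck_group M) (grothendieck_group N)"
    using sub surj unfolding iso_def hom_def bij_betw_def by auto
  then show ?thesis unfolding is_iso_def by blast
qed

theorem theorem4p5p15:
  fixes S :: "'a zsemigroup"
  assumes "orthogonally_complete S"
  shows "K_proj S \<cong> K_idem (Momega S)"
proof -
  interpret orthogonally_complete S by fact
  have step: "x \<otimes>\<^bsub>proj_monoid S\<^esub> y \<in> carrier (proj_monoid S) \<and>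
      class_idems (x \<otimes>\<^bsub>proj_monoid S\<^esub> y) =
      class_idems x \<otimes>\<^bsub>idem_monoid (Momega S)\<^esub> class_idems y"
    if xy: "x \<in> carrier (proj_monoid S)" "y \<in> carrier (proj_monoid S)" for x y
  proof -
    obtain P Q where P: "P \<in> Proj S" "x = iso_rel S `` {P}" and Q: "Q \<in> Proj S" "y = iso_rel S `` {Q}"
      using xy unfolding carrier_proj_monoid by blast
    obtain R where R: "R \<in> Proj S"
      "iso_rel S `` {P} \<otimes>\<^bsub>proj_monoid S\<^esub> iso_rel S `` {Q} = iso_rel S `` {R}"
      "basis_idems P \<otimes>\<^bsub>idem_monoid (Momega S)\<^esub> basis_idems Q = basis_idems R"
      by (rule class_idems_mult[OF P(1) Q(1)])
    show ?thesis
      unfolding P(2) Q(2) R(2) class_idems_class[OF P(1)] class_idems_class[OF Q(1)]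
        class_idems_class[OF R(1)] R(3) carrier_proj_monoid using R(1) by blast
  qed
  show ?thesis
    unfolding K_proj_def K_idem_def
    by (rule grothendieck_group_iso[OF bij_class_idems]) (use step in auto)
qed

end
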